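(* Let $X$ be an infinite dimensional complex Banach space and let $T\in L(X)$, with dual operator $T^*\in L(X^* )$. Then: (i) $T$ satisfies property $(z)$ if and only if $T^*$ has the SVEP on $\mathbb{C}\setminus\sigma_{uw}(T)$ and $\pi_{00}^a(T)=p_{00}^a(T)$. In particular, if $T$ is finitely a-polaroid, then $T$ satisfies property $(z)$ if and only if $T^*$ has the SVEP on $\mathbb{C}\setminus\sigma_{uw}(T)$. (ii) $T$ satisfies property $(gz)$ if and only if $T^*$ has the SVEP on $\mathbb{C}\setminus\sigma_{uw}(T)$ and $\pi_{0}^a(T)=p_{0}^a(T)$. In particular, if $T$ is a-polaroid, then $T$ satisfies property $(gz)$ if and only if $T^*$ has the SVEP on $\mathbb{C}\setminus\sigma_{uw}(T)$. (iii) $T^*$ satisfies property $(z)$ if and only if $T$ has the SVEP on $\mathbb{C}\setminus\sigma_{lw}(T)$ and $\pi_{00}^a(T^* )=p_{00}^a(T^* )$. (iv) $T^*$ satisfies property $(gz)$ if and only if $T$ has the SVEP on $\mathbb{C}\setminus\sigma_{lw}(T)$ and $\pi_{0}^a(T^* )=p_{0}^a(T^* )$.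
   Context: $L(X)$ is the algebra of bounded linear operators on $X$. For a bounded operator $T$ (on $X$, and likewise on any Banach space such as $X^*$): $N(T)$ is the kernel, $R(T)$ the range, $\alpha(T)=\dim N(T)$, $\beta(T)=\operatorname{codim} R(T)$; $\sigma(T)$ is the spectrum and $\sigma_a(T)$ the approximate point spectrum; $\mathrm{iso}\,A$ is the set of isolated points of $A\subset\mathbb{C}$. $T$ is upper semi-Fredholm if $R(T)$ is closed and $\alpha(T)<\infty$; lower semi-Fredholm if $R(T)$ is closed and $\beta(T)<\infty$; in either case $\operatorname{ind}T=\alpha(T)-\beta(T)$. $T$ is upper semi-Weyl if it is upper semi-Fredholm with $\operatorname{ind}T\le 0$, and lower semi-Weyl if it is lower semi-Fredholm with $\operatorname{ind}T\ge 0$. $T$ is upper semi b-Weyl if there is an integer $n\ge 0$ such that $R(T^n)$ is closed and the restriction $T_n:R(T^n)\to R(T^n)$ of $T$ is upper semi-Weyl. $\sigma_{uw}(T)$, $\sigma_{lw}(T)$, $\sigma_{ubw}(T)$ are the sets of $\lambda\in\mathbb{C}$ such that $T-\lambda I$ is not upper semi-Weyl, not lower semi-Weyl, not upper semi b-Weyl, respectively. The ascent is $a(T)=\inf\{n\ge 0: N(T^n)=N(T^{n+1})\}$ ($\inf\emptyset=\infty$). A point $\lambda\in\sigma_a(T)$ is a left pole of $T$ if $p=a(T-\lambda I)<\infty$ and $R((T-\lambda I)^{p+1})$ is closed; it is of finite rank if moreover $\alpha(T-\lambda I)<\infty$. $p_0^a(T)$ is the set of left poles of $T$ and $p_{00}^a(T)$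 the set of left poles of finite rank. $\sigma_p(T)$ is the set of eigenvalues and $\sigma_p^0(T)$ the set of eigenvalues of finite multiplicity ($0<\alpha(T-\lambda I)<\infty$). $\pi_0^a(T)=\mathrm{iso}\,\sigma_a(T)\cap\sigma_p(T)$, $\pi_{00}^a(T)=\mathrm{iso}\,\sigma_a(T)\cap\sigma_p^0(T)$. $T$ satisfies property $(z)$ if $\sigma(T)\setminus\sigma_{uw}(T)=\pi_{00}^a(T)$, and property $(gz)$ if $\sigma(T)\setminus\sigma_{ubw}(T)=\pi_0^a(T)$. $T$ is a-polaroid if every isolated point of $\sigma_a(T)$ is a left pole of $T$, and finitely a-polaroid if every isolated point of $\sigma_a(T)$ is a left pole of $T$ of finite rank. $T$ has the SVEP at $\lambda_0\in\mathbb{C}$ if for every open neighborhood $U$ of $\lambda_0$ the only analytic function $f:U\to X$ with $(T-\lambda I)f(\lambda)=0$ for all $\lambda\in U$ is $f\equiv 0$; SVEP on a set means SVEP at each of its points.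
   Formalization: In the definition of the SVEP at a point, the open neighborhoods U are required to be connected; with arbitrary open neighborhoods the SVEP at one point would force it everywhere and the equivalences would fail. *)

theory Defs
  imports "HOL-Analysis.Analysis"
begin

section \<open>Complex Banach spaces\<close>

class complex_normed_vector = real_normed_vector +
  fixes scaleC :: "complex \<Rightarrow> 'a \<Rightarrow> 'a"  (infixr "*\<^sub>C" 75)
  assumes scaleC_add_right: "c *\<^sub>C (x + y) = c *\<^sub>C x + c *\<^sub>C y"
    and scaleC_add_left: "(c + d) *\<^sub>C x = c *\<^sub>C x + d *\<^sub>C x"
    and scaleC_scaleC: "c *\<^sub>C d *\<^sub>C x = (c * d) *\<^sub>C x"
    and scaleC_one: "1 *\<^sub>C x = x"
    and scaleC_of_real: "complex_of_real r *\<^sub>C x = r *\<^sub>R x"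
    and norm_scaleC: "norm (c *\<^sub>C x) = cmod c * norm x"

class complex_banach = complex_normed_vector + complete_space

global_interpretation complex_vector:
  vector_space "scaleC :: complex \<Rightarrow> 'a \<Rightarrow> 'a::complex_normed_vector"
  by unfold_locales
    (auto simp: scaleC_add_right scaleC_add_left scaleC_scaleC scaleC_one)

definition bounded_clinear ::
  "('a::complex_normed_vector \<Rightarrow> 'b::complex_normed_vector) \<Rightarrow> bool" where
  "bounded_clinear T \<longleftrightarrow> bounded_linear T \<and> (\<forall>c x. T (c *\<^sub>C x) = c *\<^sub>C T x)"


section \<open>The dual space and the dual operator\<close>

typedef (overloaded) 'a cdual =
  "{f :: 'a::complex_normed_vector \<Rightarrow>\<^sub>L complex. \<forall>c x. blinfun_apply f (c *\<^sub>C x) = c * blinfun_apply f x}"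
  by (rule exI[of _ 0]) simp

setup_lifting type_definition_cdual

instantiation cdual :: (complex_normed_vector) complex_normed_vector
begin

lift_definition zero_cdual :: "'a cdual" is 0 by simp
lift_definition plus_cdual :: "'a cdual \<Rightarrow> 'a cdual \<Rightarrow> 'a cdual" is "(+)"
  by (simp add: blinfun.add_left distrib_left)
lift_definition minus_cdual :: "'a cdual \<Rightarrow> 'a cdual \<Rightarrow> 'a cdual" is "(-)"
  by (simp add: blinfun.diff_left right_diff_distrib)
lift_definition uminus_cdual :: "'a cdual \<Rightarrow> 'a cdual" is uminus
  by (simp add: blinfun.minus_left)
lift_definition scaleR_cdual :: "real \<Rightarrow> 'a cdual \<Rightarrow> 'a cdual" is "(*\<^sub>R)"
  by (simp add: blinfun.scaleR_left)
lift_definition scaleC_cdual :: "complex \<Rightarrow> 'a cdual \<Rightarrow> 'a cdual"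
  is "\<lambda>c f. blinfun_mult_right c o\<^sub>L f"
  by simp
lift_definition norm_cdual :: "'a cdual \<Rightarrow> real" is norm .
definition sgn_cdual :: "'a cdual \<Rightarrow> 'a cdual" where
  "sgn_cdual f = inverse (norm f) *\<^sub>R f"
definition dist_cdual :: "'a cdual \<Rightarrow> 'a cdual \<Rightarrow> real" where
  "dist_cdual f g = norm (f - g)"
definition uniformity_cdual :: "('a cdual \<times> 'a cdual) filter" where
  "uniformity_cdual = (INF e\<in>{0<..}. principal {(f, g). dist f g < e})"
definition open_cdual :: "'a cdual set \<Rightarrow> bool" where
  "open_cdual U = (\<forall>f\<in>U. eventually (\<lambda>(f', g). f' = f \<longrightarrow> g \<in> U) uniformity)"

instance
proof
  fix f g h :: "'a cdual" and r s :: real and c d :: complex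
  show "f + g + h = f + (g + h)" by transfer simp
  show "f + g = g + f" by transfer simp
  show "0 + f = f" by transfer simp
  show "- f + f = 0" by transfer simp
  show "f - g = f + - g" by transfer simp
  show "r *\<^sub>R (f + g) = r *\<^sub>R f + r *\<^sub>R g" by transfer (simp add: scaleR_add_right)
  show "(r + s) *\<^sub>R f = r *\<^sub>R f + s *\<^sub>R f" by transfer (simp add: scaleR_add_left)
  show "r *\<^sub>R s *\<^sub>R f = (r * s) *\<^sub>R f" by transfer simp
  show "1 *\<^sub>R f = f" by transfer simp
  show "sgn f = inverse (norm f) *\<^sub>R f" by (fact sgn_cdual_def)
  show "dist f g = norm (f - g)" by (fact dist_cdual_def)
  show "(norm f = 0) = (f = 0)" by transfer simp
  show "norm (f + g) \<le> norm f + norm g" by transfer (rule norm_triangle_ineq)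
  show "norm (r *\<^sub>R f) = \<bar>r\<bar> * norm f" by transfer simp
  show "c *\<^sub>C (f + g) = c *\<^sub>C f + c *\<^sub>C g"
    by transfer (auto intro!: blinfun_eqI simp: blinfun.add_left distrib_left)
  show "(c + d) *\<^sub>C f = c *\<^sub>C f + d *\<^sub>C f"
    by transfer (auto intro!: blinfun_eqI simp: blinfun.add_left distrib_right)
  show "c *\<^sub>C d *\<^sub>C f = (c * d) *\<^sub>C f"
    by transfer (auto intro!: blinfun_eqI)
  show "1 *\<^sub>C f = f"
    by transfer (auto intro!: blinfun_eqI)
  show "complex_of_real r *\<^sub>C f = r *\<^sub>R f"
    by transfer (auto intro!: blinfun_eqI simp: blinfun.scaleR_left scaleR_conv_of_real)
  show "norm (c *\<^sub>C f) = cmod c * norm f"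
  proof transfer
    fix c :: complex and f :: "'a \<Rightarrow>\<^sub>L complex"
    have "norm (blinfun_mult_right c o\<^sub>L f) = onorm (\<lambda>x. c * blinfun_apply f x)"
      by (simp add: norm_blinfun.rep_eq ext[of "blinfun_apply (blinfun_mult_right c o\<^sub>L f)"])
    also have "\<dots> = cmod c * norm f"
    proof (rule antisym)
      show "onorm (\<lambda>x. c * blinfun_apply f x) \<le> cmod c * norm f"
        by (rule onorm_bound) (auto simp: norm_mult mult.assoc intro!: mult_left_mono norm_blinfun)
      show "cmod c * norm f \<le> onorm (\<lambda>x. c * blinfun_apply f x)"
      proof (cases "c = 0")
        case True
        then show ?thesis by (simp add: onorm_zero)
      next
        case False
        have bl: "bounded_linear (\<lambda>x. c * blinfun_apply f x)"
          by (intro bounded_linear_const_mult blinfun.bounded_linear_right)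
        have "norm f \<le> onorm (\<lambda>x. c * blinfun_apply f x) / cmod c"
        proof (rule norm_blinfun_bound)
          show "0 \<le> onorm (\<lambda>x. c * blinfun_apply f x) / cmod c"
            using onorm_pos_le[OF bl] by simp
          show "norm (blinfun_apply f x) \<le> onorm (\<lambda>x. c * blinfun_apply f x) / cmod c * norm x" for x
            using onorm[OF bl, of x] False by (simp add: norm_mult field_simps)
        qed
        then show ?thesis using False by (simp add: field_simps)
      qed
    qed
    finally show "norm (blinfun_mult_right c o\<^sub>L f) = cmod c * norm f" .
  qed
qed (fact uniformity_cdual_def open_cdual_def)+

end

lift_definition cdual_apply :: "'a::complex_normed_vector cdual \<Rightarrow> 'a \<Rightarrow> complex"
  is blinfun_apply .

instance cdual :: (complex_normed_vector) complex_banach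
proof
  fix X :: "nat \<Rightarrow> 'a cdual"
  assume X: "Cauchy X"
  have dist_Rep: "dist (Rep_cdual f) (Rep_cdual g) = dist f g" for f g :: "'a cdual"
    unfolding dist_norm by transfer simp
  have "Cauchy (\<lambda>n. Rep_cdual (X n))"
    using X unfolding Cauchy_def dist_Rep .
  then obtain l where l: "(\<lambda>n. Rep_cdual (X n)) \<longlonglongrightarrow> l"
    by (auto simp: Cauchy_convergent_iff convergent_def)
  have "blinfun_apply l (c *\<^sub>C x) = c * blinfun_apply l x" for c x
  proof (rule LIMSEQ_unique)
    show "(\<lambda>n. blinfun_apply (Rep_cdual (X n)) (c *\<^sub>C x)) \<longlonglongrightarrow> blinfun_apply l (c *\<^sub>C x)"
      by (intro tendsto_intros l)
    have "(\<lambda>n. c * blinfun_apply (Rep_cdual (X n)) x) \<longlonglongrightarrow> c * blinfun_apply l x"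
      by (intro tendsto_intros l)
    moreover have "blinfun_apply (Rep_cdual (X n)) (c *\<^sub>C x) = c * blinfun_apply (Rep_cdual (X n)) x" for n
      using Rep_cdual[of "X n"] by simp
    ultimately show "(\<lambda>n. blinfun_apply (Rep_cdual (X n)) (c *\<^sub>C x)) \<longlonglongrightarrow> c * blinfun_apply l x"
      by simp
  qed
  then have "Rep_cdual (Abs_cdual l) = l"
    by (intro Abs_cdual_inverse) simp
  then have "dist (X n) (Abs_cdual l) = dist (Rep_cdual (X n)) l" for n
    by (metis dist_Rep)
  then have "X \<longlonglongrightarrow> Abs_cdual l"
    using l by (simp add: tendsto_dist_iff[of X] tendsto_dist_iff[of "\<lambda>n. Rep_cdual (X n)"])
  then show "convergent X"
    by (auto simp: convergent_def)
qed

text \<open>The dual operator \<open>f \<mapsto> f \<circ> T\<close>; meaningful only for bounded \<open>T\<close>,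
  see \<open>cdual_apply_dual_op\<close>.\<close>

definition dual_op ::
  "('a::complex_normed_vector \<Rightarrow> 'a) \<Rightarrow> 'a cdual \<Rightarrow> 'a cdual" where
  "dual_op T f = Abs_cdual (Blinfun (\<lambda>x. cdual_apply f (T x)))"

lemma cdual_apply_dual_op:
  assumes "bounded_clinear T"
  shows "cdual_apply (dual_op T f) x = cdual_apply f (T x)"
proof -
  let ?g = "\<lambda>x. cdual_apply f (T x)"
  have "bounded_linear ?g"
    using assms unfolding bounded_clinear_def cdual_apply.rep_eq
    by (auto intro: bounded_linear_compose[OF blinfun.bounded_linear_right])
  then have g: "blinfun_apply (Blinfun ?g) = ?g"
    by (rule bounded_linear_Blinfun_apply)
  have "?g (c *\<^sub>C x) = c * ?g x" for c x
    using assms Rep_cdual[of f] by (simp add: bounded_clinear_def cdual_apply.rep_eq)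
  then have "Rep_cdual (Abs_cdual (Blinfun ?g)) = Blinfun ?g"
    by (intro Abs_cdual_inverse) (simp add: g)
  then show ?thesis
    by (simp add: dual_op_def cdual_apply.rep_eq g[unfolded cdual_apply.rep_eq])
qed


section \<open>Dimension and codimension\<close>

definition edim :: "'a::complex_normed_vector set \<Rightarrow> enat" where
  "edim S = (if \<exists>B. finite B \<and> S \<subseteq> complex_vector.span B
     then enat (complex_vector.dim S) else \<infinity>)"

text \<open>The dimension of the quotient space \<open>M / N\<close> for subspaces \<open>N \<subseteq> M\<close>: the least
  cardinality of a finite subset of \<open>M\<close> whose classes span \<open>M / N\<close>, and \<open>\<infinity>\<close>
  (the infimum of the empty set) if there is none.\<close>

definition ecodim_in ::
  "'a::complex_normed_vector set \<Rightarrow> 'a set \<Rightarrow> enat" where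
  "ecodim_in M N = (INF B\<in>{B. finite B \<and> B \<subseteq> M \<and> M \<subseteq> complex_vector.span (N \<union> B)}. enat (card B))"


section \<open>Semi-Fredholm and semi-Weyl operators\<close>

text \<open>The predicates below take a closed \<open>T\<close>-invariant subspace \<open>M\<close> and refer to the restriction
  \<open>T : M \<rightarrow> M\<close>, since the notion of a b-Weyl operator needs the restrictions of \<open>T\<close> to
  \<open>R(T\<^sup>n)\<close>; \<open>M = UNIV\<close> gives the notions for \<open>T\<close> itself.\<close>

definition nullity_on :: "'a::complex_normed_vector set \<Rightarrow> ('a \<Rightarrow> 'a) \<Rightarrow> enat" where
  "nullity_on M T = edim {x\<in>M. T x = 0}"

definition deficiency_on :: "'a::complex_normed_vector set \<Rightarrow> ('a \<Rightarrow> 'a) \<Rightarrow> enat" where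
  "deficiency_on M T = ecodim_in M (T ` M)"

definition upper_semi_fredholm_on ::
  "'a::complex_normed_vector set \<Rightarrow> ('a \<Rightarrow> 'a) \<Rightarrow> bool" where
  "upper_semi_fredholm_on M T \<longleftrightarrow> closed (T ` M) \<and> nullity_on M T < \<infinity>"

definition lower_semi_fredholm_on ::
  "'a::complex_normed_vector set \<Rightarrow> ('a \<Rightarrow> 'a) \<Rightarrow> bool" where
  "lower_semi_fredholm_on M T \<longleftrightarrow> closed (T ` M) \<and> deficiency_on M T < \<infinity>"

text \<open>The index lies in \<open>\<int> \<union> {-\<infinity>, \<infinity>}\<close>; it is used only for semi-Fredholm operators, where
  \<open>\<infinity> - \<infinity>\<close> does not occur.\<close>

definition fredholm_index_on :: "'a::complex_normed_vector set \<Rightarrow> ('a \<Rightarrow> 'a) \<Rightarrow> ereal" where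
  "fredholm_index_on M T = ereal_of_enat (nullity_on M T) - ereal_of_enat (deficiency_on M T)"

definition upper_semi_weyl_on ::
  "'a::complex_normed_vector set \<Rightarrow> ('a \<Rightarrow> 'a) \<Rightarrow> bool" where
  "upper_semi_weyl_on M T \<longleftrightarrow> upper_semi_fredholm_on M T \<and> fredholm_index_on M T \<le> 0"

definition lower_semi_weyl_on ::
  "'a::complex_normed_vector set \<Rightarrow> ('a \<Rightarrow> 'a) \<Rightarrow> bool" where
  "lower_semi_weyl_on M T \<longleftrightarrow> lower_semi_fredholm_on M T \<and> fredholm_index_on M T \<ge> 0"

abbreviation nullity :: "('a::complex_normed_vector \<Rightarrow> 'a) \<Rightarrow> enat" where
  "nullity \<equiv> nullity_on UNIV"

abbreviation upper_semi_weyl :: "('a::complex_normed_vector \<Rightarrow> 'a) \<Rightarrow> bool" where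
  "upper_semi_weyl \<equiv> upper_semi_weyl_on UNIV"

abbreviation lower_semi_weyl :: "('a::complex_normed_vector \<Rightarrow> 'a) \<Rightarrow> bool" where
  "lower_semi_weyl \<equiv> lower_semi_weyl_on UNIV"

definition upper_semi_b_weyl :: "('a::complex_normed_vector \<Rightarrow> 'a) \<Rightarrow> bool" where
  "upper_semi_b_weyl T \<longleftrightarrow>
     (\<exists>n. closed (range (T ^^ n)) \<and> upper_semi_weyl_on (range (T ^^ n)) T)"


section \<open>Spectra\<close>

definition shift_op :: "('a::complex_normed_vector \<Rightarrow> 'a) \<Rightarrow> complex \<Rightarrow> 'a \<Rightarrow> 'a" where
  "shift_op T \<mu> = (\<lambda>x. T x - \<mu> *\<^sub>C x)"

definition op_spectrum :: "('a::complex_normed_vector \<Rightarrow> 'a) \<Rightarrow> complex set" where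
  "op_spectrum T = {\<mu>. \<not> (\<exists>S. bounded_clinear S \<and> S \<circ> shift_op T \<mu> = id \<and> shift_op T \<mu> \<circ> S = id)}"

definition approx_point_spectrum :: "('a::complex_normed_vector \<Rightarrow> 'a) \<Rightarrow> complex set" where
  "approx_point_spectrum T =
     {\<mu>. \<exists>x. (\<forall>n::nat. norm (x n) = 1) \<and> (\<lambda>n. shift_op T \<mu> (x n)) \<longlonglongrightarrow> 0}"

definition upper_weyl_spectrum :: "('a::complex_normed_vector \<Rightarrow> 'a) \<Rightarrow> complex set" where
  "upper_weyl_spectrum T = {\<mu>. \<not> upper_semi_weyl (shift_op T \<mu>)}"

definition lower_weyl_spectrum :: "('a::complex_normed_vector \<Rightarrow> 'a) \<Rightarrow> complex set" where
  "lower_weyl_spectrum T = {\<mu>. \<not> lower_semi_weyl (shift_op T \<mu>)}"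

definition upper_b_weyl_spectrum :: "('a::complex_normed_vector \<Rightarrow> 'a) \<Rightarrow> complex set" where
  "upper_b_weyl_spectrum T = {\<mu>. \<not> upper_semi_b_weyl (shift_op T \<mu>)}"

definition point_spectrum :: "('a::complex_normed_vector \<Rightarrow> 'a) \<Rightarrow> complex set" where
  "point_spectrum T = {\<mu>. \<exists>x. x \<noteq> 0 \<and> T x = \<mu> *\<^sub>C x}"

definition finite_point_spectrum :: "('a::complex_normed_vector \<Rightarrow> 'a) \<Rightarrow> complex set" where
  "finite_point_spectrum T =
     {\<mu>. 0 < nullity (shift_op T \<mu>) \<and> nullity (shift_op T \<mu>) < \<infinity>}"

definition isolated_points :: "complex set \<Rightarrow> complex set" where
  "isolated_points A = {\<mu>. \<mu> isolated_in A}"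


section \<open>Left poles and the properties (z) and (gz)\<close>

definition ascent :: "('a::complex_normed_vector \<Rightarrow> 'a) \<Rightarrow> enat" where
  "ascent T = (INF n\<in>{n. {x. (T ^^ n) x = 0} = {x. (T ^^ (n + 1)) x = 0}}. enat n)"

definition left_poles :: "('a::complex_normed_vector \<Rightarrow> 'a) \<Rightarrow> complex set" where
  "left_poles T = {\<mu> \<in> approx_point_spectrum T.
     \<exists>p. ascent (shift_op T \<mu>) = enat p \<and> closed (range (shift_op T \<mu> ^^ (p + 1)))}"

definition left_poles_finite_rank :: "('a::complex_normed_vector \<Rightarrow> 'a) \<Rightarrow> complex set" where
  "left_poles_finite_rank T = {\<mu> \<in> left_poles T. nullity (shift_op T \<mu>) < \<infinity>}"

definition pi_0_a :: "('a::complex_normed_vector \<Rightarrow> 'a) \<Rightarrow> complex set" where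
  "pi_0_a T = isolated_points (approx_point_spectrum T) \<inter> point_spectrum T"

definition pi_00_a :: "('a::complex_normed_vector \<Rightarrow> 'a) \<Rightarrow> complex set" where
  "pi_00_a T = isolated_points (approx_point_spectrum T) \<inter> finite_point_spectrum T"

definition property_z :: "('a::complex_normed_vector \<Rightarrow> 'a) \<Rightarrow> bool" where
  "property_z T \<longleftrightarrow> op_spectrum T - upper_weyl_spectrum T = pi_00_a T"

definition property_gz :: "('a::complex_normed_vector \<Rightarrow> 'a) \<Rightarrow> bool" where
  "property_gz T \<longleftrightarrow> op_spectrum T - upper_b_weyl_spectrum T = pi_0_a T"

definition a_polaroid :: "('a::complex_normed_vector \<Rightarrow> 'a) \<Rightarrow> bool" where
  "a_polaroid T \<longleftrightarrow> isolated_points (approx_point_spectrum T) \<subseteq> left_poles T"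

definition finitely_a_polaroid :: "('a::complex_normed_vector \<Rightarrow> 'a) \<Rightarrow> bool" where
  "finitely_a_polaroid T \<longleftrightarrow>
     isolated_points (approx_point_spectrum T) \<subseteq> left_poles_finite_rank T"


section \<open>The single-valued extension property\<close>

text \<open>Vector-valued analyticity on an open set, as complex differentiability at each point
  (the library's \<open>holomorphic_on\<close> covers only scalar-valued functions).\<close>

definition vector_analytic_on ::
  "(complex \<Rightarrow> 'a::complex_normed_vector) \<Rightarrow> complex set \<Rightarrow> bool" where
  "vector_analytic_on f U \<longleftrightarrow>
     (\<forall>z\<in>U. \<exists>D. (f has_derivative (\<lambda>h. h *\<^sub>C D)) (at z))"

text \<open>The neighbourhoods range over connected open sets, as is usual. If disconnected ones were
  allowed, \<open>f\<close> could vanish near \<open>\<mu>\<^sub>0\<close> and be nonzero on another component, so that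
  the property at a single point would already imply the property at every point.\<close>

definition SVEP_at :: "('a::complex_normed_vector \<Rightarrow> 'a) \<Rightarrow> complex \<Rightarrow> bool" where
  "SVEP_at T \<mu>\<^sub>0 \<longleftrightarrow>
     (\<forall>U f. open U \<and> connected U \<and> \<mu>\<^sub>0 \<in> U \<and> vector_analytic_on f U \<and>
        (\<forall>\<mu>\<in>U. shift_op T \<mu> (f \<mu>) = 0) \<longrightarrow> (\<forall>\<mu>\<in>U. f \<mu> = 0))"

definition SVEP_on :: "('a::complex_normed_vector \<Rightarrow> 'a) \<Rightarrow> complex set \<Rightarrow> bool" where
  "SVEP_on T A \<longleftrightarrow> (\<forall>\<mu>\<in>A. SVEP_at T \<mu>)"

end

theory Submission
  imports Defs "HOL-Complex_Analysis.Conformal_Mappings"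
begin

text \<open>
  Every equivalence comes from one condition on the spectrum: \<open>T\<close> has \<^emph>\<open>isolated Weyl
  points\<close> (\<open>weyl_points_isolated\<close>) if every \<open>\<kappa>\<close> outside the upper semi-Weyl spectrum has a
  punctured neighbourhood in the resolvent set. Two facts about this condition are combined.

  \<^item> \<open>T\<close> satisfies (z) if and only if its Weyl points are isolated and
    \<open>\<pi>\<^sub>0\<^sub>0\<^sup>a(T) = p\<^sub>0\<^sub>0\<^sup>a(T)\<close>, and likewise for (gz) with \<open>\<pi>\<^sub>0\<^sup>a(T) = p\<^sub>0\<^sup>a(T)\<close>
    (\<open>property_z_iff\<close>, \<open>property_gz_iff\<close>). These are applied both to \<open>T\<close> and to \<open>T\<^sup>*\<close>.
  \<^item> The Weyl points of \<open>T\<close> are isolated if and only if \<open>T\<^sup>*\<close> has the SVEP off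
    \<open>\<sigma>\<^sub>u\<^sub>w(T)\<close>, and those of \<open>T\<^sup>*\<close> are isolated if and only if \<open>T\<close> has the SVEP off
    \<open>\<sigma>\<^sub>l\<^sub>w(T)\<close> (\<open>weyl_points_isolated_iff_SVEP_dual\<close>, \<open>weyl_points_isolated_dual_iff_SVEP\<close>).

  For the first fact, left poles always lie in \<open>\<pi>\<^sub>0\<^sup>a(T)\<close> and outside \<open>\<sigma>\<^sub>u\<^sub>b\<^sub>w(T)\<close>: on
  \<open>R(A\<^sup>n)\<close>, where \<open>A = T - \<kappa>\<close> and \<open>n\<close> exceeds the ascent by one, \<open>A\<close> is bounded below, and
  for \<open>\<mu> \<noteq> 0\<close> the operator \<open>A - \<mu>\<close> inherits this because \<open>z\<^sup>n\<close> and \<open>z - \<mu>\<close> are coprime.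
  Conversely, if \<open>A\<close> is upper semi b-Weyl and \<open>A - \<mu>\<close> is injective for \<open>\<mu>\<close> arbitrarily close
  to \<open>0\<close>, then \<open>\<kappa>\<close> satisfies the conditions of a left pole
  (\<open>left_pole_if_upper_semi_b_weyl\<close>). The injectivity is available at isolated points of
  \<open>\<sigma>\<^sub>a(T)\<close>, and at every point of \<open>\<sigma>(T) - \<sigma>\<^sub>u\<^sub>b\<^sub>w(T)\<close> once Weyl points are isolated.
  Since left poles always lie in \<open>\<pi>\<^sub>0\<^sup>a(T)\<close>, an a-polaroid operator has \<open>\<pi>\<^sub>0\<^sup>a(T) = p\<^sub>0\<^sup>a(T)\<close>, so that
  only the condition on Weyl points remains; the same holds with finite rank.

  The second fact rests on the identity theorem in one direction. In the other direction, near
  a Weyl point the kernel of \<open>A = T - \<mu>\<close> lies in \<open>R(A\<^sup>n)\<close> for all \<open>n\<close>. By duality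
  \<open>N((A\<^sup>*)\<^sup>n) \<subseteq> R(A\<^sup>*)\<close> for all \<open>n\<close>, so a nonzero vector in \<open>N(A\<^sup>*)\<close> would start an infinite
  backward orbit under \<open>A\<^sup>*\<close>, whose power series contradicts the SVEP. Hence \<open>R(A)\<close> is the
  whole space, and the sign of the index makes \<open>A\<close> invertible.

  Two devices replace the index theory of semi-Fredholm operators. An operator is upper
  semi-Weyl exactly if some finite-rank perturbation of it is bounded below, which makes
  stability under small shifts evident. And if \<open>x\<close> is a backward orbit of \<open>A\<close>, then
  \<open>(A - \<mu>) (\<Sum>\<^sub>k \<mu>\<^sup>k x\<^sub>k) = A x\<^sub>0\<close>; on the hyper-range \<open>\<Inter>\<^sub>n R(A\<^sup>n)\<close> this yields both the
  persistence of kernel vectors and the persistence of surjectivity.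
\<close>

section \<open>Open mappings and closed ranges\<close>

text \<open>Successive approximation: the residual is halved at each step while the corrections stay
  proportional to it, so the corrections sum to an exact preimage. The set \<open>Y\<close> is arbitrary so
  that it can be the range of \<open>A\<close>, as in the open mapping theorem, or its closure, in which case
  the conclusion says that the range is closed.\<close>

lemma exact_lift_of_approximate_lift:
  fixes A :: "'a::banach \<Rightarrow> 'b::real_normed_vector"
  assumes A: "bounded_linear A" and M: "subspace M" "closed M" and K: "K \<ge> 0"
    and stable: "\<And>y x. y \<in> Y \<Longrightarrow> x \<in> M \<Longrightarrow> y - A x \<in> Y"
    and approx: "\<And>y \<delta>. y \<in> Y \<Longrightarrow> \<delta> > 0 \<Longrightarrow> \<exists>x\<in>M. norm x \<le> K * norm y \<and> norm (y - A x) < \<delta>"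
    and y: "y \<in> Y"
  shows "\<exists>x\<in>M. A x = y \<and> norm x \<le> 2 * K * norm y"
proof (cases "y = 0")
  case True
  then show ?thesis
    using M(1) bounded_linear.linear[OF A]
    by (intro bexI[of _ 0]) (auto simp: subspace_0 linear_0)
next
  case False
  interpret A: bounded_linear A by (rule A)
  define P where "P n r x \<longleftrightarrow> x \<in> M \<and> norm x \<le> K * norm r \<and> norm (r - A x) < norm y / 2 ^ Suc n"
    for n r x
  have ex: "\<exists>x. P n r x" if "r \<in> Y" for n r
    using approx[OF that, of "norm y / 2 ^ Suc n"] False by (auto simp: P_def)
  define g where "g n r = (SOME x. P n r x)" for n r
  have g: "g n r \<in> M \<and> norm (g n r) \<le> K * norm r \<and> norm (r - A (g n r)) < norm y / 2 ^ Suc n"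
    if "r \<in> Y" for n r
    using someI_ex[OF ex[OF that], of n] by (simp add: g_def P_def)
  define r where "r = rec_nat y (\<lambda>n s. s - A (g n s))"
  have r0: "r 0 = y" and rS: "\<And>n. r (Suc n) = r n - A (g n (r n))"
    by (simp_all add: r_def)
  have rY: "r n \<in> Y" for n
    by (induction n) (auto simp: r0 rS y intro!: stable g[THEN conjunct1])
  define x where "x n = g n (r n)" for n
  have xM: "x n \<in> M" for n
    using g[OF rY] by (simp add: x_def)
  have rn: "norm (r n) \<le> norm y / 2 ^ n" for n
  proof (cases n)
    case 0 then show ?thesis by (simp add: r0)
  next
    case (Suc m) then show ?thesis using g[OF rY, of m m] by (simp add: rS)
  qed
  have xn: "norm (x n) \<le> (K * norm y) * (1/2) ^ n" for n
  proof -
    have "norm (x n) \<le> K * norm (r n)" using g[OF rY] by (simp add: x_def)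
    also have "\<dots> \<le> K * (norm y / 2 ^ n)" using rn K by (intro mult_left_mono)
    finally show ?thesis by (simp add: power_one_over)
  qed
  have sg: "summable (\<lambda>n. (K * norm y) * (1/2) ^ n)"
    by (intro summable_mult summable_geometric) simp
  have sn: "summable (\<lambda>n. norm (x n))"
    by (rule summable_comparison_test'[OF sg]) (use xn in simp)
  have sx: "summable x" by (rule summable_norm_cancel[OF sn])
  have "norm (suminf x) \<le> (\<Sum>n. norm (x n))" by (rule summable_norm[OF sn])
  also have "\<dots> \<le> (\<Sum>n. (K * norm y) * (1/2) ^ n)"
    by (rule suminf_le[OF xn sn sg])
  also have "\<dots> = 2 * K * norm y"
    by (subst suminf_mult) (auto simp: suminf_geometric)
  finally have bound: "norm (suminf x) \<le> 2 * K * norm y" .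
  have part: "(\<lambda>n. \<Sum>i<n. x i) \<longlonglongrightarrow> suminf x"
    using sx by (rule summable_LIMSEQ)
  have "suminf x \<in> M"
    by (rule closed_sequentially[OF M(2) _ part]) (use M(1) xM in \<open>auto intro: subspace_sum\<close>)
  moreover have "A (suminf x) = y"
  proof (rule LIMSEQ_unique)
    show "(\<lambda>n. A (\<Sum>i<n. x i)) \<longlonglongrightarrow> A (suminf x)" by (rule A.tendsto[OF part])
    have "A (\<Sum>i<n. x i) = y - r n" for n
      by (induction n) (auto simp: r0 rS x_def A.add A.zero)
    moreover have "r \<longlonglongrightarrow> 0"
    proof (rule Lim_null_comparison)
      show "\<forall>\<^sub>F n in sequentially. norm (r n) \<le> norm y * (1/2) ^ n"
        using rn by (simp add: power_one_over)
      show "(\<lambda>n. norm y * (1/2) ^ n) \<longlonglongrightarrow> 0"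
        by (intro tendsto_mult_right_zero LIMSEQ_power_zero) simp
    qed
    ultimately show "(\<lambda>n. A (\<Sum>i<n. x i)) \<longlonglongrightarrow> y"
      using tendsto_diff[OF tendsto_const, of r 0 sequentially y] by simp
  qed
  ultimately show ?thesis using bound by blast
qed

text \<open>The open mapping theorem for \<open>A\<close> restricted to a closed subspace: by Baire's theorem the
  image of some ball is dense in a ball of \<open>A ` M\<close>, which gives approximate preimages.\<close>

lemma open_mapping_on:
  fixes A :: "'a::banach \<Rightarrow> 'b::banach"
  assumes A: "bounded_linear A" and M: "subspace M" "closed M" and cl: "closed (A ` M)"
  obtains K where "K > 0" "\<And>y. y \<in> A ` M \<Longrightarrow> \<exists>x\<in>M. A x = y \<and> norm x \<le> K * norm y"
proof -
  interpret A: bounded_linear A by (rule A)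
  define Y where "Y = A ` M"
  define C where "C n = closure (A ` (M \<inter> cball 0 (real n)))" for n
  have Y: "closed Y" "subspace Y"
    using cl M(1) A.linear by (auto simp: Y_def linear_subspace_image)
  have CY: "C n \<subseteq> Y" for n
    unfolding C_def using Y(1) by (intro closure_minimal) (auto simp: Y_def)
  have UC: "\<Union>(range C) = Y"
  proof
    show "Y \<subseteq> \<Union>(range C)"
    proof
      fix y assume "y \<in> Y"
      then obtain x where x: "x \<in> M" "y = A x" by (auto simp: Y_def)
      obtain n where "norm x \<le> real n" using real_arch_simple by blast
      then have "y \<in> A ` (M \<inter> cball 0 (real n))" using x by auto
      then have "y \<in> C n" unfolding C_def by (rule subsetD[OF closure_subset])
      then show "y \<in> \<Union>(range C)" by blast
    qed
  qed (use CY in blast)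
  have "\<exists>n. top_of_set Y interior_of (C n) \<noteq> {}"
  proof (rule ccontr)
    assume "\<not> ?thesis"
    then have int: "top_of_set Y interior_of C n = {}" for n by blast
    have cl: "closedin (top_of_set Y) (C n)" for n
      by (rule closed_subset[OF CY]) (simp add: C_def)
    have "completely_metrizable_space (top_of_set Y)"
      using Y(1) by (intro completely_metrizable_space_closedin completely_metrizable_space_euclidean) simp
    then have "top_of_set Y interior_of \<Union>(range C) = {}"
      using int cl by (intro Baire_category_alt disjI1) blast+
    moreover have "top_of_set Y interior_of Y = Y"
      by (metis interior_of_topspace topspace_euclidean_subtopology)
    ultimately show False using UC Y(2) subspace_0 by auto
  qed
  then obtain n y0 where y0: "y0 \<in> top_of_set Y interior_of (C n)" by blast
  then obtain T where T: "openin (top_of_set Y) T" "T \<subseteq> C n" "y0 \<in> T"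
    by (auto simp: interior_of_def)
  then obtain e where e: "e > 0" "\<And>z. z \<in> Y \<Longrightarrow> dist z y0 < e \<Longrightarrow> z \<in> T"
    unfolding openin_euclidean_subtopology_iff by metis
  have y0C: "y0 \<in> C n" "y0 \<in> Y" using T CY by auto
  have near: "\<exists>x\<in>M. norm x \<le> 2 * real n \<and> norm (z - A x) < \<delta>"
    if z: "z \<in> Y" "norm z < e" and d: "\<delta> > 0" for z \<delta>
  proof -
    have "y0 + z \<in> C n"
      using e(2)[of "y0 + z"] z y0C(2) Y(2) T(2) by (auto simp: dist_norm subspace_add)
    then obtain x1 where x1: "x1 \<in> M" "norm x1 \<le> real n" "dist (A x1) (y0 + z) < \<delta>/2"
      unfolding C_def closure_approachable using d by (force dest: spec[of _ "\<delta>/2"])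
    obtain x2 where x2: "x2 \<in> M" "norm x2 \<le> real n" "dist (A x2) y0 < \<delta>/2"
      using y0C(1) unfolding C_def closure_approachable using d by (force dest: spec[of _ "\<delta>/2"])
    have "z - A (x1 - x2) = (A x2 - y0) - (A x1 - (y0 + z))" by (simp add: A.diff)
    then have "norm (z - A (x1 - x2)) \<le> norm (A x2 - y0) + norm (A x1 - (y0 + z))"
      by (metis norm_triangle_ineq4)
    then have "norm (z - A (x1 - x2)) < \<delta>" using x1(3) x2(3) by (simp add: dist_norm)
    moreover have "norm (x1 - x2) \<le> 2 * real n"
      using norm_triangle_ineq4[of x1 x2] x1 x2 by simp
    ultimately show ?thesis using x1(1) x2(1) M(1) by (meson subspace_diff)
  qed
  \<comment> \<open>A vector of norm \<open>e / 2\<close> has approximate preimages of norm \<open>2 n\<close>; rescaling gives this bound.\<close>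
  define K where "K = 4 * real n / e"
  have K0: "K \<ge> 0" using e(1) by (simp add: K_def)
  have approx: "\<exists>x\<in>M. norm x \<le> K * norm y \<and> norm (y - A x) < \<delta>"
    if y: "y \<in> Y" and d: "\<delta> > 0" for y \<delta>
  proof (cases "y = 0")
    case True
    then show ?thesis using M(1) d by (intro bexI[of _ 0]) (auto simp: subspace_0 A.zero)
  next
    case False
    define t where "t = 2 * norm y / e"
    have t: "t > 0" using False e(1) by (simp add: t_def)
    have "norm ((1/t) *\<^sub>R y) < e" using False e(1) by (simp add: t_def)
    moreover have "(1/t) *\<^sub>R y \<in> Y" using y Y(2) by (auto intro: subspace_scale)
    ultimately obtain x where x: "x \<in> M" "norm x \<le> 2 * real n" "norm ((1/t) *\<^sub>R y - A x) < \<delta> / t"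
      using near[of "(1/t) *\<^sub>R y" "\<delta>/t"] d t by auto
    have "y - A (t *\<^sub>R x) = t *\<^sub>R ((1/t) *\<^sub>R y - A x)"
      using t by (simp add: A.scaleR scaleR_diff_right)
    then have "norm (y - A (t *\<^sub>R x)) = t * norm ((1/t) *\<^sub>R y - A x)"
      using t by (metis abs_of_pos norm_scaleR)
    then have "norm (y - A (t *\<^sub>R x)) < \<delta>"
      using x(3) t by (simp only: pos_less_divide_eq mult.commute)
    moreover have "norm (t *\<^sub>R x) \<le> K * norm y"
    proof -
      have "norm (t *\<^sub>R x) \<le> t * (2 * real n)" using x(2) t by (simp add: mult_left_mono)
      also have "\<dots> = K * norm y" by (simp add: t_def K_def)
      finally show ?thesis .
    qed
    ultimately show ?thesis using x(1) M(1) by (meson subspace_scale)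
  qed
  have "\<exists>x\<in>M. A x = y \<and> norm x \<le> 2 * K * norm y" if "y \<in> Y" for y
    by (rule exact_lift_of_approximate_lift[OF A M K0 _ approx that])
      (use Y(2) in \<open>auto simp: Y_def intro: subspace_diff\<close>)
  then have "\<exists>x\<in>M. A x = y \<and> norm x \<le> (2 * K + 1) * norm y" if "y \<in> A ` M" for y
    using that unfolding Y_def
    by (meson mult_right_mono norm_ge_zero order_trans less_eq_real_def less_add_one)
  moreover have "2 * K + 1 > 0" using K0 by simp
  ultimately show ?thesis using that by blast
qed

text \<open>If \<open>A s\<^sub>n\<close> converges to \<open>A x\<close>, the open mapping theorem supplies \<open>u\<^sub>n \<rightarrow> 0\<close> with
  \<open>A (x - u\<^sub>n) = A s\<^sub>n\<close>. Saturation puts \<open>x - u\<^sub>n\<close>, and hence its limit \<open>x\<close>, into \<open>S\<close>.\<close>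

lemma closed_image_if_saturated:
  fixes A :: "'a::banach \<Rightarrow> 'b::banach"
  assumes A: "bounded_linear A" and M: "subspace M" "closed M" and cl: "closed (A ` M)"
    and S: "closed S" "S \<subseteq> M"
    and saturated: "\<And>s x. s \<in> S \<Longrightarrow> x \<in> M \<Longrightarrow> A x = A s \<Longrightarrow> x \<in> S"
  shows "closed (A ` S)"
proof -
  interpret A: bounded_linear A by (rule A)
  obtain K where K: "K > 0" "\<And>y. y \<in> A ` M \<Longrightarrow> \<exists>x\<in>M. A x = y \<and> norm x \<le> K * norm y"
    using open_mapping_on[OF A M cl] by blast
  show ?thesis unfolding closed_sequential_limits
  proof (intro allI impI, elim conjE)
    fix f l assume f: "\<forall>n. f n \<in> A ` S" and l: "f \<longlonglongrightarrow> l"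
    from f obtain s where s: "\<And>n. s n \<in> S" "\<And>n. f n = A (s n)" unfolding image_iff by metis
    have "l \<in> A ` M"
      using closed_sequentially[OF cl _ l] f S(2) by blast
    then obtain x where x: "x \<in> M" "l = A x" by blast
    have "\<exists>u\<in>M. A u = l - f n \<and> norm u \<le> K * norm (l - f n)" for n
      using K(2)[of "l - f n"] x s S(2) M(1)
      by (metis A.diff imageI subsetD subspace_diff)
    then obtain u where u: "\<And>n. u n \<in> M" "\<And>n. A (u n) = l - f n"
        "\<And>n. norm (u n) \<le> K * norm (l - f n)" by metis
    have "(\<lambda>n. l - f n) \<longlonglongrightarrow> 0" using tendsto_diff[OF tendsto_const l, of l] by simp
    then have "(\<lambda>n. K * norm (l - f n)) \<longlonglongrightarrow> 0"
      by (intro tendsto_mult_right_zero tendsto_norm_zero)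
    then have "u \<longlonglongrightarrow> 0"
      by (rule Lim_null_comparison[rotated]) (simp add: u(3))
    then have lim: "(\<lambda>n. x - u n) \<longlonglongrightarrow> x" using tendsto_diff[OF tendsto_const, of u 0 _ x] by simp
    have "x - u n \<in> S" for n
    proof (rule saturated[OF s(1)[of n]])
      show "x - u n \<in> M" using M(1) x(1) u(1) by (rule subspace_diff)
      show "A (x - u n) = A (s n)" using x(2) u(2)[of n] s(2)[of n] by (simp add: A.diff)
    qed
    then have "x \<in> S" using closed_sequentially[OF S(1) _ lim] by simp
    then show "l \<in> A ` S" using x by blast
  qed
qed

text \<open>Closedness of the range of a product passes to the first factor when only a closed part of
  \<open>R(B)\<close> is invisible to \<open>C\<close>: if \<open>B x\<^sub>n \<rightarrow> l\<close>, then up to null sequences \<open>x\<^sub>n\<close> differs from a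
  fixed vector by elements of \<open>N(C B)\<close>.\<close>

lemma closed_range_of_factor:
  fixes B :: "'a::banach \<Rightarrow> 'b::banach" and C :: "'b \<Rightarrow> 'c::banach"
  assumes B: "bounded_linear B" and C: "bounded_linear C"
    and cl: "closed (range (\<lambda>x. C (B x)))" and ker: "closed (B ` {x. C (B x) = 0})"
  shows "closed (range B)"
proof -
  interpret B: bounded_linear B by (rule B)
  interpret C: bounded_linear C by (rule C)
  have CB: "bounded_linear (\<lambda>x. C (B x))" by (rule bounded_linear_compose[OF C B])
  obtain K where K: "K > 0"
      "\<And>y. y \<in> range (\<lambda>x. C (B x)) \<Longrightarrow> \<exists>x\<in>UNIV. C (B x) = y \<and> norm x \<le> K * norm y"
    using open_mapping_on[OF CB subspace_UNIV closed_UNIV cl] by blast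
  show ?thesis unfolding closed_sequential_limits
  proof (intro allI impI, elim conjE)
    fix f l assume f: "\<forall>n. f n \<in> range B" and l: "f \<longlonglongrightarrow> l"
    from f obtain x where x: "\<And>n. f n = B (x n)" unfolding image_iff by metis
    have Cl: "(\<lambda>n. C (f n)) \<longlonglongrightarrow> C l" by (rule C.tendsto[OF l])
    have "C l \<in> range (\<lambda>x. C (B x))"
      using closed_sequentially[OF cl _ Cl] x by auto
    then obtain z where z: "C l = C (B z)" by blast
    have "\<exists>u. C (B u) = C (f n) - C l \<and> norm u \<le> K * norm (C (f n) - C l)" for n
      using K(2)[of "C (f n) - C l"] x z
      by (metis B.diff C.diff rangeI)
    then obtain u where u: "\<And>n. C (B (u n)) = C (f n) - C l"
        "\<And>n. norm (u n) \<le> K * norm (C (f n) - C l)" by metis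
    have "(\<lambda>n. C (f n) - C l) \<longlonglongrightarrow> 0" using Cl by (simp add: LIM_zero)
    then have "(\<lambda>n. K * norm (C (f n) - C l)) \<longlonglongrightarrow> 0"
      by (intro tendsto_mult_right_zero tendsto_norm_zero)
    then have u0: "u \<longlonglongrightarrow> 0"
      by (rule Lim_null_comparison[rotated]) (simp add: u(2))
    have "(\<lambda>n. f n - B z - B (u n)) \<longlonglongrightarrow> l - B z - 0"
      by (intro tendsto_diff tendsto_const l) (use B.tendsto[OF u0] in \<open>simp add: B.zero\<close>)
    then have lim: "(\<lambda>n. f n - B z - B (u n)) \<longlonglongrightarrow> l - B z" by simp
    have "f n - B z - B (u n) \<in> B ` {x. C (B x) = 0}" for n
      by (rule image_eqI[of _ _ "x n - z - u n"]) (auto simp: x B.diff C.diff u z)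
    then have "l - B z \<in> B ` {x. C (B x) = 0}"
      using closed_sequentially[OF ker _ lim] by simp
    then obtain k where "l - B z = B k" by blast
    then have "l = B (k + z)" by (simp add: B.add algebra_simps)
    then show "l \<in> range B" by blast
  qed
qed

lemma bounded_below_imp_closed_image:
  fixes A :: "'a::banach \<Rightarrow> 'b::banach"
  assumes A: "bounded_linear A" and M: "subspace M" "closed M" and c: "c > 0"
    and below: "\<And>x. x \<in> M \<Longrightarrow> c * norm x \<le> norm (A x)"
  shows "closed (A ` M)"
proof -
  interpret A: bounded_linear A by (rule A)
  show ?thesis
  proof (rule complete_imp_closed, rule complete_isometric_image)
    show "0 < c" "subspace M" "bounded_linear A" by fact+
    show "\<forall>x\<in>M. c * norm x \<le> norm (A x)" using below by blast
    show "complete M" using M(2) by (simp add: complete_eq_closed)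
  qed
qed

lemma bounded_below_if_inj_closed_image:
  fixes A :: "'a::banach \<Rightarrow> 'b::banach"
  assumes A: "bounded_linear A" and M: "subspace M" "closed M" and cl: "closed (A ` M)"
    and inj: "\<And>x. x \<in> M \<Longrightarrow> A x = 0 \<Longrightarrow> x = 0"
  obtains c where "c > 0" "\<And>x. x \<in> M \<Longrightarrow> c * norm x \<le> norm (A x)"
proof -
  interpret A: bounded_linear A by (rule A)
  obtain K where K: "K > 0" "\<And>y. y \<in> A ` M \<Longrightarrow> \<exists>x\<in>M. A x = y \<and> norm x \<le> K * norm y"
    using open_mapping_on[OF A M cl] by blast
  have "(1/K) * norm x \<le> norm (A x)" if x: "x \<in> M" for x
  proof -
    obtain x' where x': "x' \<in> M" "A x' = A x" "norm x' \<le> K * norm (A x)"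
      using K(2)[of "A x"] x by blast
    have "x - x' = 0"
      by (rule inj) (use x x' M(1) in \<open>simp_all add: A.diff subspace_diff\<close>)
    then show ?thesis using x' K(1) by (simp add: field_simps)
  qed
  then show ?thesis using that[of "1/K"] K(1) by simp
qed

section \<open>Complex subspaces and bounded operators\<close>

instance complex_banach \<subseteq> banach ..

global_interpretation complex_pair:
  vector_space_pair "scaleC :: complex \<Rightarrow> 'a \<Rightarrow> 'a::complex_normed_vector"
    "scaleC :: complex \<Rightarrow> 'b \<Rightarrow> 'b::complex_normed_vector"
  by unfold_locales

abbreviation csubspace :: "'a::complex_normed_vector set \<Rightarrow> bool" where
  "csubspace \<equiv> complex_vector.subspace"

abbreviation cspan :: "'a::complex_normed_vector set \<Rightarrow> 'a set" where
  "cspan \<equiv> complex_vector.span"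

abbreviation cindependent :: "'a::complex_normed_vector set \<Rightarrow> bool" where
  "cindependent B \<equiv> \<not> complex_vector.dependent B"

lemmas csubspace_scale = complex_vector.subspace_scale
  and csubspace_UNIV = complex_vector.subspace_UNIV
  and csubspace_diff = complex_vector.subspace_diff
  and csubspace_single_0 = complex_vector.subspace_single_0
  and csubspace_0 = complex_vector.subspace_0
  and csubspace_add = complex_vector.subspace_add
  and csubspace_sum = complex_vector.subspace_sum
  and csubspaceI = complex_vector.subspaceI
  and csubspace_span = complex_vector.subspace_span
  and csubspace_neg = complex_vector.subspace_neg
  and cspan_mono = complex_vector.span_mono
  and cspan_base = complex_vector.span_base
  and cspan_minimal = complex_vector.span_minimal
  and cspan_eq_iff = complex_vector.span_eq_iff
  and cspan_add = complex_vector.span_add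
  and cspan_scale = complex_vector.span_scale
  and cspan_insert = complex_vector.span_insert
  and cspan_diff = complex_vector.span_diff
  and cspan_superset = complex_vector.span_superset
  and cspan_Un = complex_vector.span_Un
  and cindependent_span_bound = complex_vector.independent_span_bound
  and cdependent_def = complex_vector.dependent_def
  and cindependent_insertI = complex_vector.independent_insertI
  and scaleC_right_diff_distrib = complex_vector.scale_right_diff_distrib

lemma csubspace_imp_subspace: "csubspace S \<Longrightarrow> subspace S"
  unfolding subspace_def
  by (metis csubspace_0 csubspace_add csubspace_scale
      scaleC_of_real)

lemma bounded_clinear_imp_bounded_linear: "bounded_clinear A \<Longrightarrow> bounded_linear A"
  by (simp add: bounded_clinear_def)

lemma bounded_clinear_scaleC: "bounded_clinear A \<Longrightarrow> A (c *\<^sub>C x) = c *\<^sub>C A x"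
  by (simp add: bounded_clinear_def)

lemma bounded_clinear_add: "bounded_clinear A \<Longrightarrow> A (x + y) = A x + A y"
  by (simp add: bounded_clinear_def linear_simps)

lemma bounded_clinear_diff: "bounded_clinear A \<Longrightarrow> A (x - y) = A x - A y"
  by (simp add: bounded_clinear_def linear_simps)

lemma bounded_clinear_zero: "bounded_clinear A \<Longrightarrow> A 0 = 0"
  by (simp add: bounded_clinear_def linear_simps)

lemmas bounded_clinear_simps =
  bounded_clinear_add bounded_clinear_diff bounded_clinear_zero bounded_clinear_scaleC

lemma bounded_clinear_imp_linear: "bounded_clinear A \<Longrightarrow> Vector_Spaces.linear scaleC scaleC A"
  unfolding Vector_Spaces.linear_iff
  by (simp add: bounded_clinear_simps complex_vector.vector_space_axioms)

lemma bounded_linear_scaleC_right: "bounded_linear (\<lambda>x::'a::complex_normed_vector. c *\<^sub>C x)"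
proof (rule bounded_linear_intro)
  show "c *\<^sub>C (x + y) = c *\<^sub>C x + c *\<^sub>C y" for x y :: 'a by (rule scaleC_add_right)
  show "c *\<^sub>C r *\<^sub>R x = r *\<^sub>R c *\<^sub>C x" for r and x :: 'a
    by (simp add: scaleC_of_real[symmetric] scaleC_scaleC mult.commute)
  show "norm (c *\<^sub>C x) \<le> norm x * cmod c" for x :: 'a
    by (simp add: norm_scaleC mult.commute)
qed

lemma bounded_linear_scaleC_left: "bounded_linear (\<lambda>c. c *\<^sub>C (x::'a::complex_normed_vector))"
proof (rule bounded_linear_intro)
  show "(c + d) *\<^sub>C x = c *\<^sub>C x + d *\<^sub>C x" for c d by (rule scaleC_add_left)
  show "(r *\<^sub>R c) *\<^sub>C x = r *\<^sub>R c *\<^sub>C x" for r c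
    by (simp add: scaleC_of_real[symmetric] scaleC_scaleC scaleR_conv_of_real)
  show "norm (c *\<^sub>C x) \<le> norm c * norm x" for c
    by (simp add: norm_scaleC)
qed

lemma bounded_clinear_id: "bounded_clinear (\<lambda>x. x)"
  by (simp add: bounded_clinear_def)

lemma bounded_clinear_compose:
  "bounded_clinear A \<Longrightarrow> bounded_clinear B \<Longrightarrow> bounded_clinear (\<lambda>x. A (B x))"
  by (auto simp: bounded_clinear_def intro: bounded_linear_compose)

lemma bounded_clinear_funpow:
  fixes A :: "'a::complex_normed_vector \<Rightarrow> 'a"
  shows "bounded_clinear A \<Longrightarrow> bounded_clinear (A ^^ n)"
  proof (induction n)
  case 0
  show ?case by (simp add: bounded_clinear_id id_def)
next
  case (Suc n)
  then show ?case using bounded_clinear_compose[of A "A ^^ n"] by (simp add: o_def)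
qed

lemma bounded_clinear_plus:
  "bounded_clinear A \<Longrightarrow> bounded_clinear B \<Longrightarrow> bounded_clinear (\<lambda>x. A x + B x)"
  by (auto simp: bounded_clinear_def scaleC_add_right intro: bounded_linear_add)

lemma bounded_clinear_shift_op: "bounded_clinear A \<Longrightarrow> bounded_clinear (shift_op A \<mu>)"
  unfolding shift_op_def bounded_clinear_def
  by (auto simp: scaleC_right_diff_distrib scaleC_scaleC mult.commute
      intro: bounded_linear_sub bounded_linear_scaleC_right)

lemma shift_op_shift_op: "shift_op (shift_op A \<mu>) \<nu> = shift_op A (\<mu> + \<nu>)"
  by (auto simp: shift_op_def scaleC_add_left)

lemma csubspace_image: "bounded_clinear A \<Longrightarrow> csubspace S \<Longrightarrow> csubspace (A ` S)"
  by (rule complex_pair.linear_subspace_image[OF bounded_clinear_imp_linear])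

lemma csubspace_kernel: "bounded_clinear A \<Longrightarrow> csubspace {x. A x = 0}"
  by (rule complex_pair.linear_subspace_kernel[OF bounded_clinear_imp_linear])

lemma cspan_image: "bounded_clinear A \<Longrightarrow> cspan (A ` S) = A ` cspan S"
  by (rule complex_pair.linear_span_image[OF bounded_clinear_imp_linear])

lemma closed_vimage_op:
  "bounded_clinear A \<Longrightarrow> closed S \<Longrightarrow> closed (A -` S)"
  by (intro continuous_closed_vimage)
    (simp_all add: bounded_clinear_imp_bounded_linear linear_continuous_at)

lemma closed_kernel: "bounded_clinear A \<Longrightarrow> closed {x. A x = 0}"
  using closed_vimage_op[of A "{0}"] by (simp add: vimage_def)

section \<open>The Hahn--Banach theorem\<close>

text \<open>Partial functionals are handled as graphs: a subspace \<open>G\<close> of \<open>'a \<times> real\<close> below \<open>p\<close> is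
  automatically single-valued because \<open>p 0 = 0\<close>. So Zorn's lemma applies to such subspaces
  ordered by inclusion, and a union of a chain needs no gluing.\<close>

lemma hahn_banach_graph:
  fixes p :: "'a::real_vector \<Rightarrow> real"
  assumes subadd: "\<And>x y. p (x + y) \<le> p x + p y"
    and homog: "\<And>t x. t \<ge> 0 \<Longrightarrow> p (t *\<^sub>R x) = t * p x"
    and G0: "subspace G0" and dom: "\<And>x a. (x, a) \<in> G0 \<Longrightarrow> a \<le> p x"
  obtains f where "linear f" "\<And>x. f x \<le> p x" "\<And>x a. (x, a) \<in> G0 \<Longrightarrow> f x = a"
proof -
  define \<A> where "\<A> = {G. subspace G \<and> G0 \<subseteq> G \<and> (\<forall>x a. (x, a) \<in> G \<longrightarrow> a \<le> p x)}"
  have "\<exists>M\<in>\<A>. \<forall>X\<in>\<A>. M \<subseteq> X \<longrightarrow> X = M"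
  proof (rule subset_Zorn_nonempty)
    show "\<A> \<noteq> {}" using G0 dom by (auto simp: \<A>_def)
    fix \<C> assume ne: "\<C> \<noteq> {}" and ch: "subset.chain \<A> \<C>"
    then have sub: "\<And>G. G \<in> \<C> \<Longrightarrow> G \<in> \<A>" and tot: "\<And>G H. G \<in> \<C> \<Longrightarrow> H \<in> \<C> \<Longrightarrow> G \<subseteq> H \<or> H \<subseteq> G"
      by (auto simp: subset.chain_def)
    have "subspace (\<Union>\<C>)"
    proof (rule subspaceI)
      show "0 \<in> \<Union>\<C>" using ne sub subspace_0 by (fastforce simp: \<A>_def)
      show "x + y \<in> \<Union>\<C>" if x: "x \<in> \<Union>\<C>" and y: "y \<in> \<Union>\<C>" for x y
      proof -
        obtain G H where GH: "G \<in> \<C>" "x \<in> G" "H \<in> \<C>" "y \<in> H" using x y by blast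
        then obtain L where "L \<in> \<C>" "x \<in> L" "y \<in> L" using tot[of G H] by blast
        then show ?thesis using sub[of L] by (auto simp: \<A>_def intro: subspace_add)
      qed
      show "c *\<^sub>R x \<in> \<Union>\<C>" if "x \<in> \<Union>\<C>" for c x
        using that sub by (auto simp: \<A>_def intro: subspace_scale)
    qed
    then show "\<Union>\<C> \<in> \<A>" using ne sub by (auto simp: \<A>_def)
  qed
  then obtain M where M: "M \<in> \<A>" and max: "\<And>X. X \<in> \<A> \<Longrightarrow> M \<subseteq> X \<Longrightarrow> X = M" by blast
  have sM: "subspace M" and M0: "G0 \<subseteq> M" and Mp: "\<And>x a. (x, a) \<in> M \<Longrightarrow> a \<le> p x"
    using M by (auto simp: \<A>_def)
  have p0: "p 0 = 0" using homog[of 0 0] by simp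
  have Madd: "(x + y, a + b) \<in> M" if "(x, a) \<in> M" "(y, b) \<in> M" for x y a b
    using subspace_add[OF sM that] by simp
  have Mscale: "(t *\<^sub>R x, t * a) \<in> M" if "(x, a) \<in> M" for x t a
    using subspace_scale[OF sM that, of t] by simp
  have total: "\<exists>a. (x0, a) \<in> M" for x0
  proof -
    have key: "b - p (y - x0) \<le> p (y' + x0) - b'" if "(y, b) \<in> M" "(y', b') \<in> M" for y b y' b'
      using Mp[OF Madd[OF that]] subadd[of "y - x0" "y' + x0"] by (simp add: algebra_simps)
    define L where "L = {b - p (y - x0) | y b. (y, b) \<in> M}"
    have zM: "(0, 0) \<in> M" using subspace_0[OF sM] by (simp add: zero_prod_def)
    have Lne: "L \<noteq> {}" using zM by (auto simp: L_def)
    have Lbdd: "bdd_above L"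
      unfolding L_def using key[OF _ zM] by (intro bdd_aboveI) blast
    \<comment> \<open>The value at \<open>x0\<close> must lie between the elements of \<open>L\<close> and the upper bounds in \<open>key\<close>.\<close>
    define a where "a = Sup L"
    have lower: "b - p (y - x0) \<le> a" if "(y, b) \<in> M" for y b
      unfolding a_def by (rule cSup_upper[OF _ Lbdd]) (use that in \<open>auto simp: L_def\<close>)
    have upper: "a \<le> p (y + x0) - b" if "(y, b) \<in> M" for y b
      unfolding a_def by (rule cSup_least[OF Lne]) (use key[OF _ that] in \<open>auto simp: L_def\<close>)
    define G where "G = {(y + t *\<^sub>R x0, b + t * a) | y b t. (y, b) \<in> M}"
    have "subspace G"
    proof (rule subspaceI)
      show "0 \<in> G" unfolding G_def zero_prod_def using zM
        by (intro CollectI exI[of _ 0] exI[of _ "0::real"]) simp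
      show "u + v \<in> G" if uv: "u \<in> G" "v \<in> G" for u v
      proof -
        obtain y b t y' b' t' where *: "u = (y + t *\<^sub>R x0, b + t * a)" "(y, b) \<in> M"
          "v = (y' + t' *\<^sub>R x0, b' + t' * a)" "(y', b') \<in> M"
          using uv unfolding G_def by blast
        have "u + v = ((y + y') + (t + t') *\<^sub>R x0, (b + b') + (t + t') * a)"
          unfolding * by (simp add: algebra_simps)
        then show ?thesis unfolding G_def using Madd[OF *(2,4)] by blast
      qed
      show "c *\<^sub>R u \<in> G" if u: "u \<in> G" for c u
      proof -
        obtain y b t where *: "u = (y + t *\<^sub>R x0, b + t * a)" "(y, b) \<in> M"
          using u unfolding G_def by blast
        have "c *\<^sub>R u = (c *\<^sub>R y + (c * t) *\<^sub>R x0, c * b + (c * t) * a)"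
          unfolding * by (simp add: algebra_simps)
        then show ?thesis unfolding G_def using Mscale[OF *(2)] by blast
      qed
    qed
    moreover have MG: "M \<subseteq> G"
    proof
      fix z assume z: "z \<in> M"
      obtain y b where yb: "z = (y, b)" by fastforce
      have "z = (y + 0 *\<^sub>R x0, b + 0 * a)" by (simp add: yb)
      then show "z \<in> G" using z unfolding G_def yb by blast
    qed
    moreover have "c \<le> p x" if "(x, c) \<in> G" for x c
    proof -
      obtain y b t where *: "x = y + t *\<^sub>R x0" "c = b + t * a" "(y, b) \<in> M"
        using \<open>(x, c) \<in> G\<close> unfolding G_def by blast
      consider "t = 0" | "t > 0" | "t < 0" by linarith
      then show ?thesis
      proof cases
        case 1 then show ?thesis using * Mp by simp
      next
        case 2
        have "a \<le> p ((1/t) *\<^sub>R y + x0) - (1/t) * b" by (rule upper[OF Mscale[OF *(3)]])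
        then have "t * a \<le> t * p ((1/t) *\<^sub>R y + x0) - b" using 2 by (simp add: field_simps)
        moreover have "t * p ((1/t) *\<^sub>R y + x0) = p x"
          using 2 homog[of t "(1/t) *\<^sub>R y + x0"] by (simp add: * scaleR_add_right)
        ultimately show ?thesis by (simp add: *)
      next
        case 3
        define s where "s = - t"
        have s: "s > 0" using 3 by (simp add: s_def)
        have "(1/s) * b - p ((1/s) *\<^sub>R y - x0) \<le> a" by (rule lower[OF Mscale[OF *(3)]])
        then have "b - s * p ((1/s) *\<^sub>R y - x0) \<le> s * a" using s by (simp add: field_simps)
        moreover have "s * p ((1/s) *\<^sub>R y - x0) = p x"
          using s homog[of s "(1/s) *\<^sub>R y - x0"] by (simp add: * scaleR_diff_right s_def)
        ultimately show ?thesis by (simp add: * s_def)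
      qed
    qed
    ultimately have "G = M" using M0 by (intro max) (auto simp: \<A>_def)
    moreover have "(x0, a) \<in> G" unfolding G_def using zM
      by (intro CollectI exI[of _ 0] exI[of _ "0::real"] exI[of _ "1::real"]) simp
    ultimately show ?thesis by blast
  qed
  have unique: "a = b" if "(x, a) \<in> M" "(x, b) \<in> M" for x a b
    using Mp[OF Madd[OF that(1) Mscale[OF that(2), of "-1"]]]
      Mp[OF Madd[OF that(2) Mscale[OF that(1), of "-1"]]] p0 by simp
  define f where "f x = (SOME a. (x, a) \<in> M)" for x
  have fM: "(x, f x) \<in> M" for x unfolding f_def using total by (rule someI_ex)
  have "linear f"
  proof (rule linearI)
    show "f (x + y) = f x + f y" for x y by (rule unique[OF fM Madd[OF fM fM]])
    show "f (c *\<^sub>R x) = c *\<^sub>R f x" for c x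
      using unique[OF fM Mscale[OF fM]] by simp
  qed
  moreover have "f x \<le> p x" for x by (rule Mp[OF fM])
  moreover have "f x = a" if "(x, a) \<in> G0" for x a using unique[OF fM] that M0 by blast
  ultimately show ?thesis using that by blast
qed

text \<open>A complex functional is determined by its real part \<open>u\<close> as \<open>u x - \<i> u (\<i> x)\<close>, and a rotation
  of the argument turns the bound on \<open>u\<close> into a bound on the modulus.\<close>

lemma hahn_banach_complex:
  fixes p :: "'a::complex_normed_vector \<Rightarrow> real" and g :: "'a \<Rightarrow> complex"
  assumes subadd: "\<And>x y. p (x + y) \<le> p x + p y"
    and homog: "\<And>c x. p (c *\<^sub>C x) = cmod c * p x"
    and S: "csubspace S"
    and g_add: "\<And>x y. x \<in> S \<Longrightarrow> y \<in> S \<Longrightarrow> g (x + y) = g x + g y"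
    and g_scale: "\<And>c x. x \<in> S \<Longrightarrow> g (c *\<^sub>C x) = c * g x"
    and g_bound: "\<And>x. x \<in> S \<Longrightarrow> cmod (g x) \<le> p x"
  obtains F where "\<And>x y. F (x + y) = F x + F y" "\<And>c x. F (c *\<^sub>C x) = c * F x"
    "\<And>x. cmod (F x) \<le> p x" "\<And>x. x \<in> S \<Longrightarrow> F x = g x"
proof -
  define G0 where "G0 = {(x, Re (g x)) | x. x \<in> S}"
  have scaleR: "r *\<^sub>R x = complex_of_real r *\<^sub>C x" for r and x :: 'a
    by (simp add: scaleC_of_real)
  have g0: "g 0 = 0" using g_scale[OF csubspace_0[OF S], of 0] by simp
  have "subspace G0"
  proof (rule subspaceI)
    show "0 \<in> G0" unfolding G0_def zero_prod_def
      using csubspace_0[OF S] g0 by force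
    show "u + v \<in> G0" if "u \<in> G0" "v \<in> G0" for u v
      using that csubspace_add[OF S] g_add unfolding G0_def by force
    show "c *\<^sub>R u \<in> G0" if "u \<in> G0" for c u
      using that csubspace_scale[OF S] g_scale unfolding G0_def scaleR
      by (force simp: scaleR)
  qed
  moreover have "a \<le> p x" if "(x, a) \<in> G0" for x a
    using that g_bound complex_Re_le_cmod order_trans unfolding G0_def by blast
  moreover have "p (t *\<^sub>R x) = t * p x" if "t \<ge> 0" for t x
    using that by (simp add: scaleR homog)
  ultimately obtain u where u: "linear u" "\<And>x. u x \<le> p x" "\<And>x a. (x, a) \<in> G0 \<Longrightarrow> u x = a"
    using hahn_banach_graph[OF subadd, of G0] by blast
  define F where "F x = Complex (u x) (- u (\<i> *\<^sub>C x))" for x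
  have add: "F (x + y) = F x + F y" for x y
    by (simp add: F_def linear_add[OF u(1)] scaleC_add_right complex_eq_iff)
  have real: "F (complex_of_real r *\<^sub>C x) = of_real r * F x" for r x
  proof -
    have "\<i> *\<^sub>C r *\<^sub>R x = r *\<^sub>R \<i> *\<^sub>C x" by (simp add: scaleR scaleC_scaleC mult.commute)
    then show ?thesis
      by (simp add: F_def scaleC_of_real linear_scale[OF u(1)] complex_eq_iff)
  qed
  have imag: "F (\<i> *\<^sub>C x) = \<i> * F x" for x
  proof -
    have "\<i> *\<^sub>C \<i> *\<^sub>C x = - x"
      by (simp add: scaleC_scaleC complex_vector.scale_minus_left scaleC_one)
    then show ?thesis by (simp add: F_def linear_neg[OF u(1)] complex_eq_iff)
  qed
  have scale: "F (c *\<^sub>C x) = c * F x" for c x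
  proof -
    have "c *\<^sub>C x = of_real (Re c) *\<^sub>C x + \<i> *\<^sub>C of_real (Im c) *\<^sub>C x"
      by (metis complex_eq scaleC_add_left scaleC_scaleC)
    then have "F (c *\<^sub>C x) = (of_real (Re c) + \<i> * of_real (Im c)) * F x"
      by (simp only: add real imag) (simp add: algebra_simps)
    then show ?thesis by (metis complex_eq)
  qed
  have "cmod (F x) \<le> p x" for x
  proof (cases "F x = 0")
    case True
    have "u x \<le> p x" by (rule u(2))
    moreover have "u x = 0" using True by (simp add: F_def complex_eq_iff)
    ultimately show ?thesis using True by simp
  next
    case False
    define c where "c = cnj (sgn (F x))"
    have c: "cmod c = 1" using False by (simp add: c_def norm_sgn)
    have "F (c *\<^sub>C x) = of_real (cmod (F x))"
      using False by (simp add: scale c_def complex_sgn_def sgn_div_norm complex_norm_square[symmetric]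
          mult.commute scaleR_conv_of_real power2_eq_square field_simps)
    then have "cmod (F x) = u (c *\<^sub>C x)" by (simp add: F_def complex_eq_iff)
    also have "\<dots> \<le> p x" using u(2)[of "c *\<^sub>C x"] by (simp add: homog c)
    finally show ?thesis .
  qed
  moreover have "F x = g x" if x: "x \<in> S" for x
  proof -
    have "u x = Re (g x)" using x by (intro u(3)) (auto simp: G0_def)
    moreover have "u (\<i> *\<^sub>C x) = Re (g (\<i> *\<^sub>C x))"
      using csubspace_scale[OF S x] by (intro u(3)) (auto simp: G0_def)
    ultimately show ?thesis by (simp add: F_def g_scale[OF x] complex_eq_iff)
  qed
  ultimately show ?thesis using that add scale by blast
qed

lemma norming_functional:
  fixes p :: "'a::complex_normed_vector \<Rightarrow> real"
  assumes subadd: "\<And>x y. p (x + y) \<le> p x + p y"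
    and homog: "\<And>c x. p (c *\<^sub>C x) = cmod c * p x" and nonneg: "\<And>x. 0 \<le> p x"
  obtains F where "\<And>x y. F (x + y) = F x + F y" "\<And>c x. F (c *\<^sub>C x) = c * F x"
    "\<And>x. cmod (F x) \<le> p x" "F y = of_real (p y)"
proof -
  define S where "S = range (\<lambda>c. c *\<^sub>C y)"
  define g where "g z = (SOME c. z = c *\<^sub>C y) * of_real (p y)" for z
  have g: "g (c *\<^sub>C y) = c * of_real (p y)" for c
  proof (cases "y = 0")
    case True
    then show ?thesis using homog[of 0 0] by (simp add: g_def)
  next
    case False
    then show ?thesis by (simp add: g_def)
  qed
  obtain F where F: "\<And>x y. F (x + y) = F x + F y" "\<And>c x. F (c *\<^sub>C x) = c * F x"
    "\<And>x. cmod (F x) \<le> p x" "\<And>x. x \<in> S \<Longrightarrow> F x = g x"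
  proof (rule hahn_banach_complex[of p S g, OF subadd homog])
    show "csubspace S"
      unfolding S_def complex_vector.span_singleton[symmetric] by (rule csubspace_span)
    show "g (u + v) = g u + g v" if "u \<in> S" "v \<in> S" for u v
      using that unfolding S_def by (auto simp: g scaleC_add_left[symmetric] distrib_right)
    show "g (c *\<^sub>C u) = c * g u" if "u \<in> S" for c u
      using that unfolding S_def by (auto simp: g scaleC_scaleC)
    show "cmod (g u) \<le> p u" if "u \<in> S" for u
      using that unfolding S_def by (auto simp: g homog norm_mult nonneg)
  qed (rule that)
  have "1 *\<^sub>C y \<in> S" unfolding S_def by (rule rangeI)
  then have "F (1 *\<^sub>C y) = of_real (p y)" using F(4) g[of 1] by simp
  then have Fy: "F y = of_real (p y)" by (simp add: scaleC_one)
  show ?thesis by (rule that[OF F(1-3) Fy])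
qed

text \<open>The infimal convolution of \<open>r \<parallel>\<cdot>\<parallel>\<close> with the image under \<open>B\<close> of \<open>s \<parallel>\<cdot>\<parallel>\<close> on \<open>U\<close>. Both norming
  functionals that occur below are dominated by a seminorm of this kind: the distance to a
  subspace, and a seminorm that measures how well a vector is approximated by images of
  vectors of small norm.\<close>

definition infimal_norm ::
  "real \<Rightarrow> real \<Rightarrow> 'b::complex_normed_vector set \<Rightarrow> ('b \<Rightarrow> 'a::complex_normed_vector) \<Rightarrow> 'a \<Rightarrow> real" where
  "infimal_norm r s U B z = (INF x\<in>U. r * norm (z - B x) + s * norm x)"

lemma infimal_norm:
  fixes B :: "'b::complex_normed_vector \<Rightarrow> 'a::complex_normed_vector"
  assumes B: "bounded_clinear B" and U: "csubspace U" and rs: "0 \<le> r" "0 \<le> s"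
  shows "x \<in> U \<Longrightarrow> infimal_norm r s U B z \<le> r * norm (z - B x) + s * norm x"
    and "(\<And>x. x \<in> U \<Longrightarrow> c \<le> r * norm (z - B x) + s * norm x) \<Longrightarrow> c \<le> infimal_norm r s U B z"
    and "infimal_norm r s U B (z + w) \<le> infimal_norm r s U B z + infimal_norm r s U B w"
    and "infimal_norm r s U B (k *\<^sub>C z) = cmod k * infimal_norm r s U B z"
proof -
  define q where "q z x = r * norm (z - B x) + s * norm x" for z x
  define p where "p = infimal_norm r s U B"
  have p: "p z = (INF x\<in>U. q z x)" for z by (simp add: p_def q_def infimal_norm_def)
  have q0: "q z x \<ge> 0" for z x using rs by (simp add: q_def)
  have U0: "0 \<in> U" by (rule csubspace_0[OF U])
  have le: "p z \<le> q z x" if "x \<in> U" for z x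
    unfolding p by (rule cINF_lower[OF _ that]) (use q0 in \<open>auto intro: bdd_belowI[of _ 0]\<close>)
  have ge: "c \<le> p z" if "\<And>x. x \<in> U \<Longrightarrow> c \<le> q z x" for c z
    unfolding p by (rule cINF_greatest) (use U0 that in auto)
  show "x \<in> U \<Longrightarrow> infimal_norm r s U B z \<le> r * norm (z - B x) + s * norm x"
    using le unfolding p_def q_def .
  show "(\<And>x. x \<in> U \<Longrightarrow> c \<le> r * norm (z - B x) + s * norm x) \<Longrightarrow> c \<le> infimal_norm r s U B z"
    using ge unfolding p_def q_def .
  have "p (z + w) \<le> q z x + q w x'" if "x \<in> U" "x' \<in> U" for x x' z w
  proof -
    have "norm ((z + w) - B (x + x')) \<le> norm (z - B x) + norm (w - B x')"
      using norm_triangle_ineq[of "z - B x" "w - B x'"] by (simp add: bounded_clinear_add[OF B] algebra_simps)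
    then have "q (z + w) (x + x') \<le> q z x + q w x'"
      unfolding q_def using mult_left_mono[OF norm_triangle_ineq[of x x'] rs(2)]
        mult_left_mono[of "norm ((z + w) - B (x + x'))" _ r, OF _ rs(1)] by (fastforce simp: distrib_left)
    then show ?thesis using le[OF csubspace_add[OF U that], of "z + w"] by linarith
  qed
  then have "p (z + w) - q z x \<le> p w" if "x \<in> U" for x
    using that by (intro ge) (simp add: algebra_simps)
  then have "p (z + w) - p w \<le> p z" by (intro ge) (simp add: algebra_simps)
  then show "infimal_norm r s U B (z + w) \<le> infimal_norm r s U B z + infimal_norm r s U B w"
    by (simp add: p_def)
  have scale_le: "p (k *\<^sub>C z) \<le> cmod k * p z" if k: "k \<noteq> 0" for k z
  proof -
    have "p (k *\<^sub>C z) / cmod k \<le> q z x" if x: "x \<in> U" for x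
    proof -
      have "q (k *\<^sub>C z) (k *\<^sub>C x) = cmod k * q z x"
        by (simp add: q_def bounded_clinear_scaleC[OF B] scaleC_right_diff_distrib[symmetric]
            norm_scaleC distrib_left)
      then show ?thesis using le[OF csubspace_scale[OF U x, of k], of "k *\<^sub>C z"] k by (simp add: field_simps)
    qed
    then have "p (k *\<^sub>C z) / cmod k \<le> p z" by (rule ge)
    then show ?thesis using k by (simp add: field_simps)
  qed
  have "p (k *\<^sub>C z) = cmod k * p z"
  proof (cases "k = 0")
    case True
    have "0 \<le> p 0" by (rule ge) (rule q0)
    then show ?thesis using True le[OF U0, of 0] by (simp add: q_def bounded_clinear_zero[OF B])
  next
    case False
    then have "p ((1/k) *\<^sub>C (k *\<^sub>C z)) \<le> cmod (1/k) * p (k *\<^sub>C z)" by (intro scale_le) simp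
    then have "cmod k * p z \<le> p (k *\<^sub>C z)"
      using False by (simp add: scaleC_scaleC scaleC_one norm_divide field_simps)
    then show ?thesis using scale_le[OF False, of z] by simp
  qed
  then show "infimal_norm r s U B (k *\<^sub>C z) = cmod k * infimal_norm r s U B z" by (simp add: p_def)
qed

section \<open>Functionals\<close>

lemma cdual_apply_add: "cdual_apply \<phi> (x + y) = cdual_apply \<phi> x + cdual_apply \<phi> y"
  by transfer (simp add: blinfun.add_right)

lemma cdual_apply_scaleC: "cdual_apply \<phi> (c *\<^sub>C x) = c * cdual_apply \<phi> x"
  by transfer simp

lemma bounded_linear_cdual_apply: "bounded_linear (cdual_apply \<phi>)"
  by transfer (rule blinfun.bounded_linear_right)

lemma cdual_apply_diff: "cdual_apply \<phi> (x - y) = cdual_apply \<phi> x - cdual_apply \<phi> y"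
  by (rule linear_simps[OF bounded_linear_cdual_apply])

lemma cdual_apply_zero_right: "cdual_apply \<phi> 0 = 0"
  by (rule linear_simps[OF bounded_linear_cdual_apply])

lemma norm_cdual_apply: "cmod (cdual_apply \<phi> x) \<le> norm \<phi> * norm x"
  by transfer (rule norm_blinfun)

lemma cdual_eqI: "(\<And>x. cdual_apply \<phi> x = cdual_apply \<psi> x) \<Longrightarrow> \<phi> = \<psi>"
  by transfer (rule blinfun_eqI)

lemma cdual_apply_plus: "cdual_apply (\<phi> + \<psi>) x = cdual_apply \<phi> x + cdual_apply \<psi> x"
  by transfer (simp add: blinfun.add_left)

lemma cdual_apply_minus: "cdual_apply (\<phi> - \<psi>) x = cdual_apply \<phi> x - cdual_apply \<psi> x"
  by transfer (simp add: blinfun.diff_left)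

lemma cdual_apply_zero: "cdual_apply 0 x = 0"
  by transfer simp

lemma cdual_apply_scale: "cdual_apply (c *\<^sub>C \<phi>) x = c * cdual_apply \<phi> x"
  by transfer simp

lemma norm_cdual_bound:
  "0 \<le> C \<Longrightarrow> (\<And>x. cmod (cdual_apply \<phi> x) \<le> C * norm x) \<Longrightarrow> norm \<phi> \<le> C"
  by transfer (rule norm_blinfun_bound)

lemma functional_cdual:
  assumes add: "\<And>x y. F (x + y) = F x + F y" and scale: "\<And>c x. F (c *\<^sub>C x) = c * F x"
    and bound: "\<And>x. cmod (F x) \<le> C * norm x" and C: "0 \<le> C"
  obtains \<phi> where "\<And>x. cdual_apply \<phi> x = F x" "norm \<phi> \<le> C"
proof -
  have "bounded_linear F"
  proof (rule bounded_linear_intro[OF add])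
    show "F (r *\<^sub>R x) = r *\<^sub>R F x" for r x
      using scale[of "of_real r" x] by (simp add: scaleC_of_real scaleR_conv_of_real)
    show "cmod (F x) \<le> norm x * C" for x using bound[of x] by (simp add: mult.commute)
  qed
  then have B: "blinfun_apply (Blinfun F) = F" by (rule bounded_linear_Blinfun_apply)
  then have "Rep_cdual (Abs_cdual (Blinfun F)) = Blinfun F"
    by (intro Abs_cdual_inverse) (simp add: scale)
  then have \<phi>: "cdual_apply (Abs_cdual (Blinfun F)) x = F x" for x
    by (simp add: cdual_apply.rep_eq B)
  moreover have "norm (Abs_cdual (Blinfun F)) \<le> C"
    by (rule norm_cdual_bound[OF C]) (simp add: \<phi> bound)
  ultimately show ?thesis using that by blast
qed

lemma separate_from_closed_csubspace:
  fixes S :: "'a::complex_normed_vector set"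
  assumes S: "csubspace S" "closed S" and v: "v \<notin> S"
  obtains \<phi> where "cdual_apply \<phi> v = 1" "\<And>x. x \<in> S \<Longrightarrow> cdual_apply \<phi> x = 0"
proof -
  define p where "p = infimal_norm 1 0 S (\<lambda>x::'a. x)"
  note p = infimal_norm[OF bounded_clinear_id S(1), of 1 0, folded p_def, simplified]
  obtain e where e: "e > 0" "\<And>x. x \<in> S \<Longrightarrow> e \<le> norm (v - x)"
  proof -
    have "open (- S)" "v \<in> - S" using S(2) v by auto
    then obtain e where e: "e > 0" "ball v e \<subseteq> - S" unfolding open_contains_ball by blast
    have "e \<le> norm (v - x)" if "x \<in> S" for x
      using e(2) that by (force simp: dist_norm[symmetric] not_less[symmetric])
    then show ?thesis using that e(1) by blast
  qed
  have pv: "p v > 0" using p(2)[of e v] e by force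
  have p0: "p x = 0" if "x \<in> S" for x using p(1)[OF that, of x] p(2)[of 0 x] by simp
  have nonneg: "0 \<le> p x" for x by (rule p(2)) simp
  obtain F where F: "\<And>x y. F (x + y) = F x + F y" "\<And>c x. F (c *\<^sub>C x) = c * F x"
    "\<And>x. cmod (F x) \<le> p x" "F v = of_real (p v)"
    using norming_functional[of p v, OF p(3,4) nonneg] by blast
  define G where "G x = F x / p v" for x
  have G: "G (x + y) = G x + G y" "G (c *\<^sub>C x) = c * G x" for x y c
    by (simp_all add: G_def F(1,2) add_divide_distrib)
  have "cmod (G x) \<le> (1 / p v) * norm x" for x
    using order_trans[OF F(3) p(1)[OF csubspace_0[OF S(1)]], of x] pv
    by (simp add: G_def norm_divide divide_right_mono)
  moreover have "0 \<le> 1 / p v" using pv by simp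
  ultimately obtain \<phi> where "\<And>x. cdual_apply \<phi> x = G x"
    using functional_cdual[of G, OF G] by blast
  then have \<phi>: "\<And>x. cdual_apply \<phi> x = F x / p v" by (simp add: G_def)
  show ?thesis
  proof (rule that[of \<phi>])
    show "cdual_apply \<phi> v = 1" using pv by (simp add: \<phi> F(4))
    show "cdual_apply \<phi> x = 0" if "x \<in> S" for x using F(3)[of x] p0[OF that] by (simp add: \<phi>)
  qed
qed

text \<open>A functional that separates \<open>v\<close> from \<open>S\<close> reads off the coefficient of \<open>v\<close>
  continuously.\<close>

lemma closed_cspan_insert:
  fixes S :: "'a::complex_normed_vector set"
  assumes S: "csubspace S" "closed S"
  shows "closed (cspan (insert v S))"
proof (cases "v \<in> S")
  case True
  then show ?thesis using S by (simp add: insert_absorb cspan_eq_iff[THEN iffD2])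
next
  case False
  then obtain \<phi> where \<phi>: "cdual_apply \<phi> v = 1" "\<And>x. x \<in> S \<Longrightarrow> cdual_apply \<phi> x = 0"
    using separate_from_closed_csubspace[OF S] by blast
  have coeff: "k = cdual_apply \<phi> x" if "x - k *\<^sub>C v \<in> S" for x k
    using \<phi>(2)[OF that] by (simp add: cdual_apply_diff cdual_apply_scaleC \<phi>(1))
  have "cspan (insert v S) = {x. \<exists>k. x - k *\<^sub>C v \<in> S}"
    using S(1) by (simp add: cspan_insert cspan_eq_iff[THEN iffD2])
  also have "\<dots> = (\<lambda>x. x - cdual_apply \<phi> x *\<^sub>C v) -` S" using coeff by blast
  finally have "cspan (insert v S) = (\<lambda>x. x - cdual_apply \<phi> x *\<^sub>C v) -` S" .
  moreover have "bounded_linear (\<lambda>x. x - cdual_apply \<phi> x *\<^sub>C v)"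
    by (intro bounded_linear_sub bounded_linear_ident
        bounded_linear_compose[OF bounded_linear_scaleC_left bounded_linear_cdual_apply])
  ultimately show ?thesis using S(2) by (simp add: continuous_closed_vimage linear_continuous_at)
qed

lemma closed_cspan_Un_finite:
  assumes S: "csubspace S" "closed S" and B: "finite B"
  shows "closed (cspan (S \<union> B))"
  using B
proof (induction B rule: finite_induct)
  case empty
  then show ?case using S by (simp add: cspan_eq_iff[THEN iffD2])
next
  case (insert v B)
  have "cspan (S \<union> insert v B) = cspan (insert v (cspan (S \<union> B)))"
    unfolding Un_insert_right cspan_insert complex_vector.span_span ..
  then show ?case
    using closed_cspan_insert[OF csubspace_span insert.IH] by simp
qed

lemma closed_cspan_finite: "finite B \<Longrightarrow> closed (cspan B)"
  using closed_cspan_Un_finite[of "{0}" B] cspan_Un[of "{0}" B]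
  by (simp add: csubspace_single_0)

lemma eq_zero_if_functionals_vanish: "(\<And>\<phi>. cdual_apply \<phi> x = 0) \<Longrightarrow> x = 0"
  by (metis closed_singleton csubspace_single_0 separate_from_closed_csubspace
      singletonI zero_neq_one singletonD)

text \<open>The hypotheses say that \<open>B\<close> is independent modulo \<open>R\<close>.\<close>

lemma notin_cspan_Un_Diff:
  assumes R: "csubspace R" and B: "cindependent B" "cspan B \<inter> R \<subseteq> {0}" and b: "b \<in> B"
  shows "b \<notin> cspan (R \<union> (B - {b}))"
proof
  assume "b \<in> cspan (R \<union> (B - {b}))"
  then obtain r s where rs: "b = r + s" "r \<in> R" "s \<in> cspan (B - {b})"
    using R unfolding cspan_Un by (auto simp: cspan_eq_iff[THEN iffD2])
  have "s \<in> cspan B" using rs(3) cspan_mono[of "B - {b}" B] by blast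
  then have "b - s \<in> cspan B \<inter> R"
    using rs b cspan_base[OF b] cspan_diff by fastforce
  then have "b = s" using B(2) by auto
  then show False using rs(3) b B(1) unfolding cdependent_def by blast
qed

lemma biorthogonal_functionals:
  assumes R: "csubspace R" "closed R" and B: "finite B" "cindependent B" "cspan B \<inter> R \<subseteq> {0}"
  obtains \<phi> where "\<And>b. b \<in> B \<Longrightarrow> cdual_apply (\<phi> b) b = 1"
    "\<And>b b'. b \<in> B \<Longrightarrow> b' \<in> B \<Longrightarrow> b' \<noteq> b \<Longrightarrow> cdual_apply (\<phi> b) b' = 0"
    "\<And>b x. b \<in> B \<Longrightarrow> x \<in> R \<Longrightarrow> cdual_apply (\<phi> b) x = 0"
proof -
  have "\<exists>\<phi>. cdual_apply \<phi> b = 1 \<and> (\<forall>x \<in> cspan (R \<union> (B - {b})). cdual_apply \<phi> x = 0)" if b: "b \<in> B" for b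
    using separate_from_closed_csubspace[OF csubspace_span closed_cspan_Un_finite[OF R]
        notin_cspan_Un_Diff[OF R(1) B(2,3) b]] B(1) by (metis finite_Diff)
  then obtain \<phi> where \<phi>: "\<And>b. b \<in> B \<Longrightarrow> cdual_apply (\<phi> b) b = 1"
      "\<And>b x. b \<in> B \<Longrightarrow> x \<in> cspan (R \<union> (B - {b})) \<Longrightarrow> cdual_apply (\<phi> b) x = 0"
    by metis
  show ?thesis
    by (rule that[of \<phi>]) (use \<phi> in \<open>auto intro: cspan_base\<close>)
qed

lemma finite_rank_extension:
  fixes g :: "'a::complex_normed_vector \<Rightarrow> 'b::complex_normed_vector"
  assumes V: "finite V" "cindependent V"
  obtains F where "bounded_clinear F" "\<And>v. v \<in> V \<Longrightarrow> F v = g v" "range F \<subseteq> cspan (g ` V)"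
proof -
  obtain \<phi> where \<phi>: "\<And>b. b \<in> V \<Longrightarrow> cdual_apply (\<phi> b) b = 1"
    "\<And>b b'. b \<in> V \<Longrightarrow> b' \<in> V \<Longrightarrow> b' \<noteq> b \<Longrightarrow> cdual_apply (\<phi> b) b' = 0"
    by (rule biorthogonal_functionals[of "{0}" V])
      (use V in \<open>auto simp: csubspace_single_0\<close>)
  define F where "F x = (\<Sum>v\<in>V. cdual_apply (\<phi> v) x *\<^sub>C g v)" for x
  have "bounded_linear F"
    unfolding F_def
    by (intro bounded_linear_sum bounded_linear_compose[OF bounded_linear_scaleC_left bounded_linear_cdual_apply])
  then have "bounded_clinear F"
    by (simp add: bounded_clinear_def F_def cdual_apply_scaleC scaleC_scaleC complex_vector.scale_sum_right)
  moreover have "F v = g v" if v: "v \<in> V" for v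
  proof -
    have "F v = (\<Sum>u\<in>V. if u = v then g v else 0)"
      unfolding F_def by (rule sum.cong) (use \<phi> v in \<open>auto simp: scaleC_one\<close>)
    then show ?thesis using V(1) v by simp
  qed
  moreover have "F x \<in> cspan (g ` V)" for x
    unfolding F_def
    by (intro complex_vector.span_sum cspan_scale cspan_base imageI)
  ultimately show ?thesis using that by blast
qed

section \<open>Dimension and codimension\<close>

lemma cspan_csubspace: "csubspace S \<Longrightarrow> cspan S = S"
  by (simp add: cspan_eq_iff)

lemma in_cspan_Un:
  "csubspace N \<Longrightarrow> x \<in> cspan (N \<union> B) \<longleftrightarrow> (\<exists>y\<in>N. \<exists>z\<in>cspan B. x = y + z)"
  unfolding cspan_Un by (auto simp: cspan_csubspace)

text \<open>This is the rank-nullity theorem in the form of a lower bound: a basis of the kernel and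
  preimages of a basis of the image are jointly independent.\<close>

lemma independent_Un_lift:
  fixes q :: "'b::complex_normed_vector \<Rightarrow> 'a::complex_normed_vector"
  assumes A: "bounded_clinear A"
    and D: "finite D" "cindependent D" "\<And>d. d \<in> D \<Longrightarrow> A d = 0"
    and P: "finite P" "cindependent P" "\<And>p. p \<in> P \<Longrightarrow> A (q p) = p"
  shows "cindependent (D \<union> q ` P) \<and> card (D \<union> q ` P) = card D + card P"
  using P
proof (induction P rule: finite_induct)
  case empty
  then show ?case using D by simp
next
  case (insert p P)
  have IH: "cindependent (D \<union> q ` P)" "card (D \<union> q ` P) = card D + card P"
    using insert complex_vector.independent_mono[OF insert.prems(1), of P] by auto
  have nin: "q p \<notin> cspan (D \<union> q ` P)"
  proof
    assume "q p \<in> cspan (D \<union> q ` P)"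
    then have "A (q p) \<in> cspan (A ` (D \<union> q ` P))" unfolding cspan_image[OF A] by blast
    also have "A ` (D \<union> q ` P) \<subseteq> insert 0 P" using D(3) insert.prems(2) by auto
    then have "cspan (A ` (D \<union> q ` P)) \<subseteq> cspan P"
      using cspan_mono[of _ "insert 0 P"] by simp
    finally have "p \<in> cspan P" using insert.prems(2) by simp
    then show False
      using insert.prems(1) insert.hyps(2) unfolding cdependent_def
      by (metis Diff_insert_absorb insertI1)
  qed
  have "cindependent (insert (q p) (D \<union> q ` P))"
    by (rule cindependent_insertI[OF nin IH(1)])
  moreover have "q p \<notin> D \<union> q ` P"
    using nin cspan_superset[of "D \<union> q ` P"] by blast
  ultimately show ?case using IH(2) insert.hyps D(1) by simp
qed

lemma ecodim_in_le:
  "finite B \<Longrightarrow> B \<subseteq> M \<Longrightarrow> M \<subseteq> cspan (N \<union> B) \<Longrightarrow> ecodim_in M N \<le> enat (card B)"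
  unfolding ecodim_in_def by (rule INF_lower) simp

lemma ecodim_in_attained:
  assumes "ecodim_in M N < \<infinity>"
  obtains B where "finite B" "B \<subseteq> M" "M \<subseteq> cspan (N \<union> B)" "ecodim_in M N = enat (card B)"
proof -
  let ?I = "(\<lambda>B. enat (card B)) ` {B. finite B \<and> B \<subseteq> M \<and> M \<subseteq> cspan (N \<union> B)}"
  have "?I \<noteq> {}"
  proof
    assume "?I = {}"
    then have "ecodim_in M N = \<infinity>" unfolding ecodim_in_def by (simp only: Inf_empty top_enat_def)
    then show False using assms by simp
  qed
  then have "Inf ?I \<in> ?I" unfolding Inf_enat_def by (auto intro: LeastI)
  then show ?thesis using that unfolding ecodim_in_def by auto
qed

text \<open>Independence modulo \<open>N\<close> bounds the codimension from below: modulo \<open>N\<close> each member of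
  \<open>B\<close> agrees with a combination of any given spanning set, and these combinations are still
  independent.\<close>

lemma ecodim_in_ge:
  assumes N: "csubspace N" and B: "finite B" "cindependent B" "B \<subseteq> M" "cspan B \<inter> N \<subseteq> {0}"
  shows "enat (card B) \<le> ecodim_in M N"
proof (cases "ecodim_in M N < \<infinity>")
  case True
  then obtain C where C: "finite C" "M \<subseteq> cspan (N \<union> C)" "ecodim_in M N = enat (card C)"
    by (rule ecodim_in_attained)
  have "\<exists>y. y \<in> cspan C \<and> b - y \<in> N" if "b \<in> B" for b
  proof -
    have "b \<in> cspan (N \<union> C)" using that B(3) C(2) by blast
    then obtain x y where "x \<in> N" "y \<in> cspan C" "b = x + y" unfolding in_cspan_Un[OF N] by blast
    then show ?thesis by (intro exI[of _ y]) simp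
  qed
  then obtain h where h: "\<And>b. b \<in> B \<Longrightarrow> h b \<in> cspan C" "\<And>b. b \<in> B \<Longrightarrow> b - h b \<in> N" by metis
  obtain g where g: "Vector_Spaces.linear scaleC scaleC g" "\<And>b. b \<in> B \<Longrightarrow> g b = h b"
    using complex_pair.linear_independent_extend[OF B(2)] by metis
  have "csubspace {x. x - g x \<in> N}"
  proof (rule csubspaceI)
    show "0 \<in> {x. x - g x \<in> N}" using csubspace_0[OF N] by (simp add: complex_pair.linear_0[OF g(1)])
    show "x + y \<in> {x. x - g x \<in> N}" if "x \<in> {x. x - g x \<in> N}" "y \<in> {x. x - g x \<in> N}" for x y
      using csubspace_add[OF N, of "x - g x" "y - g y"] that
      by (simp add: complex_pair.linear_add[OF g(1)] algebra_simps)
    show "c *\<^sub>C x \<in> {x. x - g x \<in> N}" if "x \<in> {x. x - g x \<in> N}" for c x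
      using csubspace_scale[OF N, of "x - g x" c] that
      by (simp add: complex_pair.linear_scale[OF g(1)] scaleC_right_diff_distrib)
  qed
  then have diff: "cspan B \<subseteq> {x. x - g x \<in> N}"
    using h(2) g(2) by (intro cspan_minimal) auto
  have "inj_on g (cspan B)"
    unfolding complex_pair.linear_inj_on_iff_eq_0[OF g(1) csubspace_span]
    using diff B(4) by fastforce
  then have "cindependent (g ` B)" "inj_on g B"
    using complex_pair.linear_independent_injective_image[OF g(1) B(2)]
      inj_on_subset[OF _ cspan_superset] by blast+
  moreover have "g ` B = h ` B" using g(2) by (rule image_cong[OF refl])
  ultimately have "cindependent (h ` B)" "card (h ` B) = card B" using card_image[of g B] by simp_all
  moreover have "h ` B \<subseteq> cspan C" using h(1) by blast
  ultimately have "card B \<le> card C" using cindependent_span_bound[OF C(1)] by metis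
  then show ?thesis by (simp add: C(3))
qed simp

lemma independent_mod_of_ecodim_in:
  assumes N: "csubspace N" and n: "enat n \<le> ecodim_in M N"
  obtains B where "finite B" "card B = n" "cindependent B" "B \<subseteq> M" "cspan B \<inter> N \<subseteq> {0}"
proof -
  have "enat n \<le> ecodim_in M N \<longrightarrow>
    (\<exists>B. finite B \<and> card B = n \<and> cindependent B \<and> B \<subseteq> M \<and> cspan B \<inter> N \<subseteq> {0})"
  proof (induction n)
    case 0
    show ?case
      using complex_vector.independent_empty by (intro impI exI[of _ "{}"]) auto
  next
    case (Suc n)
    show ?case
    proof
      assume le: "enat (Suc n) \<le> ecodim_in M N"
      then have "enat n \<le> ecodim_in M N" using order_trans[of "enat n" "enat (Suc n)"] by simp
      from mp[OF Suc.IH this]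
      obtain B where B: "finite B" "card B = n" "cindependent B" "B \<subseteq> M" "cspan B \<inter> N \<subseteq> {0}"
        by (elim exE conjE) (rule that)
      have "\<not> M \<subseteq> cspan (N \<union> B)"
      proof
        assume "M \<subseteq> cspan (N \<union> B)"
        then have "enat (Suc n) \<le> enat n"
          using order_trans[OF le ecodim_in_le[OF B(1,4), of N]] B(2) by simp
        then show False by simp
      qed
      then obtain v where v: "v \<in> M" "v \<notin> cspan (N \<union> B)" by blast
      have vB: "v \<notin> cspan B" using v(2) cspan_mono[of B "N \<union> B"] by blast
      have "cspan (insert v B) \<inter> N \<subseteq> {0}"
      proof
        fix x assume "x \<in> cspan (insert v B) \<inter> N"
        then obtain k where k: "x - k *\<^sub>C v \<in> cspan B" and xN: "x \<in> N"
          unfolding cspan_insert by blast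
        have "k = 0"
        proof (rule ccontr)
          assume k0: "k \<noteq> 0"
          have "x - (x - k *\<^sub>C v) \<in> cspan (N \<union> B)"
          proof (rule cspan_diff)
            show "x \<in> cspan (N \<union> B)" using xN by (simp add: cspan_base)
            show "x - k *\<^sub>C v \<in> cspan (N \<union> B)"
              using k cspan_mono[of B "N \<union> B"] by blast
          qed
          then have "k *\<^sub>C v \<in> cspan (N \<union> B)" by simp
          then have "(1/k) *\<^sub>C (k *\<^sub>C v) \<in> cspan (N \<union> B)"
            by (rule cspan_scale)
          then show False using v(2) k0 by (simp add: scaleC_scaleC scaleC_one)
        qed
        then show "x \<in> {0}" using k xN B(5) by auto
      qed
      moreover have "v \<notin> B" using vB cspan_base by blast
      ultimately show "\<exists>B. finite B \<and> card B = Suc n \<and> cindependent B \<and> B \<subseteq> M \<and> cspan B \<inter> N \<subseteq> {0}"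
        using B v(1) cindependent_insertI[OF vB B(3)]
        by (intro exI[of _ "insert v B"] conjI) simp_all
    qed
  qed
  from mp[OF this n] show ?thesis by (elim exE conjE) (rule that)
qed

text \<open>Dimension is codimension over the zero subspace, so the bounds for codimensions carry over
  to dimensions.\<close>

lemma edim_eq_ecodim_in:
  assumes S: "csubspace S"
  shows "edim S = ecodim_in S {0}"
proof (cases "\<exists>B. finite B \<and> S \<subseteq> cspan B")
  case True
  then obtain C where C: "finite C" "S \<subseteq> cspan C" by blast
  obtain B where B: "B \<subseteq> S" "cindependent B" "S \<subseteq> cspan B" "card B = complex_vector.dim S"
    by (rule complex_vector.basis_exists)
  have fB: "finite B" using cindependent_span_bound[OF C(1) B(2)] B(1) C(2) by blast
  have "ecodim_in S {0} \<le> enat (card B)"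
    using B by (intro ecodim_in_le[OF fB]) simp_all
  moreover have "enat (card B) \<le> ecodim_in S {0}"
    by (rule ecodim_in_ge[OF csubspace_single_0 fB B(2,1)]) blast
  ultimately show ?thesis using True B(4) unfolding edim_def by simp
next
  case False
  then have "\<not> ecodim_in S {0} < \<infinity>" using ecodim_in_attained[of S "{0}"]
    by (metis complex_vector.span_insert_0 insert_is_Un)
  then show ?thesis using False unfolding edim_def by auto
qed

lemma edim_ge:
  assumes "csubspace S" "finite B" "cindependent B" "B \<subseteq> S"
  shows "enat (card B) \<le> edim S"
  unfolding edim_eq_ecodim_in[OF assms(1)]
  using assms by (intro ecodim_in_ge) (auto simp: csubspace_single_0)

lemma independent_of_edim:
  assumes "csubspace S" "enat n \<le> edim S"
  obtains B where "finite B" "card B = n" "cindependent B" "B \<subseteq> S"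
  using independent_mod_of_ecodim_in[OF csubspace_single_0, of n S] assms
  by (metis edim_eq_ecodim_in)

lemma finite_edim_basis:
  assumes S: "csubspace S" and fin: "edim S < \<infinity>"
  obtains B where "finite B" "cindependent B" "B \<subseteq> S" "cspan B = S" "edim S = enat (card B)"
proof -
  obtain C where C: "finite C" "S \<subseteq> cspan C" using fin unfolding edim_def by (auto split: if_splits)
  obtain B where B: "B \<subseteq> S" "cindependent B" "S \<subseteq> cspan B" "card B = complex_vector.dim S"
    by (rule complex_vector.basis_exists)
  have "finite B" using cindependent_span_bound[OF C(1) B(2)] B(1) C(2) by blast
  moreover have "cspan B = S" using B(1,3) cspan_minimal[OF B(1) S] by blast
  moreover have "edim S = enat (card B)" using C B(4) unfolding edim_def by auto
  ultimately show ?thesis using B that by blast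
qed

lemma edim_finite_if_subset_cspan: "finite C \<Longrightarrow> S \<subseteq> cspan C \<Longrightarrow> edim S < \<infinity>"
  unfolding edim_def by auto

lemma edim_mono:
  assumes "csubspace S" "csubspace S'" "S \<subseteq> S'"
  shows "edim S \<le> edim S'"
proof (cases "edim S < \<infinity>")
  case True
  then obtain B where "finite B" "cindependent B" "B \<subseteq> S" "edim S = enat (card B)"
    by (rule finite_edim_basis[OF assms(1)])
  then show ?thesis using edim_ge[OF assms(2)] assms(3) by auto
next
  case False
  then have "edim S' = \<infinity>"
    using assms(3) unfolding edim_def by (auto split: if_splits)
  then show ?thesis by simp
qed

lemma edim_eq_0_iff:
  assumes "csubspace S"
  shows "edim S = 0 \<longleftrightarrow> S = {0}"
proof
  assume "edim S = 0"
  then have "edim S < \<infinity>" by simp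
  then obtain B where "finite B" "cspan B = S" "edim S = enat (card B)"
    by (rule finite_edim_basis[OF assms])
  then show "S = {0}" using \<open>edim S = 0\<close> by (auto simp: zero_enat_def)
next
  assume "S = {0}"
  then show "edim S = 0"
    using ecodim_in_le[of "{}" S "{0}"] edim_eq_ecodim_in[OF assms] by (simp add: zero_enat_def[symmetric])
qed

lemma csubspace_eq_if_edim_le:
  assumes S: "csubspace S" and S': "csubspace S'" and sub: "S \<subseteq> S'"
    and le: "edim S' \<le> edim S" and fin: "edim S' < \<infinity>"
  shows "S = S'"
proof (rule ccontr)
  assume "S \<noteq> S'"
  then obtain v where v: "v \<in> S'" "v \<notin> S" using sub by blast
  have "edim S < \<infinity>" using edim_mono[OF S S' sub] fin by (rule le_less_trans)
  then obtain B where B: "finite B" "cindependent B" "B \<subseteq> S" "cspan B = S" "edim S = enat (card B)"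
    by (rule finite_edim_basis[OF S])
  have "cindependent (insert v B)" using v(2) B by (intro cindependent_insertI) auto
  then have "enat (card (insert v B)) \<le> edim S'" using B(1,3) sub v(1) by (intro edim_ge[OF S']) auto
  moreover have "v \<notin> B" using v(2) B(3) by blast
  ultimately show False using order_trans[of "enat (Suc (card B))" "edim S'" "enat (card B)"] le B(1,5) by simp
qed

lemma decreasing_finite_dimensional_stabilizes:
  fixes K :: "nat \<Rightarrow> 'a::complex_normed_vector set"
  assumes sub: "\<And>n. csubspace (K n)" and dec: "decseq K" and fin: "edim (K 0) < \<infinity>"
  obtains m where "\<And>n. n \<ge> m \<Longrightarrow> K n = K m"
proof -
  obtain m where m: "\<And>n. edim (K m) \<le> edim (K n)"
  proof -
    assume *: "\<And>m. (\<And>n. edim (K m) \<le> edim (K n)) \<Longrightarrow> thesis"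
    define e where "e = (LEAST e. \<exists>n. e = edim (K n))"
    have "\<exists>n. e = edim (K n)" unfolding e_def by (rule LeastI[of _ "edim (K 0)"]) blast
    then obtain m where m: "e = edim (K m)" by blast
    have "e \<le> edim (K n)" for n unfolding e_def by (rule Least_le) blast
    then show thesis using *[of m] m by simp
  qed
  have "K n = K m" if "n \<ge> m" for n
  proof (rule csubspace_eq_if_edim_le[OF sub sub])
    show "K n \<subseteq> K m" using dec that by (simp add: decseq_def)
    have "K m \<subseteq> K 0" using dec by (simp add: decseq_def)
    then show "edim (K m) < \<infinity>" using edim_mono[OF sub sub] fin by (metis le_less_trans)
  qed (rule m)
  then show ?thesis using that by blast
qed

section \<open>Upper semi-Weyl operators and finite-rank perturbations\<close>

lemma upper_semi_weyl_on_iff: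
  "upper_semi_weyl_on M A \<longleftrightarrow>
     closed (A ` M) \<and> nullity_on M A < \<infinity> \<and> nullity_on M A \<le> deficiency_on M A"
proof -
  have "fredholm_index_on M A \<le> 0 \<longleftrightarrow> nullity_on M A \<le> deficiency_on M A" if "nullity_on M A < \<infinity>"
    using that unfolding fredholm_index_on_def
    by (cases "nullity_on M A"; cases "deficiency_on M A") auto
  then show ?thesis unfolding upper_semi_weyl_on_def upper_semi_fredholm_on_def by blast
qed

lemma csubspace_kernel_on: "bounded_clinear A \<Longrightarrow> csubspace M \<Longrightarrow> csubspace {x\<in>M. A x = 0}"
  using complex_vector.subspace_inter[OF _ csubspace_kernel, of M A] by (simp add: Int_def)

text \<open>Since the nullity does not exceed the deficiency, a finite-rank operator can map the kernel
  injectively to vectors that are independent modulo the range. The sum with \<open>A\<close> is then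
  injective, and its range is \<open>R(A)\<close> enlarged by finitely many vectors.\<close>

lemma upper_semi_weyl_on_imp_perturbation:
  fixes A :: "'a::complex_banach \<Rightarrow> 'a"
  assumes A: "bounded_clinear A" and M: "csubspace M" "closed M" "A ` M \<subseteq> M"
    and weyl: "upper_semi_weyl_on M A"
  obtains F W c where "bounded_clinear F" "finite W" "W \<subseteq> M" "range F \<subseteq> cspan W" "c > 0"
    "\<And>x. x \<in> M \<Longrightarrow> c * norm x \<le> norm (A x + F x)"
proof -
  define K where "K = {x\<in>M. A x = 0}"
  have K: "csubspace K" unfolding K_def by (rule csubspace_kernel_on[OF A M(1)])
  have cl: "closed (A ` M)" and fin: "edim K < \<infinity>" and le: "edim K \<le> ecodim_in M (A ` M)"
    using weyl unfolding upper_semi_weyl_on_iff nullity_on_def deficiency_on_def K_def by auto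
  obtain V where V: "finite V" "cindependent V" "V \<subseteq> K" "cspan V = K" "edim K = enat (card V)"
    by (rule finite_edim_basis[OF K fin])
  obtain W where W: "finite W" "card W = card V" "cindependent W" "W \<subseteq> M" "cspan W \<inter> A ` M \<subseteq> {0}"
    using independent_mod_of_ecodim_in[OF csubspace_image[OF A M(1)], of "card V" M] le V(5) by auto
  obtain h where h: "bij_betw h V W" using finite_same_card_bij[OF V(1) W(1)] W(2) by auto
  obtain F where F: "bounded_clinear F" "\<And>v. v \<in> V \<Longrightarrow> F v = h v" "range F \<subseteq> cspan (h ` V)"
    using finite_rank_extension[OF V(1,2)] by blast
  have hV: "h ` V = W" using h by (rule bij_betw_imp_surj_on)
  have FV: "F ` V = W" using F(2) hV by (metis image_cong)
  have FW: "F x \<in> cspan W" for x using F(3) hV by blast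
  have inj_FV: "inj_on F V" using h F(2) by (metis bij_betw_imp_inj_on inj_on_cong)
  have VF0: "x = 0" if "x \<in> K" "F x = 0" for x
    using complex_pair.linear_indep_image_lemma[OF bounded_clinear_imp_linear[OF F(1)] V(1) _ inj_FV _ that(2)]
      FV W(3) that(1) V(4) by simp
  have FK: "\<exists>k\<in>K. F k = F x" for x
    using FW[of x] cspan_image[OF F(1), of V] FV V(4) by (metis imageE)
  define B where "B x = A x + F x" for x
  have B: "bounded_clinear B" unfolding B_def by (rule bounded_clinear_plus[OF A F(1)])
  have inj: "x = 0" if x: "x \<in> M" "B x = 0" for x
  proof -
    have "F x = A (- x)" using x(2) bounded_clinear_diff[OF A, of 0 x] bounded_clinear_zero[OF A]
      by (simp add: B_def add_eq_0_iff)
    moreover have "- x \<in> M" using x(1) M(1) by (rule csubspace_neg[rotated])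
    ultimately have Fx: "F x = 0" using W(5) FW by blast
    moreover have "x \<in> K" using Fx x by (simp add: K_def B_def)
    ultimately show ?thesis using VF0 by blast
  qed
  have "B ` M = cspan (A ` M \<union> W)"
  proof
    show "B ` M \<subseteq> cspan (A ` M \<union> W)"
    proof
      fix y assume "y \<in> B ` M"
      then obtain x where x: "x \<in> M" "y = A x + F x" by (auto simp: B_def)
      have "A x \<in> cspan (A ` M \<union> W)" using x by (auto intro: cspan_base)
      moreover have "F x \<in> cspan (A ` M \<union> W)" using FW cspan_mono[of W "A ` M \<union> W"] by blast
      ultimately show "y \<in> cspan (A ` M \<union> W)" by (simp add: x(2) cspan_add)
    qed
    show "cspan (A ` M \<union> W) \<subseteq> B ` M"
    proof (rule cspan_minimal[OF _ csubspace_image[OF B M(1)]])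
      have "W \<subseteq> B ` M"
      proof
        fix w assume "w \<in> W"
        then obtain v where "v \<in> V" "w = F v" using FV by blast
        then show "w \<in> B ` M" using V(3) by (intro image_eqI[of _ _ v]) (auto simp: B_def K_def)
      qed
      moreover have "A ` M \<subseteq> B ` M"
      proof
        fix y assume "y \<in> A ` M"
        then obtain x where x: "x \<in> M" "y = A x" by blast
        obtain k where k: "k \<in> K" "F k = F x" using FK by blast
        have "B (x - k) = A x"
          using k by (simp add: B_def bounded_clinear_diff[OF A] bounded_clinear_diff[OF F(1)] K_def)
        moreover have "x - k \<in> M" using k x(1) M(1) by (intro csubspace_diff) (auto simp: K_def)
        ultimately show "y \<in> B ` M" using x(2) by (metis imageI)
      qed
      ultimately show "A ` M \<union> W \<subseteq> B ` M" by blast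
    qed
  qed
  then have "closed (B ` M)"
    using closed_cspan_Un_finite[OF csubspace_image[OF A M(1)] cl W(1)] by simp
  then obtain c where "c > 0" "\<And>x. x \<in> M \<Longrightarrow> c * norm x \<le> norm (B x)"
    using bounded_below_if_inj_closed_image[OF bounded_clinear_imp_bounded_linear[OF B]
        csubspace_imp_subspace[OF M(1)] M(2) _ inj] by blast
  then show ?thesis using that[OF F(1) W(1,4)] FW by (auto simp: B_def)
qed

text \<open>Conversely, let \<open>B = A + F\<close> be bounded below. On the kernel of \<open>F\<close>, which has finite
  codimension, \<open>A\<close> and \<open>B\<close> agree, so the range of \<open>A\<close> is closed. For the index take a
  finite-dimensional \<open>V\<close> that contains the range of \<open>F\<close> and a complement \<open>C\<close> of \<open>R(A)\<close>. As \<open>B\<close>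
  maps \<open>A\<^sup>-\<^sup>1 V\<close> injectively into \<open>V\<close>, it follows that
  \<open>dim N(A) + dim (V \<inter> R(A)) \<le> dim V \<le> dim (V \<inter> R(A)) + dim C\<close>.\<close>

lemma perturbation_imp_upper_semi_weyl_on:
  fixes A :: "'a::complex_banach \<Rightarrow> 'a"
  assumes A: "bounded_clinear A" and M: "csubspace M" "closed M" "A ` M \<subseteq> M"
    and F: "bounded_clinear F" and W: "finite W" "W \<subseteq> M" "range F \<subseteq> cspan W"
    and c: "c > 0" and below: "\<And>x. x \<in> M \<Longrightarrow> c * norm x \<le> norm (A x + F x)"
  shows "upper_semi_weyl_on M A"
proof -
  define B where "B x = A x + F x" for x
  have B: "bounded_clinear B" unfolding B_def by (rule bounded_clinear_plus[OF A F])
  have inj: "x = 0" if "x \<in> M" "B x = 0" for x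
    using below[OF that(1)] that(2) c by (simp add: B_def mult_le_0_iff)
  have FM: "csubspace (F ` M)" by (rule csubspace_image[OF F M(1)])
  have "edim (F ` M) < \<infinity>" using W by (intro edim_finite_if_subset_cspan[of W]) auto
  then obtain D where D: "finite D" "D \<subseteq> F ` M" "cspan D = F ` M"
    using finite_edim_basis[OF FM] by metis
  obtain E where E: "finite E" "E \<subseteq> M" "F ` E = D"
    using finite_subset_image[OF D(1,2)] by metis
  define M0 where "M0 = {x\<in>M. F x = 0}"
  have M0: "csubspace M0" unfolding M0_def by (rule csubspace_kernel_on[OF F M(1)])
  have clM0: "closed M0" unfolding M0_def Collect_conj_eq using M(2) closed_kernel[OF F] by (intro closed_Int) simp_all
  have "M = cspan (M0 \<union> E)"
  proof
    show "cspan (M0 \<union> E) \<subseteq> M"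
      using E(2) by (intro cspan_minimal[OF _ M(1)]) (auto simp: M0_def)
    show "M \<subseteq> cspan (M0 \<union> E)"
    proof
      fix x assume x: "x \<in> M"
      then have "F x \<in> F ` cspan E" using D(3) E(3) cspan_image[OF F, of E] by auto
      then obtain e where e: "e \<in> cspan E" "F x = F e" by blast
      have "e \<in> M" using e(1) E(2) cspan_minimal[OF _ M(1)] by blast
      then have "x - e \<in> M0" using x e(2) M(1) by (simp add: M0_def bounded_clinear_diff[OF F] csubspace_diff)
      then show "x \<in> cspan (M0 \<union> E)" unfolding in_cspan_Un[OF M0] using e(1)
        by (metis diff_add_cancel)
    qed
  qed
  then have AM: "A ` M = cspan (A ` M0 \<union> A ` E)"
    using cspan_image[OF A, of "M0 \<union> E"] by (simp add: image_Un)
  have "A ` M0 = B ` M0" by (auto simp: B_def M0_def)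
  moreover have "c * norm x \<le> norm (B x)" if "x \<in> M0" for x
    using below[of x] that by (simp add: M0_def B_def)
  then have "closed (B ` M0)"
    by (rule bounded_below_imp_closed_image[OF bounded_clinear_imp_bounded_linear[OF B]
          csubspace_imp_subspace[OF M0] clM0 c])
  ultimately have cl: "closed (A ` M)"
    unfolding AM using closed_cspan_Un_finite[OF csubspace_image[OF A M0]] E(1) by simp
  define K where "K = {x\<in>M. A x = 0}"
  have K: "csubspace K" unfolding K_def by (rule csubspace_kernel_on[OF A M(1)])
  have indepB: "cindependent (B ` Q) \<and> card (B ` Q) = card Q" if Q: "cindependent Q" "Q \<subseteq> M" for Q
  proof -
    have "inj_on B (cspan Q)"
    proof (rule inj_onI)
      fix x y assume xy: "x \<in> cspan Q" "y \<in> cspan Q" "B x = B y"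
      have "cspan Q \<subseteq> M" using Q(2) cspan_minimal[OF _ M(1)] by blast
      then have "x - y \<in> M" using xy csubspace_diff[OF M(1)] by blast
      then show "x = y" using inj[of "x - y"] xy(3) by (simp add: bounded_clinear_diff[OF B])
    qed
    then show ?thesis
      using complex_pair.linear_independent_injective_image[OF bounded_clinear_imp_linear[OF B] Q(1)]
        inj_on_subset[OF _ cspan_superset] card_image by blast
  qed
  have fin: "edim K < \<infinity>"
  proof (rule ccontr)
    assume "\<not> edim K < \<infinity>"
    then obtain Q where Q: "finite Q" "card Q = Suc (card W)" "cindependent Q" "Q \<subseteq> K"
      using independent_of_edim[OF K, of "Suc (card W)"] by auto
    have "B ` Q \<subseteq> F ` Q" using Q(4) by (auto simp: B_def K_def)
    then have "B ` Q \<subseteq> cspan W" using W(3) by blast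
    then have "card (B ` Q) \<le> card W"
      using cindependent_span_bound[OF W(1)] indepB[OF Q(3)] Q(4) by (auto simp: K_def)
    moreover have "card (B ` Q) = card Q" using indepB[OF Q(3)] Q(4) by (auto simp: K_def)
    ultimately show False using Q(2) by simp
  qed
  have "edim K \<le> ecodim_in M (A ` M)"
  proof (cases "ecodim_in M (A ` M) < \<infinity>")
    case True
    then obtain C where C: "finite C" "C \<subseteq> M" "M \<subseteq> cspan (A ` M \<union> C)" "ecodim_in M (A ` M) = enat (card C)"
      by (rule ecodim_in_attained)
    obtain D where D: "finite D" "cindependent D" "D \<subseteq> K" "edim K = enat (card D)"
      by (rule finite_edim_basis[OF K fin])
    define V where "V = cspan (W \<union> C)"
    have VM: "V \<subseteq> M" unfolding V_def using W(2) C(2) by (intro cspan_minimal[OF _ M(1)]) blast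
    have V: "csubspace V" unfolding V_def by (rule csubspace_span)
    have VA: "csubspace (V \<inter> A ` M)" by (intro complex_vector.subspace_inter V csubspace_image[OF A M(1)])
    have "edim (V \<inter> A ` M) < \<infinity>"
      using W(1) C(1) by (intro edim_finite_if_subset_cspan[of "W \<union> C"]) (auto simp: V_def)
    then obtain P where P: "finite P" "cindependent P" "P \<subseteq> V \<inter> A ` M" "cspan P = V \<inter> A ` M"
      using finite_edim_basis[OF VA] by metis
    obtain q where q: "\<And>p. p \<in> P \<Longrightarrow> q p \<in> M" "\<And>p. p \<in> P \<Longrightarrow> A (q p) = p"
      using P(3) by (metis IntD2 image_iff subsetD)
    have DK: "\<And>d. d \<in> D \<Longrightarrow> A d = 0" and DM: "D \<subseteq> M" using D(3) by (auto simp: K_def)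
    have DP: "cindependent (D \<union> q ` P) \<and> card (D \<union> q ` P) = card D + card P"
      by (rule independent_Un_lift[OF A D(1,2) DK P(1,2) q(2)])
    have sub: "D \<union> q ` P \<subseteq> M" using DM q(1) by blast
    have FV: "F x \<in> V" for x
      using W(3) cspan_mono[of W "W \<union> C"] unfolding V_def by blast
    have BV: "B ` (D \<union> q ` P) \<subseteq> V"
    proof
      fix y assume "y \<in> B ` (D \<union> q ` P)"
      then obtain x where x: "x \<in> D \<union> q ` P" "y = A x + F x" by (auto simp: B_def)
      have "A x \<in> V" using x(1) DK q(2) P(3) csubspace_0[OF V] by auto
      then show "y \<in> V" using FV x(2) csubspace_add[OF V] by blast
    qed
    have "V \<subseteq> cspan (P \<union> C)"
    proof
      fix x assume x: "x \<in> V"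
      then have "x \<in> cspan (A ` M \<union> C)" using VM C(3) by blast
      then obtain y z where yz: "y \<in> A ` M" "z \<in> cspan C" "x = y + z"
        unfolding in_cspan_Un[OF csubspace_image[OF A M(1)]] by blast
      have "z \<in> V" using yz(2) cspan_mono[of C "W \<union> C"] unfolding V_def by blast
      then have "y \<in> V" using x yz(3) csubspace_diff[OF V, of x z] by simp
      then have "y \<in> cspan P" using yz(1) P(4) by blast
      then show "x \<in> cspan (P \<union> C)"
        using yz(2,3) cspan_mono[of P "P \<union> C"] cspan_mono[of C "P \<union> C"]
          cspan_add by blast
    qed
    then have "card (B ` (D \<union> q ` P)) \<le> card (P \<union> C)"
      using cindependent_span_bound[of "P \<union> C"] P(1) C(1) indepB[of "D \<union> q ` P"] DP sub BV
      by blast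
    then have "card D + card P \<le> card (P \<union> C)" using indepB[of "D \<union> q ` P"] DP sub by metis
    also have "\<dots> \<le> card P + card C" by (rule card_Un_le)
    finally show ?thesis using D(4) C(4) by simp
  qed simp
  then show ?thesis
    unfolding upper_semi_weyl_on_iff nullity_on_def deficiency_on_def using cl fin by (simp add: K_def)
qed

lemma upper_semi_weyl_on_if_bounded_below:
  fixes A :: "'a::complex_banach \<Rightarrow> 'a"
  assumes A: "bounded_clinear A" and M: "csubspace M" "closed M" "A ` M \<subseteq> M"
    and c: "c > 0" and below: "\<And>x. x \<in> M \<Longrightarrow> c * norm x \<le> norm (A x)"
  shows "upper_semi_weyl_on M A"
  by (rule perturbation_imp_upper_semi_weyl_on[OF A M _ finite.emptyI _ _ c, where F = "\<lambda>x. 0"])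
    (use below in \<open>auto simp: bounded_clinear_def\<close>)

lemma norm_shift_op_ge: "norm (A x + y) - cmod \<mu> * norm x \<le> norm (shift_op A \<mu> x + y)"
proof -
  have "A x + y = (shift_op A \<mu> x + y) + \<mu> *\<^sub>C x" by (simp add: shift_op_def)
  then have "norm (A x + y) \<le> norm (shift_op A \<mu> x + y) + norm (\<mu> *\<^sub>C x)"
    by (metis norm_triangle_ineq)
  then show ?thesis by (simp add: norm_scaleC)
qed

lemma shift_op_image_subset:
  assumes "csubspace M" "A ` M \<subseteq> M"
  shows "shift_op A \<mu> ` M \<subseteq> M"
  using assms by (auto simp: shift_op_def intro!: csubspace_diff csubspace_scale)

text \<open>Being bounded below is stable under small shifts, and the perturbation can be kept.\<close>

lemma upper_semi_weyl_on_shift_op: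
  fixes A :: "'a::complex_banach \<Rightarrow> 'a"
  assumes A: "bounded_clinear A" and M: "csubspace M" "closed M" "A ` M \<subseteq> M"
    and weyl: "upper_semi_weyl_on M A"
  obtains \<epsilon> where "\<epsilon> > 0" "\<And>\<mu>. cmod \<mu> < \<epsilon> \<Longrightarrow> upper_semi_weyl_on M (shift_op A \<mu>)"
proof -
  obtain F W c where F: "bounded_clinear F" and W: "finite W" "W \<subseteq> M" "range F \<subseteq> cspan W"
    and c: "c > 0" and below: "\<And>x. x \<in> M \<Longrightarrow> c * norm x \<le> norm (A x + F x)"
    using upper_semi_weyl_on_imp_perturbation[OF A M weyl] by blast
  have "upper_semi_weyl_on M (shift_op A \<mu>)" if \<mu>: "cmod \<mu> < c" for \<mu>
  proof (rule perturbation_imp_upper_semi_weyl_on[OF bounded_clinear_shift_op[OF A] M(1,2) _ F W])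
    show "shift_op A \<mu> ` M \<subseteq> M" by (rule shift_op_image_subset[OF M(1,3)])
    show "c - cmod \<mu> > 0" using \<mu> by simp
    show "(c - cmod \<mu>) * norm x \<le> norm (shift_op A \<mu> x + F x)" if "x \<in> M" for x
      using below[OF that] norm_shift_op_ge[of A x "F x" \<mu>] by (simp add: left_diff_distrib)
  qed
  then show ?thesis using that c by blast
qed

section \<open>Vector-valued power series and backward orbits\<close>

lemma vector_power_series_summable:
  fixes x :: "nat \<Rightarrow> 'a::complex_banach"
  assumes bound: "\<And>k. norm (x k) \<le> C * K ^ k" and K: "K > 0" and \<mu>: "cmod \<mu> < 1 / K"
  shows "summable (\<lambda>k. \<mu> ^ k *\<^sub>C x k)"
proof (rule summable_comparison_test')
  have "cmod \<mu> * K < 1" using \<mu> K by (simp add: field_simps)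
  then show "summable (\<lambda>k. C * (cmod \<mu> * K) ^ k)"
    using K by (intro summable_mult summable_geometric) simp
  show "norm (\<mu> ^ k *\<^sub>C x k) \<le> C * (cmod \<mu> * K) ^ k" for k
    using mult_left_mono[OF bound[of k], of "cmod \<mu> ^ k"]
    by (simp add: norm_scaleC norm_power power_mult_distrib mult_ac)
qed

lemma vector_analytic_power_series:
  fixes x :: "nat \<Rightarrow> 'a::complex_banach"
  assumes bound: "\<And>k. norm (x k) \<le> C * K ^ k" and K: "K > 0"
  shows "vector_analytic_on (\<lambda>\<mu>. \<Sum>k. \<mu> ^ k *\<^sub>C x k) (ball 0 (1 / K))"
  unfolding vector_analytic_on_def
proof
  fix z :: complex assume "z \<in> ball 0 (1 / K)"
  then obtain r where r: "cmod z < r" "r < 1 / K" using dense by (auto simp: dist_norm)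
  have r0: "r > 0" using r(1) norm_ge_zero[of z] by linarith
  define S where "S = ball (0::complex) r"
  define d where "d n \<mu> = (of_nat n * \<mu> ^ (n - 1)) *\<^sub>C x n" for n \<mu>
  define D where "D \<mu> = (\<Sum>n. d n \<mu>)" for \<mu>
  have C: "C \<ge> 0" using order_trans[OF norm_ge_zero bound[of 0]] by simp
  have rK: "r * K < 1" using r(2) K by (simp add: field_simps)
  have "summable (\<lambda>n. C * K * (of_nat (Suc n) * (r * K) ^ n))"
    using geometric_deriv_sums[of "r * K"] rK r0 K by (intro summable_mult) (auto simp: sums_iff)
  then have sM: "summable (\<lambda>n. C * (of_nat n * r ^ (n - 1) * K ^ n))"
    by (subst summable_Suc_iff[symmetric]) (simp add: power_mult_distrib mult_ac)
  have dM: "norm (d n \<mu>) \<le> C * (of_nat n * r ^ (n - 1) * K ^ n)" if "\<mu> \<in> S" for n \<mu>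
  proof -
    have "norm (d n \<mu>) = of_nat n * cmod \<mu> ^ (n - 1) * norm (x n)"
      by (simp add: d_def norm_scaleC norm_mult norm_power)
    also have "\<dots> \<le> of_nat n * r ^ (n - 1) * (C * K ^ n)"
      using that bound[of n] r0 C K
      by (intro mult_mono power_mono mult_left_mono) (auto simp: S_def)
    finally show ?thesis by (simp add: mult_ac)
  qed
  have unif: "uniform_limit S (\<lambda>n \<mu>. \<Sum>i<n. d i \<mu>) D sequentially"
    unfolding D_def by (rule Weierstrass_m_test[OF dM sM])
  have "\<exists>g. \<forall>\<mu>\<in>S. (\<lambda>n. \<mu> ^ n *\<^sub>C x n) sums g \<mu> \<and> (g has_derivative (\<lambda>h. h *\<^sub>C D \<mu>)) (at \<mu> within S)"
  proof (rule has_derivative_series)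
    show "convex S" by (simp add: S_def)
    show "((\<lambda>\<mu>. \<mu> ^ n *\<^sub>C x n) has_derivative (\<lambda>h. h *\<^sub>C d n \<mu>)) (at \<mu> within S)" for n \<mu>
    proof -
      have "((\<lambda>\<mu>. \<mu> ^ n) has_derivative (\<lambda>h. h * (of_nat n * \<mu> ^ (n - 1)))) (at \<mu> within S)"
        by (auto intro!: derivative_eq_intros simp: mult_ac)
      from bounded_linear.has_derivative[OF bounded_linear_scaleC_left this, of "x n"]
      show ?thesis by (simp add: d_def scaleC_scaleC)
    qed
    show "\<forall>\<^sub>F n in sequentially. \<forall>\<mu>\<in>S. \<forall>h. norm ((\<Sum>i<n. h *\<^sub>C d i \<mu>) - h *\<^sub>C D \<mu>) \<le> e * norm h"
      if e: "e > 0" for e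
      using uniform_limitD[OF unif e]
    proof eventually_elim
      case (elim n)
      show ?case
      proof (intro ballI allI)
        fix \<mu> h assume "\<mu> \<in> S"
        then have "norm ((\<Sum>i<n. d i \<mu>) - D \<mu>) \<le> e" using elim by (auto simp: dist_norm)
        moreover have "(\<Sum>i<n. h *\<^sub>C d i \<mu>) - h *\<^sub>C D \<mu> = h *\<^sub>C ((\<Sum>i<n. d i \<mu>) - D \<mu>)"
          by (simp add: scaleC_right_diff_distrib complex_vector.scale_sum_right)
        ultimately show "norm ((\<Sum>i<n. h *\<^sub>C d i \<mu>) - h *\<^sub>C D \<mu>) \<le> e * norm h"
          by (simp add: norm_scaleC mult.commute[of e] mult_left_mono)
      qed
    qed
    show "z \<in> S" using r by (simp add: S_def)
    show "(\<lambda>n. z ^ n *\<^sub>C x n) sums (\<Sum>n. z ^ n *\<^sub>C x n)"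
      using vector_power_series_summable[of x C K z] bound K r by (intro summable_sums) simp
  qed
  then obtain g where g: "\<And>\<mu>. \<mu> \<in> S \<Longrightarrow> (\<lambda>n. \<mu> ^ n *\<^sub>C x n) sums g \<mu>"
    "\<And>\<mu>. \<mu> \<in> S \<Longrightarrow> (g has_derivative (\<lambda>h. h *\<^sub>C D \<mu>)) (at \<mu> within S)" by blast
  have zS: "z \<in> S" and oS: "open S" using r by (auto simp: S_def)
  have "(g has_derivative (\<lambda>h. h *\<^sub>C D z)) (at z)" using g(2)[OF zS] at_within_open[OF zS oS] by simp
  then have "((\<lambda>\<mu>. \<Sum>k. \<mu> ^ k *\<^sub>C x k) has_derivative (\<lambda>h. h *\<^sub>C D z)) (at z)"
    by (rule has_derivative_transform_within_open[OF _ oS zS]) (use g(1) in \<open>simp add: sums_iff\<close>)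
  then show "\<exists>D. ((\<lambda>\<mu>. \<Sum>k. \<mu> ^ k *\<^sub>C x k) has_derivative (\<lambda>h. h *\<^sub>C D)) (at z)" by blast
qed

text \<open>If \<open>x\<close> runs backwards along \<open>A\<close>, then \<open>\<Sum>\<mu>\<^sup>k x\<^sub>k\<close> solves
  \<open>(A - \<mu>) y = A x\<^sub>0\<close>. This one computation produces solutions of inhomogeneous equations when
  \<open>x\<^sub>0\<close> is a preimage of the right-hand side, and analytic families of eigenvectors when
  \<open>x\<^sub>0\<close> lies in the kernel.\<close>

lemma backward_orbit_sum:
  fixes x :: "nat \<Rightarrow> 'a::complex_banach"
  assumes A: "bounded_clinear A" and orbit: "\<And>k. A (x (Suc k)) = x k"
    and bound: "\<And>k. norm (x k) \<le> C * K ^ k" and K: "K > 0" and \<mu>: "cmod \<mu> < 1 / K"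
  shows "shift_op A \<mu> (\<Sum>k. \<mu> ^ k *\<^sub>C x k) = A (x 0)"
proof -
  let ?t = "\<lambda>k. \<mu> ^ k *\<^sub>C x k"
  have sm: "summable ?t" by (rule vector_power_series_summable[OF bound K \<mu>])
  have "A (\<Sum>k. ?t k) = (\<Sum>k. A (?t k))"
    by (rule bounded_linear.suminf[OF bounded_clinear_imp_bounded_linear[OF A] sm])
  also have "\<dots> = A (?t 0) + (\<Sum>k. A (?t (Suc k)))"
    using suminf_split_head[OF bounded_linear.summable[OF bounded_clinear_imp_bounded_linear[OF A] sm]]
    by (simp add: algebra_simps)
  also have "(\<Sum>k. A (?t (Suc k))) = (\<Sum>k. \<mu> *\<^sub>C ?t k)"
    by (simp add: bounded_clinear_scaleC[OF A] orbit scaleC_scaleC)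
  also have "\<dots> = \<mu> *\<^sub>C (\<Sum>k. ?t k)"
    by (rule bounded_linear.suminf[OF bounded_linear_scaleC_right sm, symmetric])
  finally show ?thesis by (simp add: shift_op_def scaleC_one)
qed

lemma vector_power_series_0: "(\<Sum>k. 0 ^ k *\<^sub>C x k) = (x 0 :: 'a::complex_banach)"
proof -
  have "(\<lambda>k. 0 ^ k *\<^sub>C x k) sums (\<Sum>k\<in>{0}. 0 ^ k *\<^sub>C x k)"
    by (rule sums_finite) (auto simp: power_0_left)
  then show ?thesis by (simp add: sums_iff scaleC_one)
qed

lemma vector_power_series_mem:
  fixes x :: "nat \<Rightarrow> 'a::complex_banach"
  assumes bound: "\<And>k. norm (x k) \<le> C * K ^ k" and K: "K > 0" and \<mu>: "cmod \<mu> < 1 / K"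
    and Z: "csubspace Z" "closed Z" "\<And>k. x k \<in> Z"
  shows "(\<Sum>k. \<mu> ^ k *\<^sub>C x k) \<in> Z"
proof (rule closed_sequentially[OF Z(2)])
  show "(\<lambda>n. \<Sum>k<n. \<mu> ^ k *\<^sub>C x k) \<longlonglongrightarrow> (\<Sum>k. \<mu> ^ k *\<^sub>C x k)"
    by (rule summable_LIMSEQ[OF vector_power_series_summable[OF bound K \<mu>]])
  show "(\<Sum>k<n. \<mu> ^ k *\<^sub>C x k) \<in> Z" for n
    using Z by (intro csubspace_sum csubspace_scale)
qed

text \<open>Backward orbits with geometric growth exist inside any set \<open>S\<close> of image vectors that is
  closed under taking preimages. The set \<open>S\<close> need not be closed, so it may be the union of the
  kernels of all powers of \<open>A\<close> as well as a subspace mapped onto itself.\<close>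

lemma backward_orbit_exists:
  fixes A :: "'a::complex_banach \<Rightarrow> 'a"
  assumes A: "bounded_clinear A" and M: "csubspace M" "closed M" and cl: "closed (A ` M)"
    and S: "S \<subseteq> A ` M" "\<And>x. x \<in> M \<Longrightarrow> A x \<in> S \<Longrightarrow> x \<in> S"
  obtains K where "K > 0" "\<And>x0. x0 \<in> S \<Longrightarrow> \<exists>x. x 0 = x0 \<and> (\<forall>k. x k \<in> S) \<and>
    (\<forall>k. A (x (Suc k)) = x k) \<and> (\<forall>k. norm (x k) \<le> norm x0 * K ^ k)"
proof -
  obtain K where K: "K > 0" "\<And>y. y \<in> A ` M \<Longrightarrow> \<exists>x\<in>M. A x = y \<and> norm x \<le> K * norm y"
    using open_mapping_on[OF bounded_clinear_imp_bounded_linear[OF A] csubspace_imp_subspace[OF M(1)] M(2) cl]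
    by blast
  have "\<exists>x. x \<in> S \<and> A x = y \<and> norm x \<le> K * norm y" if y: "y \<in> S" for y
  proof -
    have "y \<in> A ` M" using S(1) y by (rule subsetD)
    then obtain x where x: "x \<in> M" "A x = y" "norm x \<le> K * norm y" using K(2) by blast
    then have "x \<in> S" using S(2) y by simp
    then show ?thesis using x by blast
  qed
  then obtain g where g: "\<And>y. y \<in> S \<Longrightarrow> g y \<in> S" "\<And>y. y \<in> S \<Longrightarrow> A (g y) = y"
    "\<And>y. y \<in> S \<Longrightarrow> norm (g y) \<le> K * norm y" by metis
  have "\<exists>x. x 0 = x0 \<and> (\<forall>k. x k \<in> S) \<and> (\<forall>k. A (x (Suc k)) = x k) \<and> (\<forall>k. norm (x k) \<le> norm x0 * K ^ k)"
    if x0: "x0 \<in> S" for x0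
  proof -
    define x where "x k = (g ^^ k) x0" for k
    have Sx: "x k \<in> S" for k by (induction k) (simp_all add: x_def x0 g(1))
    moreover have "A (x (Suc k)) = x k" for k using g(2)[OF Sx[of k]] by (simp add: x_def)
    moreover have "norm (x k) \<le> norm x0 * K ^ k" for k
    proof (induction k)
      case (Suc k)
      have "norm (x (Suc k)) \<le> K * norm (x k)" using g(3)[OF Sx[of k]] by (simp add: x_def)
      also have "\<dots> \<le> K * (norm x0 * K ^ k)" using Suc K(1) by (intro mult_left_mono) auto
      finally show ?case by (simp add: mult_ac)
    qed (simp add: x_def)
    ultimately show ?thesis by (intro exI[of _ x]) (simp add: x_def)
  qed
  then show ?thesis using that K(1) by blast
qed

text \<open>Surjectivity is stable under small shifts: a preimage of \<open>z\<close> starts a backward orbit.\<close>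

lemma shift_op_image_eq_if_image_eq:
  fixes A :: "'a::complex_banach \<Rightarrow> 'a"
  assumes A: "bounded_clinear A" and Z: "csubspace Z" "closed Z" "A ` Z = Z"
  obtains \<epsilon> where "\<epsilon> > 0" "\<And>\<mu>. cmod \<mu> < \<epsilon> \<Longrightarrow> shift_op A \<mu> ` Z = Z"
proof -
  have cl: "closed (A ` Z)" and ZA: "Z \<subseteq> A ` Z" using Z(2,3) by simp_all
  obtain K where K: "K > 0" and orb: "\<And>x0. x0 \<in> Z \<Longrightarrow> \<exists>x. x 0 = x0 \<and> (\<forall>k. x k \<in> Z) \<and>
    (\<forall>k. A (x (Suc k)) = x k) \<and> (\<forall>k. norm (x k) \<le> norm x0 * K ^ k)"
    using backward_orbit_exists[OF A Z(1,2) cl ZA] by blast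
  have "shift_op A \<mu> ` Z = Z" if \<mu>: "cmod \<mu> < 1 / K" for \<mu>
  proof
    show "shift_op A \<mu> ` Z \<subseteq> Z" using shift_op_image_subset[OF Z(1)] Z(3) by blast
    show "Z \<subseteq> shift_op A \<mu> ` Z"
    proof
      fix z assume "z \<in> Z"
      then obtain x0 where x0: "x0 \<in> Z" "A x0 = z" using Z(3) by (metis imageE)
      then obtain x where x: "x 0 = x0" "\<And>k. x k \<in> Z" "\<And>k. A (x (Suc k)) = x k"
        "\<And>k. norm (x k) \<le> norm x0 * K ^ k" using orb by blast
      have "shift_op A \<mu> (\<Sum>k. \<mu> ^ k *\<^sub>C x k) = z"
        using backward_orbit_sum[OF A x(3,4) K \<mu>] x(1) x0(2) by simp
      moreover have "(\<Sum>k. \<mu> ^ k *\<^sub>C x k) \<in> Z"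
        by (rule vector_power_series_mem[OF x(4) K \<mu> Z(1,2) x(2)])
      ultimately show "z \<in> shift_op A \<mu> ` Z" by blast
    qed
  qed
  then show ?thesis using that[of "1 / K"] K by simp
qed

lemma eigenvector_branch:
  fixes A :: "'a::complex_banach \<Rightarrow> 'a"
  assumes A: "bounded_clinear A" and Z: "csubspace Z" "closed Z" "A ` Z = Z"
    and x0: "x0 \<in> Z" "x0 \<noteq> 0" "A x0 = 0"
  obtains \<epsilon> where "\<epsilon> > 0" "\<And>\<mu>. cmod \<mu> < \<epsilon> \<Longrightarrow> \<exists>x\<in>Z. x \<noteq> 0 \<and> shift_op A \<mu> x = 0"
proof -
  have cl: "closed (A ` Z)" and ZA: "Z \<subseteq> A ` Z" using Z(2,3) by simp_all
  obtain K where K: "K > 0" and orb: "\<And>x0. x0 \<in> Z \<Longrightarrow> \<exists>x. x 0 = x0 \<and> (\<forall>k. x k \<in> Z) \<and>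
    (\<forall>k. A (x (Suc k)) = x k) \<and> (\<forall>k. norm (x k) \<le> norm x0 * K ^ k)"
    using backward_orbit_exists[OF A Z(1,2) cl ZA] by blast
  obtain x where x: "x 0 = x0" "\<And>k. x k \<in> Z" "\<And>k. A (x (Suc k)) = x k"
    "\<And>k. norm (x k) \<le> norm x0 * K ^ k" using orb[OF x0(1)] by blast
  define f where "f \<mu> = (\<Sum>k. \<mu> ^ k *\<^sub>C x k)" for \<mu>
  have "vector_analytic_on f (ball 0 (1 / K))"
    unfolding f_def by (rule vector_analytic_power_series[OF x(4) K])
  then have "continuous (at 0) f"
    using K unfolding vector_analytic_on_def by (auto dest!: bspec[of _ _ 0] has_derivative_continuous)
  moreover have "f 0 \<noteq> 0" using x0(2) by (simp add: f_def vector_power_series_0 x(1))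
  ultimately obtain \<delta> where \<delta>: "\<delta> > 0" "\<And>\<mu>. dist \<mu> 0 < \<delta> \<Longrightarrow> f \<mu> \<noteq> 0"
    using continuous_at_avoid[of 0 f 0] by (metis dist_commute)
  show ?thesis
  proof (rule that[of "min \<delta> (1 / K)"])
    show "min \<delta> (1 / K) > 0" using \<delta>(1) K by simp
    fix \<mu> assume "cmod \<mu> < min \<delta> (1 / K)"
    then have \<mu>: "cmod \<mu> < \<delta>" "cmod \<mu> < 1 / K" by auto
    have "shift_op A \<mu> (f \<mu>) = 0"
      using backward_orbit_sum[OF A x(3,4) K \<mu>(2)] x(1) x0(3) by (simp add: f_def)
    moreover have "f \<mu> \<in> Z"
      unfolding f_def by (rule vector_power_series_mem[OF x(4) K \<mu>(2) Z(1,2) x(2)])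
    ultimately show "\<exists>x\<in>Z. x \<noteq> 0 \<and> shift_op A \<mu> x = 0" using \<delta>(2)[of \<mu>] \<mu>(1) by auto
  qed
qed

section \<open>The hyper-range of a semi-Fredholm operator\<close>

text \<open>A finite-dimensional kernel can be added to \<open>S\<close> without losing closedness, and
  does not change the image; the enlarged subspace is saturated.\<close>

lemma closed_image_of_closed_csubspace:
  fixes A :: "'a::complex_banach \<Rightarrow> 'a"
  assumes A: "bounded_clinear A" and M: "csubspace M" "closed M" and cl: "closed (A ` M)"
    and fin: "edim {x\<in>M. A x = 0} < \<infinity>" and S: "csubspace S" "closed S" "S \<subseteq> M"
  shows "closed (A ` S)"
proof -
  define K where "K = {x\<in>M. A x = 0}"
  have K: "csubspace K" unfolding K_def by (rule csubspace_kernel_on[OF A M(1)])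
  obtain V where V: "finite V" "V \<subseteq> K" "cspan V = K"
    using finite_edim_basis[OF K] fin unfolding K_def by metis
  define S' where "S' = cspan (S \<union> V)"
  have SM: "S' \<subseteq> M"
    unfolding S'_def using S(3) V(2) by (intro cspan_minimal[OF _ M(1)]) (auto simp: K_def)
  have "closed S'" unfolding S'_def by (rule closed_cspan_Un_finite[OF S(1,2) V(1)])
  then have "closed (A ` S')"
  proof (rule closed_image_if_saturated[OF bounded_clinear_imp_bounded_linear[OF A]
          csubspace_imp_subspace[OF M(1)] M(2) cl _ SM])
    fix s x assume sx: "s \<in> S'" "x \<in> M" "A x = A s"
    then have "x - s \<in> K"
      using SM M(1) by (auto simp: K_def bounded_clinear_diff[OF A] intro: csubspace_diff)
    then have "x - s \<in> S'"
      using V(3) cspan_mono[of V "S \<union> V"] by (auto simp: S'_def)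
    then have "s + (x - s) \<in> S'" using sx(1) unfolding S'_def by (intro cspan_add)
    then show "x \<in> S'" by simp
  qed
  moreover have "A ` S' = A ` S"
  proof
    show "A ` S \<subseteq> A ` S'" unfolding S'_def by (auto intro: cspan_base)
    show "A ` S' \<subseteq> A ` S"
    proof
      fix y assume "y \<in> A ` S'"
      then obtain s v where sv: "s \<in> S" "v \<in> cspan V" "y = A (s + v)"
        unfolding S'_def by (auto simp: in_cspan_Un[OF S(1)])
      then have "A v = 0" using V(3) by (simp add: K_def)
      then show "y \<in> A ` S" using sv by (auto simp: bounded_clinear_add[OF A])
    qed
  qed
  ultimately show ?thesis by simp
qed

lemma funpow_image_Suc: "(A ^^ Suc n) ` M = A ` (A ^^ n) ` M"
  by (simp add: image_comp)

lemma funpow_image_decseq: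
  assumes "A ` M \<subseteq> M"
  shows "decseq (\<lambda>n. (A ^^ n) ` M)"
proof (rule decseq_SucI)
  fix n
  have "(A ^^ Suc n) ` M = (A ^^ n) ` (A ` M)" by (simp add: image_comp funpow_swap1 o_def)
  then show "(A ^^ Suc n) ` M \<subseteq> (A ^^ n) ` M" using assms by auto
qed

lemma funpow_image_subset: "A ` M \<subseteq> M \<Longrightarrow> (A ^^ n) ` M \<subseteq> M"
  by (induction n) auto

lemma closed_funpow_image:
  fixes A :: "'a::complex_banach \<Rightarrow> 'a"
  assumes A: "bounded_clinear A" and M: "csubspace M" "closed M" "A ` M \<subseteq> M" and cl: "closed (A ` M)"
    and fin: "edim {x\<in>M. A x = 0} < \<infinity>"
  shows "closed ((A ^^ n) ` M)"
proof (induction n)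
  case 0
  show ?case using M(2) by simp
next
  case (Suc n)
  show ?case unfolding funpow_image_Suc
    by (rule closed_image_of_closed_csubspace[OF A M(1,2) cl fin
          csubspace_image[OF bounded_clinear_funpow[OF A] M(1)] Suc funpow_image_subset[OF M(3)]])
qed

definition hyper_range :: "'a::complex_normed_vector set \<Rightarrow> ('a \<Rightarrow> 'a) \<Rightarrow> 'a set" where
  "hyper_range M A = (\<Inter>n. (A ^^ n) ` M)"

text \<open>The subspaces \<open>N(A) \<inter> R(A\<^sup>n)\<close> decrease inside the finite-dimensional kernel, so they
  become stationary; from then on a preimage of a point of the hyper-range can be taken in
  the hyper-range.\<close>

lemma hyper_range_semi_fredholm:
  fixes A :: "'a::complex_banach \<Rightarrow> 'a"
  assumes A: "bounded_clinear A" and M: "csubspace M" "closed M" "A ` M \<subseteq> M" and cl: "closed (A ` M)"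
    and fin: "edim {x\<in>M. A x = 0} < \<infinity>"
  shows "csubspace (hyper_range M A)" "closed (hyper_range M A)" "A ` hyper_range M A = hyper_range M A"
    "\<exists>m. {x \<in> (A ^^ m) ` M. A x = 0} \<subseteq> hyper_range M A"
proof -
  define R where "R n = (A ^^ n) ` M" for n
  have Z: "hyper_range M A = (\<Inter>n. R n)" by (simp add: hyper_range_def R_def)
  have R: "csubspace (R n)" for n unfolding R_def by (rule csubspace_image[OF bounded_clinear_funpow[OF A] M(1)])
  have dec: "R n \<subseteq> R m" if "m \<le> n" for m n
    using funpow_image_decseq[OF M(3)] that by (auto simp: R_def decseq_def)
  obtain m where m: "\<And>n. n \<ge> m \<Longrightarrow> {x\<in>R n. A x = 0} = {x\<in>R m. A x = 0}"
  proof (rule decreasing_finite_dimensional_stabilizes[of "\<lambda>n. {x\<in>R n. A x = 0}"])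
    show "csubspace {x\<in>R n. A x = 0}" for n by (rule csubspace_kernel_on[OF A R])
    show "decseq (\<lambda>n. {x\<in>R n. A x = 0})" using dec by (auto simp: decseq_def)
    show "edim {x\<in>R 0. A x = 0} < \<infinity>" using fin by (simp add: R_def)
  qed blast
  show "csubspace (hyper_range M A)" unfolding Z using R by (intro complex_vector.subspace_Inter) auto
  show "closed (hyper_range M A)"
    unfolding Z R_def using closed_funpow_image[OF A M cl fin] by (intro closed_INT) simp
  have "{x \<in> R m. A x = 0} \<subseteq> (\<Inter>n. R n)"
  proof
    fix x assume x: "x \<in> {x\<in>R m. A x = 0}"
    have "x \<in> R n" for n
    proof (cases "n \<ge> m")
      case True
      then show ?thesis using m[of n] x by blast
    next
      case False
      then show ?thesis using dec[of n m] x by auto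
    qed
    then show "x \<in> (\<Inter>n. R n)" by simp
  qed
  then show "\<exists>m. {x \<in> (A ^^ m) ` M. A x = 0} \<subseteq> hyper_range M A" unfolding Z R_def by blast
  define Z where "Z = (\<Inter>n. R n)"
  have "A ` Z = Z"
  proof
    show "A ` Z \<subseteq> Z"
    proof
      fix y assume "y \<in> A ` Z"
      then obtain x where x: "x \<in> Z" "y = A x" by blast
      have "y \<in> R (Suc n)" for n using x by (auto simp: Z_def R_def funpow_image_Suc)
      then have "y \<in> R n" for n using dec[of n "Suc n"] by auto
      then show "y \<in> Z" by (simp add: Z_def)
    qed
    show "Z \<subseteq> A ` Z"
    proof
      fix z assume z: "z \<in> Z"
      have pre: "\<exists>x\<in>R n. A x = z" for n
      proof -
        have "z \<in> R (Suc n)" using z by (simp add: Z_def)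
        then show ?thesis unfolding R_def funpow_image_Suc by blast
      qed
      obtain x where x: "x \<in> R m" "A x = z" using pre by blast
      have "x \<in> R n" for n
      proof (cases "n \<ge> m")
        case True
        obtain y where y: "y \<in> R n" "A y = z" using pre by blast
        have "x - y \<in> R m" using x(1) y(1) dec[OF True] by (intro csubspace_diff[OF R]) auto
        then have "x - y \<in> {x\<in>R m. A x = 0}" using x(2) y(2) by (simp add: bounded_clinear_diff[OF A])
        then have "x - y \<in> R n" using m[OF True] by blast
        then have "y + (x - y) \<in> R n" using y(1) by (intro csubspace_add[OF R])
        then show ?thesis by simp
      next
        case False
        then show ?thesis using dec[of n m] x by auto
      qed
      then show "z \<in> A ` Z" using x(2) by (auto simp: Z_def)
    qed
  qed
  then show "A ` hyper_range M A = hyper_range M A" unfolding Z Z_def .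
qed

text \<open>A kernel vector in the hyper-range would continue to an eigenvector for every small
  \<open>\<mu>\<close>.\<close>

lemma kernel_range_trivial_if_shift_injective:
  fixes A :: "'a::complex_banach \<Rightarrow> 'a"
  assumes A: "bounded_clinear A" and M: "csubspace M" "closed M" "A ` M \<subseteq> M" and cl: "closed (A ` M)"
    and fin: "edim {x\<in>M. A x = 0} < \<infinity>"
    and inj: "\<And>\<epsilon>. \<epsilon> > 0 \<Longrightarrow> \<exists>\<mu>. cmod \<mu> < \<epsilon> \<and> (\<forall>x. shift_op A \<mu> x = 0 \<longrightarrow> x = 0)"
  obtains m where "\<And>x. x \<in> (A ^^ m) ` M \<Longrightarrow> A x = 0 \<Longrightarrow> x = 0"
proof -
  define Z where "Z = hyper_range M A"
  note Z = hyper_range_semi_fredholm[OF A M cl fin, folded Z_def]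
  obtain m where m: "{x \<in> (A ^^ m) ` M. A x = 0} \<subseteq> Z" using Z(4) by blast
  have "x = 0" if x: "x \<in> (A ^^ m) ` M" "A x = 0" for x
  proof (rule ccontr)
    assume "x \<noteq> 0"
    moreover have "x \<in> Z" using m x by blast
    ultimately obtain \<epsilon> where "\<epsilon> > 0" "\<And>\<mu>. cmod \<mu> < \<epsilon> \<Longrightarrow> \<exists>x\<in>Z. x \<noteq> 0 \<and> shift_op A \<mu> x = 0"
      using eigenvector_branch[OF A Z(1-3) _ _ x(2)] by blast
    then show False using inj[of \<epsilon>] by blast
  qed
  then show ?thesis using that by blast
qed

lemma eigenvector_in_funpow_image:
  assumes A: "bounded_clinear A" and M: "csubspace M" and x: "x \<in> M" "A x = \<mu> *\<^sub>C x" and \<mu>: "\<mu> \<noteq> 0"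
  shows "x \<in> (A ^^ n) ` M"
proof -
  have "(A ^^ n) y = \<mu> ^ n *\<^sub>C y" if "A y = \<mu> *\<^sub>C y" for y
    by (induction n) (simp_all add: scaleC_one that bounded_clinear_scaleC[OF A] scaleC_scaleC mult.commute)
  then have "(A ^^ n) ((1 / \<mu> ^ n) *\<^sub>C x) = x"
    using x(2) \<mu>
    by (simp add: bounded_clinear_scaleC[OF bounded_clinear_funpow[OF A]] scaleC_scaleC scaleC_one)
  moreover have "(1 / \<mu> ^ n) *\<^sub>C x \<in> M" using M x(1) by (rule csubspace_scale)
  ultimately show ?thesis by (metis imageI)
qed

text \<open>Eigenvectors of \<open>A\<close> for \<open>\<mu> \<noteq> 0\<close> lie in the hyper-range of \<open>A\<close>, on which
  \<open>A - \<mu>\<close> remains surjective for small \<open>\<mu>\<close>; hence they lie in the hyper-range of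
  \<open>A - \<mu>\<close> as well.\<close>

lemma kernel_in_hyper_range_of_shift:
  fixes A :: "'a::complex_banach \<Rightarrow> 'a"
  assumes A: "bounded_clinear A" and cl: "closed (range A)" and fin: "edim {x. A x = 0} < \<infinity>"
  obtains \<epsilon> where "\<epsilon> > 0"
    "\<And>\<mu> x n. \<mu> \<noteq> 0 \<Longrightarrow> cmod \<mu> < \<epsilon> \<Longrightarrow> shift_op A \<mu> x = 0 \<Longrightarrow> x \<in> range (shift_op A \<mu> ^^ n)"
proof -
  define Z where "Z = hyper_range UNIV A"
  have "edim {x \<in> UNIV. A x = 0} < \<infinity>" using fin by simp
  note Z = hyper_range_semi_fredholm(1-3)[OF A csubspace_UNIV closed_UNIV subset_UNIV cl this,
      folded Z_def]
  obtain \<epsilon> where \<epsilon>: "\<epsilon> > 0" "\<And>\<mu>. cmod \<mu> < \<epsilon> \<Longrightarrow> shift_op A \<mu> ` Z = Z"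
    using shift_op_image_eq_if_image_eq[OF A Z] by blast
  have "x \<in> range (shift_op A \<mu> ^^ n)" if "\<mu> \<noteq> 0" "cmod \<mu> < \<epsilon>" "shift_op A \<mu> x = 0" for \<mu> x n
  proof -
    have "x \<in> Z" unfolding Z_def hyper_range_def
      using eigenvector_in_funpow_image[OF A csubspace_UNIV UNIV_I _ that(1)] that(3)
      by (simp add: shift_op_def)
    moreover have "(shift_op A \<mu> ^^ n) ` Z = Z"
      by (induction n) (simp_all add: funpow_image_Suc \<epsilon>(2)[OF that(2)] del: funpow.simps(2))
    ultimately have "x \<in> (shift_op A \<mu> ^^ n) ` Z" by simp
    then show ?thesis by auto
  qed
  then show ?thesis using that \<epsilon>(1) by blast
qed

section \<open>Ascent and left poles\<close>

text \<open>What the definition of a left pole asks of \<open>A = T - \<mu>\<close> besides \<open>\<mu> \<in> \<sigma>\<^sub>a(T)\<close>.\<close>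

definition left_pole_at_zero :: "('a::complex_normed_vector \<Rightarrow> 'a) \<Rightarrow> bool" where
  "left_pole_at_zero A \<longleftrightarrow> (\<exists>p. ascent A = enat p \<and> closed (range (A ^^ (p + 1))))"

lemma funpow_kernel_stable:
  fixes A :: "'a::complex_normed_vector \<Rightarrow> 'a"
  assumes eq: "{x. (A ^^ p) x = 0} = {x. (A ^^ (p + 1)) x = 0}" and n: "n \<ge> p"
  shows "(A ^^ n) x = 0 \<longleftrightarrow> (A ^^ p) x = 0"
proof -
  have step: "(A ^^ p) y = 0 \<longleftrightarrow> (A ^^ Suc p) y = 0" for y using eq by auto
  have "(A ^^ (p + k)) x = 0 \<longleftrightarrow> (A ^^ p) x = 0" for k
  proof (induction k)
    case (Suc k)
    have "(A ^^ (p + Suc k)) x = (A ^^ Suc p) ((A ^^ k) x)"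
      by (metis add_Suc_right add_Suc funpow_add o_apply)
    also have "\<dots> = 0 \<longleftrightarrow> (A ^^ p) ((A ^^ k) x) = 0" using step by blast
    also have "(A ^^ p) ((A ^^ k) x) = (A ^^ (p + k)) x" by (simp add: funpow_add)
    finally show ?case using Suc by simp
  qed simp
  then show ?thesis using n by (metis le_add_diff_inverse)
qed

lemma ascent_kernel_eq:
  assumes "ascent A = enat p"
  shows "{x. (A ^^ p) x = 0} = {x. (A ^^ (p + 1)) x = 0}"
proof -
  let ?S = "{n. {x. (A ^^ n) x = 0} = {x. (A ^^ (n + 1)) x = 0}}"
  have "enat ` ?S \<noteq> {}"
  proof
    assume "enat ` ?S = {}"
    then have "ascent A = \<infinity>" unfolding ascent_def by (simp only: Inf_empty top_enat_def)
    then show False using assms by simp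
  qed
  then obtain e where "e \<in> enat ` ?S" unfolding ex_in_conv[symmetric] ..
  then have "Inf (enat ` ?S) \<in> enat ` ?S" by (rule wellorder_InfI)
  then have "enat p \<in> enat ` ?S" using assms unfolding ascent_def by simp
  then have "p \<in> ?S" by (elim imageE) (simp only: enat.inject)
  then show ?thesis by simp
qed

lemma ascent_le:
  assumes "{x. (A ^^ m) x = 0} = {x. (A ^^ (m + 1)) x = 0}"
  obtains p where "ascent A = enat p" "p \<le> m"
proof -
  have "ascent A \<le> enat m" unfolding ascent_def by (rule INF_lower) (use assms in simp)
  then show ?thesis using that by (metis enat_ile enat_ord_simps(1))
qed

text \<open>For a left pole of order \<open>p\<close> the closed set \<open>(A\<^sup>p)\<^sup>-\<^sup>1 R(A\<^sup>p\<^sup>+\<^sup>1) = R(A) + N(A\<^sup>p)\<close>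
  contains the kernel of \<open>A\<^sup>p\<^sup>+\<^sup>1\<close>, so \<open>A\<^sup>p\<^sup>+\<^sup>1\<close> maps it onto a closed set, namely
  \<open>R(A\<^sup>p\<^sup>+\<^sup>2)\<close>. Thus \<open>A\<close> acts on \<open>R(A\<^sup>p\<^sup>+\<^sup>1)\<close> injectively with closed range.\<close>

lemma left_pole_bounded_below:
  fixes A :: "'a::complex_banach \<Rightarrow> 'a"
  assumes A: "bounded_clinear A" and pole: "left_pole_at_zero A"
  obtains n c where "closed (range (A ^^ n))" "c > 0"
    "\<And>x. x \<in> range (A ^^ n) \<Longrightarrow> c * norm x \<le> norm (A x)"
proof -
  obtain p where p: "ascent A = enat p" and cl: "closed (range (A ^^ Suc p))"
    using pole by (auto simp: left_pole_at_zero_def)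
  have ker: "(A ^^ n) x = 0 \<longleftrightarrow> (A ^^ p) x = 0" if "n \<ge> p" for n x
    by (rule funpow_kernel_stable[OF ascent_kernel_eq[OF p] that])
  have pow: "bounded_clinear (A ^^ n)" for n by (rule bounded_clinear_funpow[OF A])
  have comm: "(A ^^ n) (A x) = A ((A ^^ n) x)" for n x by (simp add: funpow_swap1)
  define S where "S = (A ^^ p) -` range (A ^^ Suc p)"
  have "closed ((A ^^ Suc p) ` S)"
  proof (rule closed_image_if_saturated[OF bounded_clinear_imp_bounded_linear[OF pow] subspace_UNIV closed_UNIV cl])
    show "closed S" unfolding S_def by (rule closed_vimage_op[OF pow cl])
    fix s x assume s: "s \<in> S" and eq: "(A ^^ Suc p) x = (A ^^ Suc p) s"
    have "(A ^^ Suc p) (x - s) = 0" using eq by (simp add: bounded_clinear_diff[OF pow] del: funpow.simps)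
    then have "(A ^^ p) (x - s) = 0" using ker[of "Suc p"] by simp
    then have "(A ^^ p) x = (A ^^ p) s" by (simp add: bounded_clinear_diff[OF pow])
    then show "x \<in> S" using s by (simp add: S_def)
  qed simp
  moreover have "(A ^^ Suc p) ` S = A ` range (A ^^ Suc p)"
  proof
    show "(A ^^ Suc p) ` S \<subseteq> A ` range (A ^^ Suc p)"
    proof
      fix z assume "z \<in> (A ^^ Suc p) ` S"
      then obtain s y where "z = (A ^^ Suc p) s" "(A ^^ p) s = (A ^^ Suc p) y" by (auto simp: S_def)
      then show "z \<in> A ` range (A ^^ Suc p)" by auto
    qed
    show "A ` range (A ^^ Suc p) \<subseteq> (A ^^ Suc p) ` S"
    proof
      fix z assume "z \<in> A ` range (A ^^ Suc p)"
      then obtain y where z: "z = A ((A ^^ Suc p) y)" by auto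
      have "z = (A ^^ Suc p) (A y)" unfolding z comm ..
      moreover have "A y \<in> S" by (simp add: S_def comm)
      ultimately show "z \<in> (A ^^ Suc p) ` S" by blast
    qed
  qed
  ultimately have clA: "closed (A ` range (A ^^ Suc p))" by simp
  have inj: "x = 0" if x: "x \<in> range (A ^^ Suc p)" and "A x = 0" for x
  proof -
    obtain y where y: "x = (A ^^ Suc p) y" using x by blast
    have "(A ^^ Suc (Suc p)) y = 0" using \<open>A x = 0\<close> y by simp
    then have "(A ^^ Suc p) y = 0" using ker[of "Suc (Suc p)" y] ker[of "Suc p" y] by simp
    then show ?thesis using y by simp
  qed
  have sub: "csubspace (range (A ^^ Suc p))"
    by (rule csubspace_image[OF pow csubspace_UNIV])
  obtain c where "c > 0" "\<And>x. x \<in> range (A ^^ Suc p) \<Longrightarrow> c * norm x \<le> norm (A x)"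
    using bounded_below_if_inj_closed_image[OF bounded_clinear_imp_bounded_linear[OF A]
        csubspace_imp_subspace[OF sub] cl clA inj] by blast
  then show ?thesis using that cl by blast
qed

lemma funpow_range_invariant: "A ` range (A ^^ n) \<subseteq> range (A ^^ n)"
  by (auto simp: funpow_swap1)

lemma csubspace_funpow_range:
  fixes A :: "'a::complex_normed_vector \<Rightarrow> 'a"
  shows "bounded_clinear A \<Longrightarrow> csubspace (range (A ^^ n))"
  by (rule csubspace_image[OF bounded_clinear_funpow csubspace_UNIV])

lemma left_pole_imp_upper_semi_b_weyl:
  fixes A :: "'a::complex_banach \<Rightarrow> 'a"
  assumes A: "bounded_clinear A" and pole: "left_pole_at_zero A"
  shows "upper_semi_b_weyl A"
proof -
  obtain n c where n: "closed (range (A ^^ n))" "c > 0"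
    "\<And>x. x \<in> range (A ^^ n) \<Longrightarrow> c * norm x \<le> norm (A x)"
    using left_pole_bounded_below[OF A pole] by blast
  then have "upper_semi_weyl_on (range (A ^^ n)) A"
    by (intro upper_semi_weyl_on_if_bounded_below[OF A csubspace_funpow_range[OF A] _ funpow_range_invariant])
  then show ?thesis unfolding upper_semi_b_weyl_def using n(1) by blast
qed

subsection \<open>Shifts of an operator and of its restriction to the range of a power\<close>

text \<open>For \<open>\<mu> \<noteq> 0\<close> the polynomials \<open>z\<^sup>n\<close> and \<open>z - \<mu>\<close> are coprime. The next two lemmas are what
  this means for \<open>R(A - \<mu>)\<close>: it contains \<open>N(A\<^sup>n)\<close>, and it meets \<open>R(A\<^sup>n)\<close> only in the image
  of \<open>R(A\<^sup>n)\<close>. Instead of a Bezout identity the proofs use \<open>\<mu> x = A x - (A - \<mu>) x\<close> once for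
  each power of \<open>A\<close>.\<close>

lemma funpow_kernel_subset_range_shift:
  assumes A: "bounded_clinear A" and \<mu>: "\<mu> \<noteq> 0" and x: "(A ^^ n) x = 0"
  shows "x \<in> range (shift_op A \<mu>)"
  using x
proof (induction n arbitrary: x)
  case 0
  then show ?case
    using bounded_clinear_zero[OF bounded_clinear_shift_op[OF A]] by (auto intro: image_eqI[of _ _ 0])
next
  case (Suc n)
  have "(A ^^ n) (A x) = 0" using Suc.prems by (simp add: funpow_swap1)
  then obtain y where y: "A x = shift_op A \<mu> y" using Suc.IH by blast
  have "shift_op A \<mu> (y - x) = \<mu> *\<^sub>C x"
    by (simp add: bounded_clinear_diff[OF bounded_clinear_shift_op[OF A]] y[symmetric])
      (simp add: shift_op_def)
  then have "shift_op A \<mu> ((1/\<mu>) *\<^sub>C (y - x)) = x"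
    using \<mu> by (simp add: bounded_clinear_scaleC[OF bounded_clinear_shift_op[OF A]] scaleC_scaleC scaleC_one)
  then show ?case by (metis rangeI)
qed

lemma in_funpow_range_if_shift_in:
  assumes A: "bounded_clinear A" and \<mu>: "\<mu> \<noteq> 0" and y: "shift_op A \<mu> y \<in> range (A ^^ n)"
  shows "y \<in> range (A ^^ n)"
proof -
  have "y \<in> range (A ^^ k)" if "k \<le> n" for k
    using that
  proof (induction k)
    case (Suc k)
    then obtain u where u: "y = (A ^^ k) u" by auto
    have "range (A ^^ n) \<subseteq> range (A ^^ Suc k)"
      using decseqD[OF funpow_image_decseq[OF subset_UNIV] Suc.prems] .
    then have "shift_op A \<mu> y \<in> range (A ^^ Suc k)" using y by blast
    moreover have "A y \<in> range (A ^^ Suc k)" by (simp add: u)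
    ultimately have "A y - shift_op A \<mu> y \<in> range (A ^^ Suc k)"
      using csubspace_diff[OF csubspace_funpow_range[OF A]] by blast
    then have "\<mu> *\<^sub>C y \<in> range (A ^^ Suc k)" by (simp add: shift_op_def)
    then have "(1/\<mu>) *\<^sub>C (\<mu> *\<^sub>C y) \<in> range (A ^^ Suc k)"
      by (rule csubspace_scale[OF csubspace_funpow_range[OF A]])
    then show ?case using \<mu> by (simp add: scaleC_scaleC scaleC_one)
  qed simp
  then show ?thesis by simp
qed

lemma shift_op_funpow_commute:
  "bounded_clinear A \<Longrightarrow> shift_op A \<mu> ((A ^^ n) x) = (A ^^ n) (shift_op A \<mu> x)"
  by (simp add: shift_op_def bounded_clinear_diff[OF bounded_clinear_funpow]
      bounded_clinear_scaleC[OF bounded_clinear_funpow] funpow_swap1)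

text \<open>Since \<open>N(A\<^sup>n) \<subseteq> R(A - \<mu>)\<close>, the range of \<open>A - \<mu>\<close> is the full preimage under \<open>A\<^sup>n\<close> of
  \<open>(A - \<mu>) R(A\<^sup>n)\<close>.\<close>

lemma closed_range_shift_if_restriction:
  fixes A :: "'a::complex_banach \<Rightarrow> 'a"
  assumes A: "bounded_clinear A" and \<mu>: "\<mu> \<noteq> 0" and cl: "closed (shift_op A \<mu> ` range (A ^^ n))"
  shows "closed (range (shift_op A \<mu>))"
proof -
  have "range (shift_op A \<mu>) = (A ^^ n) -` (shift_op A \<mu> ` range (A ^^ n))"
  proof
    show "range (shift_op A \<mu>) \<subseteq> (A ^^ n) -` (shift_op A \<mu> ` range (A ^^ n))"
      by (auto simp: shift_op_funpow_commute[OF A, symmetric])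
    show "(A ^^ n) -` (shift_op A \<mu> ` range (A ^^ n)) \<subseteq> range (shift_op A \<mu>)"
    proof
      fix x assume "x \<in> (A ^^ n) -` (shift_op A \<mu> ` range (A ^^ n))"
      then obtain y where y: "(A ^^ n) x = (A ^^ n) (shift_op A \<mu> y)"
        by (auto simp: shift_op_funpow_commute[OF A])
      then have "(A ^^ n) (x - shift_op A \<mu> y) = 0"
        by (simp add: bounded_clinear_diff[OF bounded_clinear_funpow[OF A]])
      then have "x - shift_op A \<mu> y \<in> range (shift_op A \<mu>)"
        by (rule funpow_kernel_subset_range_shift[OF A \<mu>])
      then obtain z where "x - shift_op A \<mu> y = shift_op A \<mu> z" by blast
      then have "x = shift_op A \<mu> (z + y)"
        by (simp add: bounded_clinear_add[OF bounded_clinear_shift_op[OF A]] algebra_simps)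
      then show "x \<in> range (shift_op A \<mu>)" by blast
    qed
  qed
  then show ?thesis using closed_vimage_op[OF bounded_clinear_funpow[OF A] cl] by simp
qed

lemma kernel_shift_in_funpow_range:
  "bounded_clinear A \<Longrightarrow> \<mu> \<noteq> 0 \<Longrightarrow> shift_op A \<mu> x = 0 \<Longrightarrow> x \<in> range (A ^^ n)"
  using eigenvector_in_funpow_image[OF _ csubspace_UNIV UNIV_I] by (simp add: shift_op_def)

lemma upper_semi_weyl_shift_if_restriction:
  fixes A :: "'a::complex_banach \<Rightarrow> 'a"
  assumes A: "bounded_clinear A" and \<mu>: "\<mu> \<noteq> 0"
    and weyl: "upper_semi_weyl_on (range (A ^^ n)) (shift_op A \<mu>)"
  shows "upper_semi_weyl (shift_op A \<mu>)"
proof -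
  define M where "M = range (A ^^ n)"
  have S: "bounded_clinear (shift_op A \<mu>)" by (rule bounded_clinear_shift_op[OF A])
  have M: "csubspace M" unfolding M_def by (rule csubspace_funpow_range[OF A])
  have W: "closed (shift_op A \<mu> ` M)" "nullity_on M (shift_op A \<mu>) < \<infinity>"
    "nullity_on M (shift_op A \<mu>) \<le> deficiency_on M (shift_op A \<mu>)"
    using weyl unfolding upper_semi_weyl_on_iff M_def by auto
  have null: "nullity_on UNIV (shift_op A \<mu>) = nullity_on M (shift_op A \<mu>)"
    unfolding nullity_on_def M_def using kernel_shift_in_funpow_range[OF A \<mu>]
    by (intro arg_cong[where f = edim]) auto
  obtain k where k: "nullity_on M (shift_op A \<mu>) = enat k" using W(2) by auto
  then obtain B where B: "finite B" "card B = k" "cindependent B" "B \<subseteq> M" "cspan B \<inter> shift_op A \<mu> ` M \<subseteq> {0}"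
    using independent_mod_of_ecodim_in[OF csubspace_image[OF S M], of k M] W(3)
    unfolding deficiency_on_def by auto
  have "cspan B \<inter> range (shift_op A \<mu>) \<subseteq> {0}"
  proof
    fix x assume x: "x \<in> cspan B \<inter> range (shift_op A \<mu>)"
    then obtain y where y: "x = shift_op A \<mu> y" by blast
    have "x \<in> M" using x cspan_minimal[OF B(4) M] by blast
    then have "y \<in> M" using in_funpow_range_if_shift_in[OF A \<mu>] y by (simp add: M_def)
    then show "x \<in> {0}" using x y B(5) by blast
  qed
  then have "enat (card B) \<le> deficiency_on UNIV (shift_op A \<mu>)"
    unfolding deficiency_on_def
    by (intro ecodim_in_ge[OF csubspace_image[OF S csubspace_UNIV] B(1,3)]) auto
  then show ?thesis
    unfolding upper_semi_weyl_on_iff null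
    using closed_range_shift_if_restriction[OF A \<mu> W(1)[unfolded M_def]] k B(2) by simp
qed

lemma left_pole_shift_bounded_below:
  fixes A :: "'a::complex_banach \<Rightarrow> 'a"
  assumes A: "bounded_clinear A" and pole: "left_pole_at_zero A"
  obtains \<epsilon> where "\<epsilon> > 0"
    "\<And>\<mu>. \<mu> \<noteq> 0 \<Longrightarrow> cmod \<mu> < \<epsilon> \<Longrightarrow> \<exists>c>0. \<forall>x. c * norm x \<le> norm (shift_op A \<mu> x)"
proof -
  obtain n c where cl: "closed (range (A ^^ n))" and c: "c > 0"
    and below: "\<And>x. x \<in> range (A ^^ n) \<Longrightarrow> c * norm x \<le> norm (A x)"
    using left_pole_bounded_below[OF A pole] by blast
  have "\<exists>c>0. \<forall>x. c * norm x \<le> norm (shift_op A \<mu> x)" if \<mu>: "\<mu> \<noteq> 0" "cmod \<mu> < c" for \<mu>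
  proof -
    have S: "bounded_linear (shift_op A \<mu>)"
      by (rule bounded_clinear_imp_bounded_linear[OF bounded_clinear_shift_op[OF A]])
    have belowS: "(c - cmod \<mu>) * norm x \<le> norm (shift_op A \<mu> x)" if "x \<in> range (A ^^ n)" for x
      using below[OF that] norm_shift_op_ge[of A x 0 \<mu>] by (simp add: left_diff_distrib)
    have "closed (shift_op A \<mu> ` range (A ^^ n))"
      by (rule bounded_below_imp_closed_image[OF S csubspace_imp_subspace[OF csubspace_funpow_range[OF A]] cl _ belowS])
        (use \<mu>(2) in simp)
    then have clS: "closed (range (shift_op A \<mu>))" by (rule closed_range_shift_if_restriction[OF A \<mu>(1)])
    have injS: "x = 0" if "shift_op A \<mu> x = 0" for x
      using belowS[OF kernel_shift_in_funpow_range[OF A \<mu>(1) that]] that \<mu>(2) by (simp add: mult_le_0_iff)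
    obtain d where "d > 0" "\<And>x. x \<in> UNIV \<Longrightarrow> d * norm x \<le> norm (shift_op A \<mu> x)"
      using bounded_below_if_inj_closed_image[OF S subspace_UNIV closed_UNIV clS injS] by blast
    then show ?thesis by blast
  qed
  then show ?thesis using that c by blast
qed

subsection \<open>Recognizing left poles\<close>

text \<open>On \<open>M = R(A\<^sup>n)\<close> the kernel of \<open>A\<close> misses \<open>R(A\<^sup>m\<^sup>+\<^sup>n)\<close> for some \<open>m\<close>, which bounds the
  ascent. Large powers have closed range, and closedness descends as long as the kernels
  do not grow.\<close>

lemma left_pole_if_upper_semi_b_weyl:
  fixes A :: "'a::complex_banach \<Rightarrow> 'a"
  assumes A: "bounded_clinear A" and weyl: "upper_semi_b_weyl A"
    and inj: "\<And>\<epsilon>. \<epsilon> > 0 \<Longrightarrow> \<exists>\<mu>. cmod \<mu> < \<epsilon> \<and> (\<forall>x. shift_op A \<mu> x = 0 \<longrightarrow> x = 0)"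
  shows "left_pole_at_zero A"
proof -
  obtain n where cl: "closed (range (A ^^ n))" and W: "upper_semi_weyl_on (range (A ^^ n)) A"
    using weyl unfolding upper_semi_b_weyl_def by blast
  have pow: "bounded_clinear (A ^^ k)" for k by (rule bounded_clinear_funpow[OF A])
  have clA: "closed (A ` range (A ^^ n))" and fin: "edim {x \<in> range (A ^^ n). A x = 0} < \<infinity>"
    using W unfolding upper_semi_weyl_on_iff nullity_on_def by auto
  have comp: "(A ^^ k) ` range (A ^^ n) = range (A ^^ (k + n))" for k
    by (simp add: funpow_add image_comp)
  have closed_large: "closed (range (A ^^ (k + n)))" for k
    using closed_funpow_image[OF A csubspace_funpow_range[OF A] cl funpow_range_invariant clA fin, of k] comp
    by simp
  obtain m where m: "\<And>x. x \<in> range (A ^^ (m + n)) \<Longrightarrow> A x = 0 \<Longrightarrow> x = 0"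
    using kernel_range_trivial_if_shift_injective[OF A csubspace_funpow_range[OF A] cl
        funpow_range_invariant clA fin inj] unfolding comp by blast
  have "{x. (A ^^ (m + n)) x = 0} = {x. (A ^^ (m + n + 1)) x = 0}"
  proof (rule Collect_cong, rule iffI)
    fix x assume "(A ^^ (m + n)) x = 0"
    then show "(A ^^ (m + n + 1)) x = 0" by (simp add: bounded_clinear_zero[OF A])
  next
    fix x assume "(A ^^ (m + n + 1)) x = 0"
    then show "(A ^^ (m + n)) x = 0" by (intro m[of "(A ^^ (m + n)) x"]) simp_all
  qed
  then obtain p where p: "ascent A = enat p" "p \<le> m + n" by (rule ascent_le)
  have ker: "(A ^^ k) x = 0 \<longleftrightarrow> (A ^^ p) x = 0" if "k \<ge> p" for k x
    by (rule funpow_kernel_stable[OF ascent_kernel_eq[OF p(1)] that])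
  have descend: "closed (range (A ^^ k))" if "k \<ge> p" "closed (range (A ^^ Suc k))" for k
  proof (rule closed_range_of_factor[OF bounded_clinear_imp_bounded_linear[OF pow] bounded_clinear_imp_bounded_linear[OF A]])
    show "closed (range (\<lambda>x. A ((A ^^ k) x)))" using that(2) by (simp add: o_def)
    have "{x. A ((A ^^ k) x) = 0} = {x. (A ^^ k) x = 0}"
      using ker[of "Suc k"] ker[of k] that(1) by simp
    then have "(A ^^ k) ` {x. A ((A ^^ k) x) = 0} \<subseteq> {0}" by auto
    then show "closed ((A ^^ k) ` {x. A ((A ^^ k) x) = 0})"
      by (metis closed_empty closed_singleton subset_singletonD)
  qed
  have le: "p + 1 \<le> Suc m + n" using p(2) by simp
  have "closed (range (A ^^ (p + 1)))"
    using le
  proof (induction rule: inc_induct)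
    case base
    show ?case by (rule closed_large)
  next
    case (step k)
    show ?case by (rule descend[OF _ step.IH]) (use step.hyps in simp)
  qed
  then show ?thesis using p(1) by (auto simp: left_pole_at_zero_def)
qed

lemma finite_edim_kernel_funpow:
  fixes A :: "'a::complex_normed_vector \<Rightarrow> 'a"
  assumes A: "bounded_clinear A" and fin: "edim {x. A x = 0} < \<infinity>"
  shows "edim {x. (A ^^ n) x = 0} < \<infinity>"
proof (induction n)
  case 0
  then show ?case by (intro edim_finite_if_subset_cspan[of "{}"]) auto
next
  case (Suc n)
  define N where "N k = {x. (A ^^ k) x = 0}" for k
  have N: "csubspace (N k)" for k unfolding N_def by (rule csubspace_kernel[OF bounded_clinear_funpow[OF A]])
  have sub: "A ` N (Suc n) \<subseteq> N n" by (auto simp: N_def funpow_swap1)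
  have AN: "csubspace (A ` N (Suc n))" by (rule csubspace_image[OF A N])
  have "edim (A ` N (Suc n)) < \<infinity>"
    using edim_mono[OF AN N sub] Suc unfolding N_def by (rule le_less_trans)
  then obtain P where P: "finite P" "P \<subseteq> A ` N (Suc n)" "cspan P = A ` N (Suc n)"
    using finite_edim_basis[OF AN] by metis
  obtain Q where Q: "finite Q" "Q \<subseteq> N (Suc n)" "A ` Q = P" using finite_subset_image[OF P(1,2)] by metis
  obtain V where V: "finite V" "cspan V = {x. A x = 0}"
    using finite_edim_basis[OF csubspace_kernel[OF A] fin] by metis
  have "N (Suc n) \<subseteq> cspan (V \<union> Q)"
  proof
    fix x assume "x \<in> N (Suc n)"
    then have "A x \<in> A ` cspan Q" using P(3) Q(3) cspan_image[OF A, of Q] by auto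
    then obtain q where q: "q \<in> cspan Q" "A x = A q" by blast
    then have "x - q \<in> cspan V" using V(2) by (simp add: bounded_clinear_diff[OF A])
    then have "(x - q) + q \<in> cspan (V \<union> Q)" using q(1)
      by (intro cspan_add)
        (use cspan_mono[of V "V \<union> Q"] cspan_mono[of Q "V \<union> Q"] in auto)
    then show "x \<in> cspan (V \<union> Q)" by simp
  qed
  then show ?case unfolding N_def using V(1) Q(1) by (intro edim_finite_if_subset_cspan) auto
qed

text \<open>With \<open>p\<close> the ascent and \<open>P\<close> a projection onto the finite-dimensional \<open>N = N(A\<^sup>p)\<close>, the
  finite-rank perturbation \<open>A (1 - P) + P\<close> of \<open>A\<close> is the identity on \<open>N\<close>, and it is injective
  because \<open>A\<^sup>-\<^sup>1 N = N\<close>.\<close>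

lemma upper_semi_weyl_if_left_pole_finite_rank:
  fixes A :: "'a::complex_banach \<Rightarrow> 'a"
  assumes A: "bounded_clinear A" and pole: "left_pole_at_zero A" and fin: "nullity A < \<infinity>"
  shows "upper_semi_weyl A"
proof -
  obtain p where p: "ascent A = enat p" and cl: "closed (range (A ^^ Suc p))"
    using pole by (auto simp: left_pole_at_zero_def)
  have pow: "bounded_clinear (A ^^ n)" for n by (rule bounded_clinear_funpow[OF A])
  define N where "N = {x. (A ^^ p) x = 0}"
  have N: "csubspace N" unfolding N_def by (rule csubspace_kernel[OF pow])
  have fin': "edim {x. A x = 0} < \<infinity>" using fin by (simp add: nullity_on_def)
  obtain V where V: "finite V" "cindependent V" "cspan V = N"
    using finite_edim_basis[OF N] finite_edim_kernel_funpow[OF A fin', of p] unfolding N_def by metis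
  have NA: "A x \<in> N \<longleftrightarrow> x \<in> N" for x
    using funpow_kernel_stable[OF ascent_kernel_eq[OF p], of "Suc p" x] by (simp add: N_def funpow_swap1)
  have clA: "closed (range A)"
  proof (rule closed_range_of_factor[OF bounded_clinear_imp_bounded_linear[OF A] bounded_clinear_imp_bounded_linear[OF pow]])
    show "closed (range (\<lambda>x. (A ^^ p) (A x)))" using cl by (simp add: o_def funpow_swap1)
    have "{x. (A ^^ p) (A x) = 0} = N" using NA by (auto simp: N_def)
    then show "closed (A ` {x. (A ^^ p) (A x) = 0})"
      using closed_cspan_finite[of "A ` V"] cspan_image[OF A, of V] V(1,3) by simp
  qed
  obtain P where P: "bounded_clinear P" "\<And>v. v \<in> V \<Longrightarrow> P v = v" "range P \<subseteq> cspan (id ` V)"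
    using finite_rank_extension[OF V(1,2), of id] by (metis id_apply)
  have PN: "P x \<in> N" for x using P(3) V(3) by auto
  have "csubspace {x. P x = x}"
    by (rule csubspaceI) (auto simp: bounded_clinear_simps[OF P(1)])
  then have P_id: "P x = x" if "x \<in> N" for x
    using cspan_minimal[of V "{x. P x = x}"] P(2) V(3) that by blast
  define F where "F x = P x - A (P x)" for x
  note bl = bounded_clinear_imp_bounded_linear
  have "bounded_linear F"
    unfolding F_def by (rule bounded_linear_sub[OF bl[OF P(1)] bounded_linear_compose[OF bl[OF A] bl[OF P(1)]]])
  then have F: "bounded_clinear F"
    by (simp add: bounded_clinear_def F_def bounded_clinear_scaleC[OF A] bounded_clinear_scaleC[OF P(1)]
        scaleC_right_diff_distrib)
  have rF: "range F \<subseteq> cspan V"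
    unfolding V(3) F_def using PN NA by (auto intro: csubspace_diff[OF N])
  define B where "B x = A x + F x" for x
  have B: "bounded_clinear B" unfolding B_def by (rule bounded_clinear_plus[OF A F])
  have B_eq: "B x = A (x - P x) + P x" for x by (simp add: B_def F_def bounded_clinear_diff[OF A])
  have inj: "x = 0" if "B x = 0" for x
  proof -
    have "A (x - P x) = - P x" using that unfolding B_eq by (simp add: eq_neg_iff_add_eq_0)
    then have "x - P x \<in> N" using NA csubspace_neg[OF N PN] by metis
    then have "x \<in> N" using csubspace_add[OF N _ PN, of "x - P x" x] by simp
    then show ?thesis using that unfolding B_eq by (simp add: P_id bounded_clinear_zero[OF A])
  qed
  have "range B = cspan (A ` {x. P x = 0} \<union> V)"
  proof
    have "A (x - P x) \<in> A ` {x. P x = 0}" for x using P_id[OF PN] by (simp add: bounded_clinear_diff[OF P(1)])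
    then show "range B \<subseteq> cspan (A ` {x. P x = 0} \<union> V)"
      using PN V(3) in_cspan_Un[OF csubspace_image[OF A csubspace_kernel[OF P(1)]]] unfolding B_eq by blast
    have "A x \<in> range B" if "P x = 0" for x by (rule range_eqI[of _ _ x]) (simp add: B_eq that)
    moreover have "v \<in> range B" if "v \<in> V" for v
      by (rule range_eqI[of _ _ v]) (simp add: B_eq P(2)[OF that] bounded_clinear_zero[OF A])
    ultimately show "cspan (A ` {x. P x = 0} \<union> V) \<subseteq> range B"
      by (intro cspan_minimal[OF _ csubspace_image[OF B csubspace_UNIV]]) auto
  qed
  moreover have "closed (A ` {x. P x = 0})"
    using closed_image_of_closed_csubspace[OF A csubspace_UNIV closed_UNIV clA _
        csubspace_kernel[OF P(1)] closed_kernel[OF P(1)]] fin' by simp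
  ultimately have "closed (range B)"
    using closed_cspan_Un_finite[OF csubspace_image[OF A csubspace_kernel[OF P(1)]] _ V(1)] by simp
  then obtain c where "c > 0" "\<And>x. x \<in> UNIV \<Longrightarrow> c * norm x \<le> norm (B x)"
    using bounded_below_if_inj_closed_image[OF bounded_clinear_imp_bounded_linear[OF B] subspace_UNIV closed_UNIV _ inj]
    by blast
  then show ?thesis
    using perturbation_imp_upper_semi_weyl_on[OF A csubspace_UNIV closed_UNIV subset_UNIV F V(1) subset_UNIV rF]
    by (simp add: B_def)
qed

section \<open>Properties (z) and (gz) through isolated points of the spectrum\<close>

lemma shift_op_recenter: "shift_op T \<mu> = shift_op (shift_op T \<nu>) (\<mu> - \<nu>)"
  by (simp add: shift_op_shift_op)

lemma notin_approx_point_spectrum_iff: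
  assumes T: "bounded_clinear T"
  shows "\<mu> \<notin> approx_point_spectrum T \<longleftrightarrow> (\<exists>c>0. \<forall>x. c * norm x \<le> norm (shift_op T \<mu> x))"
proof
  assume nin: "\<mu> \<notin> approx_point_spectrum T"
  show "\<exists>c>0. \<forall>x. c * norm x \<le> norm (shift_op T \<mu> x)"
  proof (rule ccontr)
    assume *: "\<not> ?thesis"
    have "\<exists>y. norm (shift_op T \<mu> y) < (1 / real (Suc n)) * norm y" for n
    proof -
      have "(1 / real (Suc n)) > 0" by simp
      then show ?thesis using * not_le by blast
    qed
    then obtain y where y: "\<And>n. norm (shift_op T \<mu> (y n)) < (1 / real (Suc n)) * norm (y n)" by metis
    have y0: "norm (y n) > 0" for n
      using le_less_trans[OF norm_ge_zero y[of n]] by (cases "y n = 0") simp_all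
    define x where "x n = (1 / norm (y n)) *\<^sub>R y n" for n
    have "norm (x n) = 1" for n using y0[of n] by (simp add: x_def)
    moreover have "(\<lambda>n. shift_op T \<mu> (x n)) \<longlonglongrightarrow> 0"
    proof (rule Lim_null_comparison)
      have "norm (shift_op T \<mu> (x n)) \<le> 1 / real (Suc n)" for n
      proof -
        have "shift_op T \<mu> (x n) = (1 / norm (y n)) *\<^sub>R shift_op T \<mu> (y n)"
          unfolding x_def
          by (rule linear_scale[OF bounded_linear.linear[OF bounded_clinear_imp_bounded_linear[OF bounded_clinear_shift_op[OF T]]]])
        then show ?thesis using y[of n] y0[of n] by (simp add: field_simps)
      qed
      then show "\<forall>\<^sub>F n in sequentially. norm (shift_op T \<mu> (x n)) \<le> 1 / real (Suc n)" by simp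
      show "(\<lambda>n. 1 / real (Suc n)) \<longlonglongrightarrow> 0" using LIMSEQ_inverse_real_of_nat by (simp add: inverse_eq_divide)
    qed
    ultimately show False using nin by (auto simp: approx_point_spectrum_def)
  qed
next
  assume "\<exists>c>0. \<forall>x. c * norm x \<le> norm (shift_op T \<mu> x)"
  then obtain c where c: "c > 0" "\<And>x. c * norm x \<le> norm (shift_op T \<mu> x)" by blast
  show "\<mu> \<notin> approx_point_spectrum T"
  proof
    assume "\<mu> \<in> approx_point_spectrum T"
    then obtain x where x: "\<And>n::nat. norm (x n) = 1" "(\<lambda>n. shift_op T \<mu> (x n)) \<longlonglongrightarrow> 0"
      by (auto simp: approx_point_spectrum_def)
    have "c \<le> norm (0::'a)"
      by (rule LIMSEQ_le_const[OF tendsto_norm[OF x(2)]]) (use c(2) x(1) in \<open>metis mult_1_right\<close>)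
    then show False using c(1) by simp
  qed
qed

lemma notin_op_spectrum_iff:
  assumes T: "bounded_clinear T"
  shows "\<mu> \<notin> op_spectrum T \<longleftrightarrow>
    (\<exists>c>0. \<forall>x. c * norm x \<le> norm (shift_op T \<mu> x)) \<and> range (shift_op T \<mu>) = UNIV"
proof
  assume "\<mu> \<notin> op_spectrum T"
  then obtain S where S: "bounded_clinear S" "S \<circ> shift_op T \<mu> = id" "shift_op T \<mu> \<circ> S = id"
    by (auto simp: op_spectrum_def)
  have SA: "S (shift_op T \<mu> x) = x" and AS: "shift_op T \<mu> (S x) = x" for x
    using S(2,3) by (simp_all add: fun_eq_iff)
  obtain K where K: "K > 0" "\<And>x. norm (S x) \<le> norm x * K"
    using bounded_linear.pos_bounded[OF bounded_clinear_imp_bounded_linear[OF S(1)]] by blast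
  have "(1/K) * norm x \<le> norm (shift_op T \<mu> x)" for x
    using K(2)[of "shift_op T \<mu> x"] K(1) by (simp add: SA field_simps)
  then have "\<exists>c>0. \<forall>x. c * norm x \<le> norm (shift_op T \<mu> x)" using K(1) by (intro exI[of _ "1/K"]) simp
  moreover have "range (shift_op T \<mu>) = UNIV" using AS by (metis surjI)
  ultimately show "(\<exists>c>0. \<forall>x. c * norm x \<le> norm (shift_op T \<mu> x)) \<and> range (shift_op T \<mu>) = UNIV" ..
next
  assume *: "(\<exists>c>0. \<forall>x. c * norm x \<le> norm (shift_op T \<mu> x)) \<and> range (shift_op T \<mu>) = UNIV"
  then obtain c where c: "c > 0" "\<And>x. c * norm x \<le> norm (shift_op T \<mu> x)" by blast
  define A where "A = shift_op T \<mu>"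
  have A: "bounded_clinear A" unfolding A_def by (rule bounded_clinear_shift_op[OF T])
  have below: "c * norm x \<le> norm (A x)" for x using c(2) by (simp add: A_def)
  have inj: "inj A"
  proof (rule injI)
    fix x y assume "A x = A y"
    then show "x = y" using below[of "x - y"] c(1) by (simp add: bounded_clinear_diff[OF A] mult_le_0_iff)
  qed
  define S where "S = inv A"
  have AS: "A (S y) = y" for y using * by (simp add: S_def A_def surj_f_inv_f)
  have SA: "S (A x) = x" for x using inj by (simp add: S_def)
  have eqI: "x = y" if "A x = A y" for x y using inj that by (simp add: inj_eq)
  have scale: "S (k *\<^sub>C x) = k *\<^sub>C S x" for k x by (rule eqI) (simp add: AS bounded_clinear_simps[OF A])
  have "bounded_linear S"
  proof (rule bounded_linear_intro)
    show "S (x + y) = S x + S y" for x y by (rule eqI) (simp add: AS bounded_clinear_simps[OF A])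
    show "S (r *\<^sub>R x) = r *\<^sub>R S x" for r x using scale[of "of_real r" x] by (simp add: scaleC_of_real)
    show "norm (S x) \<le> norm x * (1/c)" for x using below[of "S x"] c(1) by (simp add: AS field_simps)
  qed
  then have "bounded_clinear S" using scale by (simp add: bounded_clinear_def)
  then show "\<mu> \<notin> op_spectrum T" using AS SA by (auto simp: op_spectrum_def fun_eq_iff A_def)
qed

lemma approx_point_spectrum_subset: "bounded_clinear T \<Longrightarrow> approx_point_spectrum T \<subseteq> op_spectrum T"
  using notin_approx_point_spectrum_iff notin_op_spectrum_iff by blast

lemma injective_if_bounded_below: "c > 0 \<Longrightarrow> c * norm x \<le> norm (A x) \<Longrightarrow> A x = 0 \<Longrightarrow> x = 0"
  by (simp add: mult_le_0_iff)

lemma upper_semi_weyl_if_notin_approx_point_spectrum: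
  fixes T :: "'a::complex_banach \<Rightarrow> 'a"
  assumes "bounded_clinear T" "\<mu> \<notin> approx_point_spectrum T"
  shows "upper_semi_weyl (shift_op T \<mu>)"
  using assms(2) unfolding notin_approx_point_spectrum_iff[OF assms(1)]
  by (metis upper_semi_weyl_on_if_bounded_below[OF bounded_clinear_shift_op[OF assms(1)]
        csubspace_UNIV closed_UNIV subset_UNIV])

lemma approx_point_spectrum_closed_complement:
  assumes T: "bounded_clinear T" and \<mu>: "\<mu> \<notin> approx_point_spectrum T"
  obtains \<epsilon> where "\<epsilon> > 0" "\<And>\<nu>. dist \<nu> \<mu> < \<epsilon> \<Longrightarrow> \<nu> \<notin> approx_point_spectrum T"
proof -
  obtain c where c: "c > 0" "\<And>x. c * norm x \<le> norm (shift_op T \<mu> x)"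
    using \<mu> unfolding notin_approx_point_spectrum_iff[OF T] by blast
  have "\<nu> \<notin> approx_point_spectrum T" if "dist \<nu> \<mu> < c" for \<nu>
  proof -
    have "(c - dist \<nu> \<mu>) * norm x \<le> norm (shift_op T \<nu> x)" for x
      using c(2)[of x] norm_shift_op_ge[of "shift_op T \<mu>" x 0 "\<nu> - \<mu>"]
      unfolding shift_op_recenter[of T \<nu> \<mu>] by (simp add: left_diff_distrib dist_norm)
    then show ?thesis unfolding notin_approx_point_spectrum_iff[OF T] using that
      by (metis diff_gt_0_iff_gt)
  qed
  then show ?thesis using that c(1) by blast
qed

text \<open>A boundary point of the spectrum lies in the approximate point spectrum: if \<open>A\<close> is bounded
  below, the solutions of \<open>(A - \<mu>) x = y\<close> stay bounded as \<open>\<mu> \<rightarrow> 0\<close>, so \<open>R(A)\<close> is dense.\<close>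

lemma surjective_if_limit_of_surjective:
  fixes A :: "'a::complex_banach \<Rightarrow> 'a"
  assumes A: "bounded_clinear A" and c: "c > 0" and below: "\<And>x. c * norm x \<le> norm (A x)"
    and approx: "\<And>\<epsilon>. \<epsilon> > 0 \<Longrightarrow> \<exists>\<mu>. cmod \<mu> < \<epsilon> \<and> range (shift_op A \<mu>) = UNIV"
  shows "range A = UNIV"
proof -
  have cl: "closed (range A)"
    by (rule bounded_below_imp_closed_image[OF bounded_clinear_imp_bounded_linear[OF A] subspace_UNIV closed_UNIV c below])
  have "y \<in> closure (range A)" for y
    unfolding closure_approachable
  proof (intro allI impI)
    fix e :: real assume e: "e > 0"
    \<comment> \<open>The first bound gives \<open>c * norm x \<le> 2 * norm y\<close> for the solution \<open>x\<close>, the second then makes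
      \<open>A x - y = \<mu> x\<close> small.\<close>
    define d where "d = min (c/2) (e * c / (2 * norm y + 1))"
    have pos: "2 * norm y + 1 > 0" using norm_ge_zero[of y] by linarith
    then have "d > 0" using e c by (simp add: d_def)
    then obtain \<mu> where \<mu>: "cmod \<mu> < d" "range (shift_op A \<mu>) = UNIV" using approx by blast
    obtain x where x: "shift_op A \<mu> x = y" using \<mu>(2) by (metis surjD)
    have "c * norm x \<le> norm y + cmod \<mu> * norm x"
      using norm_shift_op_ge[of A x 0 \<mu>] below[of x] x by simp
    moreover have "cmod \<mu> * norm x \<le> c/2 * norm x" using \<mu>(1) by (intro mult_right_mono) (auto simp: d_def)
    ultimately have nx: "c * norm x \<le> 2 * norm y" by simp
    have "dist (A x) y = cmod \<mu> * norm x" using x by (auto simp: dist_norm shift_op_def norm_scaleC)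
    also have "\<dots> \<le> (e * c / (2 * norm y + 1)) * norm x"
      using \<mu>(1) by (intro mult_right_mono) (auto simp: d_def)
    also have "\<dots> = e * (c * norm x / (2 * norm y + 1))" by simp
    also have "\<dots> < e * 1"
      using e nx pos by (intro mult_strict_left_mono) simp_all
    finally show "\<exists>z\<in>range A. dist z y < e" by auto
  qed
  then show ?thesis using cl by auto
qed

text \<open>The hinge of the proof: properties (z) and (gz) are expressed through this condition, and so
  is the single-valued extension property.\<close>

definition weyl_points_isolated :: "('a::complex_normed_vector \<Rightarrow> 'a) \<Rightarrow> bool" where
  "weyl_points_isolated T \<longleftrightarrow> (\<forall>\<kappa>. \<kappa> \<notin> upper_weyl_spectrum T \<longrightarrow>
     (\<exists>\<epsilon>>0. \<forall>\<mu>. \<mu> \<noteq> \<kappa> \<and> dist \<mu> \<kappa> < \<epsilon> \<longrightarrow> \<mu> \<notin> op_spectrum T))"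

lemma upper_weyl_spectrum_closed_complement:
  fixes T :: "'a::complex_banach \<Rightarrow> 'a"
  assumes T: "bounded_clinear T" and \<kappa>: "\<kappa> \<notin> upper_weyl_spectrum T"
  obtains \<epsilon> where "\<epsilon> > 0" "\<And>\<mu>. dist \<mu> \<kappa> < \<epsilon> \<Longrightarrow> \<mu> \<notin> upper_weyl_spectrum T"
proof -
  have "upper_semi_weyl (shift_op T \<kappa>)" using \<kappa> by (simp add: upper_weyl_spectrum_def)
  then obtain \<epsilon> where \<epsilon>: "\<epsilon> > 0" "\<And>\<mu>. cmod \<mu> < \<epsilon> \<Longrightarrow> upper_semi_weyl (shift_op (shift_op T \<kappa>) \<mu>)"
    using upper_semi_weyl_on_shift_op[OF bounded_clinear_shift_op[OF T] csubspace_UNIV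
        closed_UNIV subset_UNIV] by blast
  have "\<mu> \<notin> upper_weyl_spectrum T" if "dist \<mu> \<kappa> < \<epsilon>" for \<mu>
    using \<epsilon>(2)[of "\<mu> - \<kappa>"] that
    by (simp add: upper_weyl_spectrum_def dist_norm shift_op_recenter[of T \<mu> \<kappa>, symmetric])
  then show ?thesis using that \<epsilon>(1) by blast
qed

lemma left_poles_iff: "\<kappa> \<in> left_poles T \<longleftrightarrow> \<kappa> \<in> approx_point_spectrum T \<and> left_pole_at_zero (shift_op T \<kappa>)"
  by (simp add: left_poles_def left_pole_at_zero_def)

lemma isolated_points_iff:
  "\<kappa> \<in> isolated_points S \<longleftrightarrow> \<kappa> \<in> S \<and> (\<exists>\<epsilon>>0. \<forall>\<mu>. \<mu> \<noteq> \<kappa> \<and> dist \<mu> \<kappa> < \<epsilon> \<longrightarrow> \<mu> \<notin> S)"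
  unfolding isolated_points_def isolated_in_dist_Ex_iff by (auto simp: dist_commute)

lemma left_poles_subset_pi_0_a:
  fixes T :: "'a::complex_banach \<Rightarrow> 'a"
  assumes T: "bounded_clinear T"
  shows "left_poles T \<subseteq> pi_0_a T"
proof
  fix \<kappa> assume "\<kappa> \<in> left_poles T"
  then have ap: "\<kappa> \<in> approx_point_spectrum T" and pole: "left_pole_at_zero (shift_op T \<kappa>)"
    by (simp_all add: left_poles_iff)
  have A: "bounded_clinear (shift_op T \<kappa>)" by (rule bounded_clinear_shift_op[OF T])
  obtain \<epsilon> where \<epsilon>: "\<epsilon> > 0" "\<And>\<mu>. \<mu> \<noteq> 0 \<Longrightarrow> cmod \<mu> < \<epsilon> \<Longrightarrow>
      \<exists>c>0. \<forall>x. c * norm x \<le> norm (shift_op (shift_op T \<kappa>) \<mu> x)"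
    using left_pole_shift_bounded_below[OF A pole] by blast
  have "\<mu> \<notin> approx_point_spectrum T" if "\<mu> \<noteq> \<kappa>" "dist \<mu> \<kappa> < \<epsilon>" for \<mu>
    unfolding notin_approx_point_spectrum_iff[OF T] shift_op_recenter[of T \<mu> \<kappa>]
    using that by (intro \<epsilon>(2)) (auto simp: dist_norm)
  then have "\<kappa> \<in> isolated_points (approx_point_spectrum T)"
    unfolding isolated_points_iff using ap \<epsilon>(1) by blast
  moreover have "\<kappa> \<in> point_spectrum T"
  proof (rule ccontr)
    assume "\<kappa> \<notin> point_spectrum T"
    then have inj: "shift_op T \<kappa> x = 0 \<Longrightarrow> x = 0" for x by (auto simp: point_spectrum_def shift_op_def)
    obtain p where p: "ascent (shift_op T \<kappa>) = enat p" "closed (range (shift_op T \<kappa> ^^ (p + 1)))"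
      using pole by (auto simp: left_pole_at_zero_def)
    have "{x. (shift_op T \<kappa> ^^ 0) x = 0} = {x. (shift_op T \<kappa> ^^ (0 + 1)) x = 0}"
      using inj bounded_clinear_zero[OF A] by auto
    then obtain q where "ascent (shift_op T \<kappa>) = enat q" "q \<le> 0" by (rule ascent_le)
    then have "closed (range (shift_op T \<kappa>))" using p by simp
    then obtain c where "c > 0" "\<And>x. x \<in> UNIV \<Longrightarrow> c * norm x \<le> norm (shift_op T \<kappa> x)"
      using bounded_below_if_inj_closed_image[OF bounded_clinear_imp_bounded_linear[OF A] subspace_UNIV
          closed_UNIV _ inj] by blast
    then show False using ap notin_approx_point_spectrum_iff[OF T] by blast
  qed
  ultimately show "\<kappa> \<in> pi_0_a T" by (simp add: pi_0_a_def)
qed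

lemma nullity_shift_op_eq_0_iff:
  assumes "bounded_clinear T"
  shows "nullity (shift_op T \<kappa>) = 0 \<longleftrightarrow> \<kappa> \<notin> point_spectrum T"
proof -
  have "nullity (shift_op T \<kappa>) = 0 \<longleftrightarrow> {x. shift_op T \<kappa> x = 0} = {0}"
    unfolding nullity_on_def using edim_eq_0_iff[OF csubspace_kernel[OF bounded_clinear_shift_op[OF assms]]] by simp
  also have "\<dots> \<longleftrightarrow> \<kappa> \<notin> point_spectrum T"
    using bounded_clinear_zero[OF bounded_clinear_shift_op[OF assms], of \<kappa>]
    by (auto simp: point_spectrum_def shift_op_def)
  finally show ?thesis .
qed

lemma pi_00_a_eq:
  assumes "bounded_clinear T"
  shows "pi_00_a T = {\<kappa> \<in> pi_0_a T. nullity (shift_op T \<kappa>) < \<infinity>}"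
  using nullity_shift_op_eq_0_iff[OF assms]
  by (auto simp: pi_00_a_def pi_0_a_def finite_point_spectrum_def zero_less_iff_neq_zero)

lemma left_poles_subset_complement_upper_b_weyl_spectrum:
  fixes T :: "'a::complex_banach \<Rightarrow> 'a"
  assumes T: "bounded_clinear T"
  shows "left_poles T \<subseteq> op_spectrum T - upper_b_weyl_spectrum T"
  using approx_point_spectrum_subset[OF T] left_pole_imp_upper_semi_b_weyl[OF bounded_clinear_shift_op[OF T]]
  by (auto simp: left_poles_iff upper_b_weyl_spectrum_def)

lemma left_poles_finite_rank_subset_complement_upper_weyl_spectrum:
  fixes T :: "'a::complex_banach \<Rightarrow> 'a"
  assumes T: "bounded_clinear T"
  shows "left_poles_finite_rank T \<subseteq> op_spectrum T - upper_weyl_spectrum T"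
  using approx_point_spectrum_subset[OF T]
    upper_semi_weyl_if_left_pole_finite_rank[OF bounded_clinear_shift_op[OF T]]
  by (auto simp: left_poles_finite_rank_def left_poles_iff upper_weyl_spectrum_def)

lemma upper_semi_weyl_imp_upper_semi_b_weyl: "upper_semi_weyl A \<Longrightarrow> upper_semi_b_weyl A"
  unfolding upper_semi_b_weyl_def by (intro exI[of _ 0]) simp

lemma upper_b_weyl_spectrum_subset: "upper_b_weyl_spectrum T \<subseteq> upper_weyl_spectrum T"
  using upper_semi_weyl_imp_upper_semi_b_weyl by (auto simp: upper_b_weyl_spectrum_def upper_weyl_spectrum_def)

lemma isolated_point_is_left_pole:
  fixes T :: "'a::complex_banach \<Rightarrow> 'a"
  assumes T: "bounded_clinear T" and \<kappa>: "\<kappa> \<in> isolated_points (approx_point_spectrum T)"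
    and weyl: "\<kappa> \<notin> upper_b_weyl_spectrum T"
  shows "\<kappa> \<in> left_poles T"
proof -
  obtain \<epsilon> where ap: "\<kappa> \<in> approx_point_spectrum T" and \<epsilon>: "\<epsilon> > 0"
    "\<And>\<mu>. \<mu> \<noteq> \<kappa> \<Longrightarrow> dist \<mu> \<kappa> < \<epsilon> \<Longrightarrow> \<mu> \<notin> approx_point_spectrum T"
    using \<kappa> unfolding isolated_points_iff by blast
  have "left_pole_at_zero (shift_op T \<kappa>)"
  proof (rule left_pole_if_upper_semi_b_weyl[OF bounded_clinear_shift_op[OF T]])
    show "upper_semi_b_weyl (shift_op T \<kappa>)" using weyl by (simp add: upper_b_weyl_spectrum_def)
    fix \<delta> :: real assume \<delta>: "\<delta> > 0"
    define \<mu> where "\<mu> = complex_of_real (min \<delta> \<epsilon> / 2)"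
    have \<mu>: "cmod \<mu> < \<delta>" "cmod \<mu> < \<epsilon>" "\<mu> \<noteq> 0" using \<delta> \<epsilon>(1) by (auto simp: \<mu>_def norm_of_real simp del: of_real_divide)
    have "\<kappa> + \<mu> \<notin> approx_point_spectrum T" using \<mu> by (intro \<epsilon>(2)) (auto simp: dist_norm)
    then obtain c where "c > 0" "\<And>x. c * norm x \<le> norm (shift_op (shift_op T \<kappa>) \<mu> x)"
      unfolding notin_approx_point_spectrum_iff[OF T] shift_op_shift_op by blast
    then have "\<forall>x. shift_op (shift_op T \<kappa>) \<mu> x = 0 \<longrightarrow> x = 0" using injective_if_bounded_below by metis
    then show "\<exists>\<mu>. cmod \<mu> < \<delta> \<and> (\<forall>x. shift_op (shift_op T \<kappa>) \<mu> x = 0 \<longrightarrow> x = 0)" using \<mu>(1) by blast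
  qed
  then show ?thesis using ap by (simp add: left_poles_iff)
qed

text \<open>Next to a point where \<open>T - \<kappa>\<close> is upper semi b-Weyl there are points where \<open>T - \<mu>\<close> is upper
  semi-Weyl, and next to those there are points of the resolvent set. So \<open>T - \<mu>\<close> is injective
  for \<open>\<mu>\<close> arbitrarily close to \<open>\<kappa>\<close>, which is all that the criterion for a left pole needs.\<close>

lemma weyl_point_is_left_pole:
  fixes T :: "'a::complex_banach \<Rightarrow> 'a"
  assumes T: "bounded_clinear T" and iso: "weyl_points_isolated T"
    and \<kappa>: "\<kappa> \<in> op_spectrum T" and weyl: "\<kappa> \<notin> upper_b_weyl_spectrum T"
  shows "\<kappa> \<in> left_poles T"
proof -
  define A where "A = shift_op T \<kappa>"
  have A: "bounded_clinear A" unfolding A_def by (rule bounded_clinear_shift_op[OF T])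
  have W: "upper_semi_b_weyl A" using weyl by (simp add: upper_b_weyl_spectrum_def A_def)
  then obtain n where cl: "closed (range (A ^^ n))" and Wn: "upper_semi_weyl_on (range (A ^^ n)) A"
    unfolding upper_semi_b_weyl_def by blast
  obtain \<epsilon> where \<epsilon>: "\<epsilon> > 0" "\<And>\<mu>. cmod \<mu> < \<epsilon> \<Longrightarrow> upper_semi_weyl_on (range (A ^^ n)) (shift_op A \<mu>)"
    using upper_semi_weyl_on_shift_op[OF A csubspace_funpow_range[OF A] cl funpow_range_invariant Wn] by blast
  have nearby: "\<exists>\<nu>. \<nu> \<notin> op_spectrum T \<and> dist \<nu> \<kappa> < \<delta>" if w: "\<kappa> + \<mu> \<notin> upper_weyl_spectrum T" and \<mu>: "cmod \<mu> < \<delta>" for \<mu> \<delta>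
  proof -
    obtain \<epsilon>' where \<epsilon>': "\<epsilon>' > 0" "\<And>\<nu>. \<nu> \<noteq> \<kappa> + \<mu> \<Longrightarrow> dist \<nu> (\<kappa> + \<mu>) < \<epsilon>' \<Longrightarrow> \<nu> \<notin> op_spectrum T"
      using iso w unfolding weyl_points_isolated_def by blast
    define r where "r = min \<epsilon>' (\<delta> - cmod \<mu>) / 2"
    define \<nu> where "\<nu> = \<kappa> + \<mu> + complex_of_real r"
    have r: "r > 0" "r < \<epsilon>'" "r < \<delta> - cmod \<mu>" using \<epsilon>'(1) \<mu> by (auto simp: r_def min_def)
    have "\<nu> \<notin> op_spectrum T" using r by (intro \<epsilon>'(2)) (auto simp: \<nu>_def dist_norm)
    moreover have "dist \<nu> \<kappa> \<le> cmod \<mu> + r"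
      using norm_triangle_ineq[of \<mu> "complex_of_real r"] r(1) by (simp add: \<nu>_def dist_norm)
    ultimately show ?thesis using r(3) by force
  qed
  have inj: "\<exists>\<mu>. cmod \<mu> < \<delta> \<and> (\<forall>x. shift_op A \<mu> x = 0 \<longrightarrow> x = 0)" if \<delta>: "\<delta> > 0" for \<delta>
  proof -
    define \<mu> where "\<mu> = complex_of_real (min \<delta> \<epsilon> / 2)"
    have \<mu>: "cmod \<mu> < \<delta>" "cmod \<mu> < \<epsilon>" "\<mu> \<noteq> 0" using \<delta> \<epsilon>(1) by (auto simp: \<mu>_def norm_of_real simp del: of_real_divide)
    have "upper_semi_weyl (shift_op A \<mu>)"
      by (rule upper_semi_weyl_shift_if_restriction[OF A \<mu>(3) \<epsilon>(2)[OF \<mu>(2)]])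
    then have "\<kappa> + \<mu> \<notin> upper_weyl_spectrum T" by (simp add: upper_weyl_spectrum_def A_def shift_op_shift_op)
    then obtain \<nu> where \<nu>: "\<nu> \<notin> op_spectrum T" "dist \<nu> \<kappa> < \<delta>" using nearby \<mu>(1) by blast
    then obtain c where "c > 0" "\<And>x. c * norm x \<le> norm (shift_op A (\<nu> - \<kappa>) x)"
      unfolding notin_op_spectrum_iff[OF T] shift_op_recenter[of T \<nu> \<kappa>] A_def by blast
    then have "\<forall>x. shift_op A (\<nu> - \<kappa>) x = 0 \<longrightarrow> x = 0" using injective_if_bounded_below by metis
    then show ?thesis using \<nu>(2) by (auto simp: dist_norm)
  qed
  have "\<kappa> \<in> approx_point_spectrum T"
  proof (rule ccontr)
    assume nin: "\<kappa> \<notin> approx_point_spectrum T"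
    then obtain c where c: "c > 0" "\<And>x. c * norm x \<le> norm (A x)"
      unfolding notin_approx_point_spectrum_iff[OF T] A_def by blast
    have "\<kappa> \<notin> upper_weyl_spectrum T"
      using upper_semi_weyl_if_notin_approx_point_spectrum[OF T nin] by (simp add: upper_weyl_spectrum_def)
    then have w0: "\<kappa> + 0 \<notin> upper_weyl_spectrum T" by simp
    have "range A = UNIV"
    proof (rule surjective_if_limit_of_surjective[OF A c])
      fix \<delta> :: real assume "\<delta> > 0"
      then obtain \<nu> where \<nu>: "\<nu> \<notin> op_spectrum T" "dist \<nu> \<kappa> < \<delta>" using nearby[OF w0, of \<delta>] by auto
      then show "\<exists>\<mu>. cmod \<mu> < \<delta> \<and> range (shift_op A \<mu>) = UNIV"
        unfolding notin_op_spectrum_iff[OF T] shift_op_recenter[of T \<nu> \<kappa>] A_def by (auto simp: dist_norm)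
    qed
    then show False using \<kappa> c notin_op_spectrum_iff[OF T] unfolding A_def by blast
  qed
  then show ?thesis
    using left_pole_if_upper_semi_b_weyl[OF A W inj] by (simp add: left_poles_iff A_def)
qed

text \<open>Nearby points are again outside the upper semi-Weyl spectrum and, being outside
  \<open>\<sigma>\<^sub>a(T)\<close>, cannot be isolated points of it; the hypothesis leaves them only the resolvent
  set.\<close>

lemma weyl_points_isolated_if_in_isolated_points:
  fixes T :: "'a::complex_banach \<Rightarrow> 'a"
  assumes T: "bounded_clinear T"
    and sub: "op_spectrum T - upper_weyl_spectrum T \<subseteq> isolated_points (approx_point_spectrum T)"
  shows "weyl_points_isolated T"
  unfolding weyl_points_isolated_def
proof (intro allI impI)
  fix \<kappa> assume \<kappa>: "\<kappa> \<notin> upper_weyl_spectrum T"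
  obtain \<epsilon> where \<epsilon>: "\<epsilon> > 0" "\<And>\<mu>. dist \<mu> \<kappa> < \<epsilon> \<Longrightarrow> \<mu> \<notin> upper_weyl_spectrum T"
    using upper_weyl_spectrum_closed_complement[OF T \<kappa>] by blast
  have "\<exists>\<delta>>0. \<forall>\<mu>. \<mu> \<noteq> \<kappa> \<and> dist \<mu> \<kappa> < \<delta> \<longrightarrow> \<mu> \<notin> approx_point_spectrum T"
  proof (cases "\<kappa> \<in> op_spectrum T")
    case True
    then have "\<kappa> \<in> isolated_points (approx_point_spectrum T)" using \<kappa> sub by blast
    then show ?thesis unfolding isolated_points_iff by blast
  next
    case False
    then have "\<kappa> \<notin> approx_point_spectrum T" using approx_point_spectrum_subset[OF T] by blast
    then show ?thesis using approx_point_spectrum_closed_complement[OF T] by metis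
  qed
  then obtain \<delta> where \<delta>: "\<delta> > 0" "\<And>\<mu>. \<mu> \<noteq> \<kappa> \<Longrightarrow> dist \<mu> \<kappa> < \<delta> \<Longrightarrow> \<mu> \<notin> approx_point_spectrum T" by blast
  have "\<mu> \<notin> op_spectrum T" if "\<mu> \<noteq> \<kappa>" "dist \<mu> \<kappa> < min \<delta> \<epsilon>" for \<mu>
  proof
    assume "\<mu> \<in> op_spectrum T"
    then have "\<mu> \<in> isolated_points (approx_point_spectrum T)" using sub \<epsilon>(2) that(2) by auto
    then show False using \<delta>(2) that by (auto simp: isolated_points_iff)
  qed
  then show "\<exists>\<epsilon>>0. \<forall>\<mu>. \<mu> \<noteq> \<kappa> \<and> dist \<mu> \<kappa> < \<epsilon> \<longrightarrow> \<mu> \<notin> op_spectrum T"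
    using \<delta>(1) \<epsilon>(1) by (intro exI[of _ "min \<delta> \<epsilon>"]) simp
qed

text \<open>The left poles belong to both sets that property (gz) compares, for every operator. The
  converse inclusions hold as soon as the points in question are isolated in \<open>\<sigma>\<^sub>a(T)\<close>, which (gz)
  grants, or the Weyl points are isolated.\<close>

theorem property_gz_iff:
  fixes T :: "'a::complex_banach \<Rightarrow> 'a"
  assumes T: "bounded_clinear T"
  shows "property_gz T \<longleftrightarrow> weyl_points_isolated T \<and> pi_0_a T = left_poles T"
proof
  assume gz: "property_gz T"
  then have eq: "op_spectrum T - upper_b_weyl_spectrum T = pi_0_a T" by (simp add: property_gz_def)
  have "weyl_points_isolated T"
    by (rule weyl_points_isolated_if_in_isolated_points[OF T])
      (use eq upper_b_weyl_spectrum_subset[of T] in \<open>auto simp: pi_0_a_def\<close>)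
  moreover have "pi_0_a T \<subseteq> left_poles T"
    using eq isolated_point_is_left_pole[OF T] by (auto simp: pi_0_a_def)
  ultimately show "weyl_points_isolated T \<and> pi_0_a T = left_poles T"
    using left_poles_subset_pi_0_a[OF T] by blast
next
  assume *: "weyl_points_isolated T \<and> pi_0_a T = left_poles T"
  then have "op_spectrum T - upper_b_weyl_spectrum T \<subseteq> left_poles T"
    using weyl_point_is_left_pole[OF T] by blast
  then show "property_gz T"
    using * left_poles_subset_complement_upper_b_weyl_spectrum[OF T] unfolding property_gz_def by blast
qed

theorem property_z_iff:
  fixes T :: "'a::complex_banach \<Rightarrow> 'a"
  assumes T: "bounded_clinear T"
  shows "property_z T \<longleftrightarrow> weyl_points_isolated T \<and> pi_00_a T = left_poles_finite_rank T"
proof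
  have fin: "nullity (shift_op T \<kappa>) < \<infinity>" if "\<kappa> \<notin> upper_weyl_spectrum T" for \<kappa>
    using that by (simp add: upper_weyl_spectrum_def upper_semi_weyl_on_iff)
  {
    assume z: "property_z T"
    then have eq: "op_spectrum T - upper_weyl_spectrum T = pi_00_a T" by (simp add: property_z_def)
    have "weyl_points_isolated T"
      by (rule weyl_points_isolated_if_in_isolated_points[OF T]) (use eq in \<open>auto simp: pi_00_a_def\<close>)
    moreover have "pi_00_a T \<subseteq> left_poles_finite_rank T"
    proof
      fix \<kappa> assume \<kappa>: "\<kappa> \<in> pi_00_a T"
      then have "\<kappa> \<notin> upper_weyl_spectrum T" using eq by blast
      then show "\<kappa> \<in> left_poles_finite_rank T"
        using \<kappa> isolated_point_is_left_pole[OF T] upper_b_weyl_spectrum_subset[of T] fin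
        by (auto simp: left_poles_finite_rank_def pi_00_a_def)
    qed
    moreover have "left_poles_finite_rank T \<subseteq> pi_00_a T"
      using left_poles_subset_pi_0_a[OF T] by (auto simp: left_poles_finite_rank_def pi_00_a_eq[OF T])
    ultimately show "weyl_points_isolated T \<and> pi_00_a T = left_poles_finite_rank T" by blast
  next
    assume *: "weyl_points_isolated T \<and> pi_00_a T = left_poles_finite_rank T"
    then have "op_spectrum T - upper_weyl_spectrum T \<subseteq> left_poles_finite_rank T"
      using weyl_point_is_left_pole[OF T] upper_b_weyl_spectrum_subset[of T] fin
      by (auto simp: left_poles_finite_rank_def)
    then show "property_z T"
      using * left_poles_finite_rank_subset_complement_upper_weyl_spectrum[OF T]
      unfolding property_z_def by blast
  }
qed

lemma pi_0_a_eq_left_poles_if_a_polaroid: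
  fixes T :: "'a::complex_banach \<Rightarrow> 'a"
  assumes "bounded_clinear T" "a_polaroid T"
  shows "pi_0_a T = left_poles T"
  using left_poles_subset_pi_0_a[OF assms(1)] assms(2) by (auto simp: a_polaroid_def pi_0_a_def)

lemma pi_00_a_eq_left_poles_if_finitely_a_polaroid:
  fixes T :: "'a::complex_banach \<Rightarrow> 'a"
  assumes "bounded_clinear T" "finitely_a_polaroid T"
  shows "pi_00_a T = left_poles_finite_rank T"
proof
  show "pi_00_a T \<subseteq> left_poles_finite_rank T"
    using assms(2) by (auto simp: finitely_a_polaroid_def pi_00_a_def)
  show "left_poles_finite_rank T \<subseteq> pi_00_a T"
    using left_poles_subset_pi_0_a[OF assms(1)]
    by (auto simp: left_poles_finite_rank_def pi_00_a_eq[OF assms(1)])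
qed

section \<open>The dual operator\<close>

lemma bounded_clinear_dual_op:
  assumes T: "bounded_clinear T"
  shows "bounded_clinear (dual_op T)"
proof -
  note ap = cdual_apply_dual_op[OF T]
  have scale: "dual_op T (c *\<^sub>C \<phi>) = c *\<^sub>C dual_op T \<phi>" for c \<phi>
    by (rule cdual_eqI) (simp add: ap cdual_apply_scale)
  obtain K where K: "K > 0" "\<And>x. norm (T x) \<le> norm x * K"
    using bounded_linear.pos_bounded[OF bounded_clinear_imp_bounded_linear[OF T]] by blast
  have "bounded_linear (dual_op T)"
  proof (rule bounded_linear_intro)
    show "dual_op T (\<phi> + \<psi>) = dual_op T \<phi> + dual_op T \<psi>" for \<phi> \<psi>
      by (rule cdual_eqI) (simp add: ap cdual_apply_plus)
    show "dual_op T (r *\<^sub>R \<phi>) = r *\<^sub>R dual_op T \<phi>" for r \<phi>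
      using scale[of "of_real r" \<phi>] by (simp add: scaleC_of_real)
    show "norm (dual_op T \<phi>) \<le> norm \<phi> * K" for \<phi>
    proof (rule norm_cdual_bound)
      show "0 \<le> norm \<phi> * K" using K(1) by simp
      show "cmod (cdual_apply (dual_op T \<phi>) x) \<le> norm \<phi> * K * norm x" for x
        using order_trans[OF norm_cdual_apply[of \<phi> "T x"] mult_left_mono[OF K(2)[of x] norm_ge_zero[of \<phi>]]]
        by (simp add: ap mult_ac)
    qed
  qed
  then show ?thesis using scale by (simp add: bounded_clinear_def)
qed

lemma dual_op_shift_op:
  assumes T: "bounded_clinear T"
  shows "dual_op (shift_op T \<mu>) = shift_op (dual_op T) \<mu>"
proof
  fix \<phi>
  show "dual_op (shift_op T \<mu>) \<phi> = shift_op (dual_op T) \<mu> \<phi>"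
  proof (rule cdual_eqI)
    fix x
    show "cdual_apply (dual_op (shift_op T \<mu>) \<phi>) x = cdual_apply (shift_op (dual_op T) \<mu> \<phi>) x"
      unfolding cdual_apply_dual_op[OF bounded_clinear_shift_op[OF T]]
      by (simp add: shift_op_def cdual_apply_dual_op[OF T] cdual_apply_diff cdual_apply_scaleC
          cdual_apply_minus cdual_apply_scale)
  qed
qed

lemma cdual_apply_dual_op_funpow:
  assumes "bounded_clinear A"
  shows "cdual_apply ((dual_op A ^^ n) \<phi>) x = cdual_apply \<phi> ((A ^^ n) x)"
  by (induction n arbitrary: x) (simp_all add: cdual_apply_dual_op[OF assms] funpow_swap1[of A])

definition annihilator :: "'a::complex_normed_vector set \<Rightarrow> 'a cdual set" where
  "annihilator S = {\<phi>. \<forall>x\<in>S. cdual_apply \<phi> x = 0}"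

lemma csubspace_annihilator: "csubspace (annihilator S)"
  by (rule csubspaceI)
    (auto simp: annihilator_def cdual_apply_zero cdual_apply_plus cdual_apply_scale)

lemma bounded_linear_evaluation: "bounded_linear (\<lambda>\<phi>. cdual_apply \<phi> x)"
proof (rule bounded_linear_intro)
  show "cdual_apply (r *\<^sub>R \<phi>) x = r *\<^sub>R cdual_apply \<phi> x" for r \<phi>
    using cdual_apply_scale[of "of_real r" \<phi> x] by (simp add: scaleC_of_real scaleR_conv_of_real)
  show "norm (cdual_apply \<phi> x) \<le> norm \<phi> * norm x" for \<phi> by (rule norm_cdual_apply)
qed (rule cdual_apply_plus)

lemma closed_annihilator: "closed (annihilator S)"
proof -
  have "annihilator S = (\<Inter>x\<in>S. (\<lambda>\<phi>. cdual_apply \<phi> x) -` {0})" by (auto simp: annihilator_def)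
  then show ?thesis
    by (simp add: closed_INT continuous_closed_vimage linear_continuous_at bounded_linear_evaluation)
qed

lemma kernel_dual_op: "bounded_clinear A \<Longrightarrow> {\<phi>. dual_op A \<phi> = 0} = annihilator (range A)"
  by (auto simp: annihilator_def cdual_apply_dual_op[symmetric] cdual_apply_zero intro: cdual_eqI)

text \<open>A functional \<open>\<phi>\<close> that vanishes on \<open>N(A)\<close> induces the functional \<open>A x \<mapsto> \<phi> x\<close> on
  \<open>R(A)\<close>. It is bounded by the open mapping theorem, and any extension of it is mapped to \<open>\<phi>\<close>.\<close>

lemma range_dual_op:
  fixes A :: "'a::complex_banach \<Rightarrow> 'a"
  assumes A: "bounded_clinear A" and cl: "closed (range A)"
  shows "range (dual_op A) = annihilator {x. A x = 0}"
proof
  show "range (dual_op A) \<subseteq> annihilator {x. A x = 0}"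
    by (auto simp: annihilator_def cdual_apply_dual_op[OF A] cdual_apply_zero_right)
  show "annihilator {x. A x = 0} \<subseteq> range (dual_op A)"
  proof
    fix \<phi> assume "\<phi> \<in> annihilator {x. A x = 0}"
    then have ann: "cdual_apply \<phi> x = 0" if "A x = 0" for x using that by (simp add: annihilator_def)
    obtain K where K: "K > 0" "\<And>y. y \<in> range A \<Longrightarrow> \<exists>x\<in>UNIV. A x = y \<and> norm x \<le> K * norm y"
      using open_mapping_on[OF bounded_clinear_imp_bounded_linear[OF A] subspace_UNIV closed_UNIV cl] by blast
    define g where "g y = cdual_apply \<phi> (SOME x. A x = y)" for y
    have g: "g (A x) = cdual_apply \<phi> x" for x
    proof -
      have "A (SOME z. A z = A x) = A x" by (rule someI) (rule refl)
      then have "A ((SOME z. A z = A x) - x) = 0" by (simp add: bounded_clinear_diff[OF A])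
      then show ?thesis using ann by (fastforce simp: g_def cdual_apply_diff)
    qed
    obtain F where F: "\<And>x y. F (x + y) = F x + F y" "\<And>c x. F (c *\<^sub>C x) = c * F x"
      "\<And>y. cmod (F y) \<le> norm \<phi> * K * norm y" "\<And>y. y \<in> range A \<Longrightarrow> F y = g y"
    proof (rule hahn_banach_complex[of "\<lambda>y. norm \<phi> * K * norm y" "range A" g])
      show "norm \<phi> * K * norm (x + y) \<le> norm \<phi> * K * norm x + norm \<phi> * K * norm y" for x y :: 'a
        using K(1) norm_triangle_ineq[of x y] by (simp add: distrib_left[symmetric] mult_left_mono)
      show "norm \<phi> * K * norm (c *\<^sub>C x) = cmod c * (norm \<phi> * K * norm x)" for c and x :: 'a
        by (simp add: norm_scaleC)
      show "csubspace (range A)" by (rule csubspace_image[OF A csubspace_UNIV])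
      show "g (x + y) = g x + g y" if xy: "x \<in> range A" "y \<in> range A" for x y
      proof -
        obtain u v where "x = A u" "y = A v" using xy by blast
        then show ?thesis using g[of "u + v"] by (simp add: bounded_clinear_add[OF A] g cdual_apply_add)
      qed
      show "g (c *\<^sub>C x) = c * g x" if x: "x \<in> range A" for c x
      proof -
        obtain u where "x = A u" using x by blast
        then show ?thesis using g[of "c *\<^sub>C u"] by (simp add: bounded_clinear_scaleC[OF A] g cdual_apply_scaleC)
      qed
      show "cmod (g y) \<le> norm \<phi> * K * norm y" if y: "y \<in> range A" for y
      proof -
        obtain x where x: "A x = y" "norm x \<le> K * norm y" using K(2)[OF y] by blast
        have "cmod (g y) \<le> norm \<phi> * norm x" using g[of x] norm_cdual_apply[of \<phi> x] x(1) by simp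
        also have "\<dots> \<le> norm \<phi> * (K * norm y)" using x(2) by (simp add: mult_left_mono)
        finally show ?thesis by (simp add: mult_ac)
      qed
    qed (rule that)
    have "0 \<le> norm \<phi> * K" using K(1) by simp
    then obtain \<psi> where \<psi>: "\<And>y. cdual_apply \<psi> y = F y" using functional_cdual[OF F(1-3)] by blast
    have "dual_op A \<psi> = \<phi>"
      by (rule cdual_eqI) (simp add: cdual_apply_dual_op[OF A] \<psi> F(4) g)
    then show "\<phi> \<in> range (dual_op A)" by blast
  qed
qed

text \<open>For each \<open>\<delta>\<close> the seminorm \<open>p y = inf\<^sub>x (\<parallel>y - A x\<parallel> / \<delta> + \<parallel>x\<parallel>)\<close> is at most
  \<open>\<parallel>y\<parallel> / \<delta>\<close>, and \<open>p (A x) \<le> \<parallel>x\<parallel>\<close>. A functional \<open>f\<close> dominated by \<open>p\<close> with \<open>f y = p y\<close>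
  therefore has \<open>\<parallel>A\<^sup>* f\<parallel> \<le> 1\<close>; as \<open>R(A\<^sup>*)\<close> is closed, \<open>f\<close> agrees on the closure of \<open>R(A)\<close> with
  a functional of norm at most \<open>K\<close>. So \<open>p y \<le> K \<parallel>y\<parallel>\<close> whatever \<open>\<delta>\<close> is, which means that
  \<open>y\<close> is approximated by images \<open>A x\<close> with \<open>\<parallel>x\<parallel>\<close> under control.\<close>

lemma closed_range_if_closed_range_dual_op:
  fixes A :: "'a::complex_banach \<Rightarrow> 'a"
  assumes A: "bounded_clinear A" and cl: "closed (range (dual_op A))"
  shows "closed (range A)"
proof -
  have D: "bounded_clinear (dual_op A)" by (rule bounded_clinear_dual_op[OF A])
  obtain K where K: "K > 0"
    "\<And>\<phi>. \<phi> \<in> range (dual_op A) \<Longrightarrow> \<exists>\<psi>\<in>UNIV. dual_op A \<psi> = \<phi> \<and> norm \<psi> \<le> K * norm \<phi>"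
    using open_mapping_on[OF bounded_clinear_imp_bounded_linear[OF D] subspace_UNIV closed_UNIV cl] by blast
  define Y where "Y = closure (range A)"
  have stable: "y - A x \<in> Y" if y: "y \<in> Y" for y x
    unfolding Y_def closure_approachable
  proof (intro allI impI)
    fix e :: real assume "e > 0"
    then obtain u where "dist (A u) y < e" using y unfolding Y_def closure_approachable by blast
    then have "dist (A (u - x)) (y - A x) < e" by (simp add: bounded_clinear_diff[OF A] dist_norm)
    then show "\<exists>z\<in>range A. dist z (y - A x) < e" by blast
  qed
  have approx: "\<exists>x. norm x \<le> (K + 1) * norm y \<and> norm (y - A x) < e"
    if y: "y \<in> Y" and e: "e > 0" for y e
  proof (cases "y = 0")
    case True
    then show ?thesis using e by (intro exI[of _ 0]) (simp add: bounded_clinear_zero[OF A])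
  next
    case False
    \<comment> \<open>Chosen so that \<open>norm (y - A x) / \<delta> < (K + 1) * norm y\<close> means \<open>norm (y - A x) < e\<close>.\<close>
    define \<delta> where "\<delta> = e / ((K + 1) * norm y)"
    have \<delta>: "\<delta> > 0" using e K(1) False by (simp add: \<delta>_def)
    define p where "p = infimal_norm (1/\<delta>) 1 UNIV A"
    have \<delta>': "0 \<le> 1/\<delta>" "(0::real) \<le> 1" using \<delta> by simp_all
    note p = infimal_norm[OF A csubspace_UNIV \<delta>', folded p_def, simplified]
    have pnonneg: "0 \<le> p z" for z by (rule p(2)) (use \<delta> in simp)
    obtain f where f: "\<And>x y. f (x + y) = f x + f y" "\<And>c x. f (c *\<^sub>C x) = c * f x"
      "\<And>z. cmod (f z) \<le> p z" and fy: "f y = of_real (p y)"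
      using norming_functional[of p y, OF p(3,4) pnonneg] by blast
    have "cmod (f z) \<le> (1/\<delta>) * norm z" for z
      using order_trans[OF f(3)[of z] p(1)[of z 0]] by (simp add: bounded_clinear_zero[OF A])
    then obtain \<phi> where \<phi>: "\<And>z. cdual_apply \<phi> z = f z"
      using functional_cdual[OF f(1,2), of "1/\<delta>"] \<delta> by (metis less_eq_real_def zero_less_divide_1_iff)
    have n1: "norm (dual_op A \<phi>) \<le> 1"
    proof (rule norm_cdual_bound)
      show "cmod (cdual_apply (dual_op A \<phi>) x) \<le> 1 * norm x" for x
        using order_trans[OF f(3)[of "A x"] p(1)[of "A x" x]] by (simp add: cdual_apply_dual_op[OF A] \<phi>)
    qed simp
    obtain \<psi> where \<psi>: "dual_op A \<psi> = dual_op A \<phi>" "norm \<psi> \<le> K * norm (dual_op A \<phi>)"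
      using K(2)[of "dual_op A \<phi>"] by blast
    have "cdual_apply (\<phi> - \<psi>) z = 0" if "z \<in> range A" for z
      using that \<psi>(1) by (auto simp: cdual_apply_minus cdual_apply_dual_op[OF A, symmetric])
    then have "range A \<subseteq> {z. cdual_apply (\<phi> - \<psi>) z = 0}" by blast
    moreover have "closed {z. cdual_apply (\<phi> - \<psi>) z = 0}"
      using continuous_closed_vimage[of "{0}" "cdual_apply (\<phi> - \<psi>)"]
      by (simp add: vimage_def linear_continuous_at bounded_linear_cdual_apply)
    ultimately have "Y \<subseteq> {z. cdual_apply (\<phi> - \<psi>) z = 0}" unfolding Y_def by (rule closure_minimal)
    then have "cdual_apply \<phi> y = cdual_apply \<psi> y" using y by (auto simp: cdual_apply_minus)
    then have "of_real (p y) = cdual_apply \<psi> y" using fy \<phi> by simp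
    then have "p y \<le> norm \<psi> * norm y" using norm_cdual_apply[of \<psi> y] pnonneg[of y]
      by (metis abs_of_nonneg norm_of_real)
    also have "\<dots> \<le> K * norm y"
      using \<psi>(2) n1 K(1) by (intro mult_right_mono) (auto intro: order_trans mult_left_le)
    also have "\<dots> < (K + 1) * norm y" using False by simp
    finally have "\<not> (\<forall>x. (K + 1) * norm y \<le> norm (y - A x) / \<delta> + norm x)"
      using p(2)[of "(K + 1) * norm y" y] by force
    then obtain x where x: "norm (y - A x) / \<delta> + norm x < (K + 1) * norm y" by (auto simp: not_le)
    have "norm x \<le> (K + 1) * norm y" using x \<delta>
      by (smt (verit) divide_nonneg_pos norm_ge_zero)
    moreover have "norm (y - A x) / \<delta> < (K + 1) * norm y" using x
      by (smt (verit) norm_ge_zero)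
    then have "norm (y - A x) < (K + 1) * norm y * \<delta>" using \<delta> by (simp only: pos_divide_less_eq)
    then have "norm (y - A x) < e" using K(1) False by (simp add: \<delta>_def)
    ultimately show ?thesis by blast
  qed
  have "y \<in> range A" if y: "y \<in> Y" for y
  proof -
    have "\<exists>x\<in>UNIV. A x = y \<and> norm x \<le> 2 * (K + 1) * norm y"
    proof (rule exact_lift_of_approximate_lift[OF bounded_clinear_imp_bounded_linear[OF A] subspace_UNIV closed_UNIV _ _ _ y])
      show "K + 1 \<ge> 0" using K(1) by simp
      show "z - A x \<in> Y" if "z \<in> Y" for z x by (rule stable[OF that])
      show "\<exists>x\<in>UNIV. norm x \<le> (K + 1) * norm z \<and> norm (z - A x) < e" if "z \<in> Y" "e > 0" for z e
        using approx[OF that] by blast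
    qed
    then show ?thesis by blast
  qed
  then have "closure (range A) \<subseteq> range A" by (auto simp: Y_def)
  then show ?thesis using closure_subset_eq by blast
qed

subsection \<open>Dimensions of annihilators\<close>

lemma enat_eqI: "(\<And>n. enat n \<le> a \<longleftrightarrow> enat n \<le> b) \<Longrightarrow> a = b"
proof (rule antisym)
  assume *: "\<And>n. enat n \<le> a \<longleftrightarrow> enat n \<le> b"
  show "a \<le> b" using * by (cases a) (auto, metis enat_ile enat_ord_simps(1) Suc_n_not_le_n not_infinity_eq)
  show "b \<le> a" using * by (cases b) (auto, metis enat_ile enat_ord_simps(1) Suc_n_not_le_n not_infinity_eq)
qed

text \<open>Stated for an abstract family \<open>F\<close> of functionals so that it serves both for vectors tested
  by functionals and for functionals tested by vectors.\<close>

lemma independent_if_biorthogonal: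
  fixes u :: "'i \<Rightarrow> 'v::complex_normed_vector" and F :: "'i \<Rightarrow> 'v \<Rightarrow> complex"
  assumes I: "finite I"
    and add: "\<And>i x y. F i (x + y) = F i x + F i y" and scale: "\<And>i c x. F i (c *\<^sub>C x) = c * F i x"
    and diag: "\<And>i. i \<in> I \<Longrightarrow> F i (u i) = 1"
    and off: "\<And>i j. i \<in> I \<Longrightarrow> j \<in> I \<Longrightarrow> i \<noteq> j \<Longrightarrow> F i (u j) = 0"
    and R: "\<And>i x. i \<in> I \<Longrightarrow> x \<in> R \<Longrightarrow> F i x = 0"
  shows "cindependent (u ` I)" "card (u ` I) = card I" "cspan (u ` I) \<inter> R \<subseteq> {0}"
proof -
  have zero: "F i 0 = 0" for i using scale[of i 0 0] by simp
  have ker: "csubspace {x. F i x = 0}" for i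
    by (rule csubspaceI) (auto simp: add scale zero)
  have inj: "inj_on u I"
  proof (rule inj_onI)
    fix i j assume "i \<in> I" "j \<in> I" "u i = u j"
    then show "i = j" using diag[of i] off[of i j] by (metis zero_neq_one)
  qed
  then show "card (u ` I) = card I" by (rule card_image)
  show "cindependent (u ` I)"
    unfolding cdependent_def
  proof (rule notI, elim bexE)
    fix a assume "a \<in> u ` I" and a: "a \<in> cspan (u ` I - {a})"
    then obtain i where i: "i \<in> I" "a = u i" by blast
    have "u ` I - {a} \<subseteq> {x. F i x = 0}"
    proof
      fix x assume "x \<in> u ` I - {a}"
      then obtain j where "j \<in> I" "x = u j" "i \<noteq> j" using i(2) by blast
      then show "x \<in> {x. F i x = 0}" using off[OF i(1)] by simp
    qed
    then have "cspan (u ` I - {a}) \<subseteq> {x. F i x = 0}" by (rule cspan_minimal[OF _ ker])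
    then show False using a i diag[OF i(1)] by auto
  qed
  define G where "G x = (\<Sum>i\<in>I. F i x *\<^sub>C u i)" for x
  have "G (x + y) = G x + G y" "G (c *\<^sub>C x) = c *\<^sub>C G x" "G 0 = 0" for x y c
    by (simp_all add: G_def add scale zero scaleC_add_left sum.distrib complex_vector.scale_sum_right scaleC_scaleC)
  then have "csubspace {x. G x = x}" by (intro csubspaceI) simp_all
  define E where "E = {x. G x = x}"
  have "csubspace E" unfolding E_def by fact
  moreover have "u ` I \<subseteq> E"
  proof
    fix x assume "x \<in> u ` I"
    then obtain j where j: "j \<in> I" "x = u j" by blast
    have "(\<Sum>i\<in>I. F i x *\<^sub>C u i) = (\<Sum>i\<in>I. if i = j then u j else 0)"
    proof (rule sum.cong[OF refl])
      fix i assume "i \<in> I"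
      then show "F i x *\<^sub>C u i = (if i = j then u j else 0)"
        using j diag[of j] off[of i j] by (cases "i = j") (simp_all add: scaleC_one)
    qed
    then show "x \<in> E" using I j by (simp add: E_def G_def)
  qed
  ultimately have "cspan (u ` I) \<subseteq> E" using cspan_minimal by blast
  moreover have "x = 0" if "x \<in> E" "x \<in> R" for x
  proof -
    have "x = (\<Sum>i\<in>I. F i x *\<^sub>C u i)" using that(1) by (simp add: E_def G_def)
    also have "\<dots> = 0" using R that(2) by (intro sum.neutral) simp
    finally show ?thesis .
  qed
  ultimately show "cspan (u ` I) \<inter> R \<subseteq> {0}" by blast
qed

text \<open>A functional that vanishes on the common kernel in \<open>N\<close> of finitely many others is a
  combination of them modulo \<open>N\<^sup>\<bottom>\<close>; the kernels are intersected with \<open>N\<close> one at a time.\<close>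

lemma in_cspan_annihilator_Un:
  fixes \<Psi> :: "'a::complex_normed_vector cdual set"
  assumes "finite \<Psi>" "csubspace N" "\<And>x. x \<in> N \<Longrightarrow> (\<And>\<psi>. \<psi> \<in> \<Psi> \<Longrightarrow> cdual_apply \<psi> x = 0) \<Longrightarrow> cdual_apply \<phi> x = 0"
  shows "\<phi> \<in> cspan (annihilator N \<union> \<Psi>)"
  using assms
proof (induction \<Psi> arbitrary: N rule: finite_induct)
  case empty
  then show ?case by (auto simp: annihilator_def intro: cspan_base)
next
  case (insert \<psi> \<Psi>)
  define N' where "N' = {x\<in>N. cdual_apply \<psi> x = 0}"
  have "csubspace N'"
    unfolding N'_def using insert.prems(1)
    by (auto simp: complex_vector.subspace_def cdual_apply_add cdual_apply_scaleC cdual_apply_zero_right)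
  then have "\<phi> \<in> cspan (annihilator N' \<union> \<Psi>)" using insert.prems(2) by (intro insert.IH) (auto simp: N'_def)
  also have "\<dots> \<subseteq> cspan (annihilator N \<union> insert \<psi> \<Psi>)"
  proof (rule cspan_minimal[OF _ csubspace_span], rule Un_least)
    show "\<Psi> \<subseteq> cspan (annihilator N \<union> insert \<psi> \<Psi>)" by (auto intro: cspan_base)
    show "annihilator N' \<subseteq> cspan (annihilator N \<union> insert \<psi> \<Psi>)"
    proof
      fix \<omega> assume \<omega>: "\<omega> \<in> annihilator N'"
      have "\<exists>c. \<omega> - c *\<^sub>C \<psi> \<in> annihilator N"
      proof (cases "\<exists>z\<in>N. cdual_apply \<psi> z \<noteq> 0")
        case True
        then obtain z where z: "z \<in> N" "cdual_apply \<psi> z \<noteq> 0" by blast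
        define c where "c = cdual_apply \<omega> z / cdual_apply \<psi> z"
        have "cdual_apply \<omega> x = c * cdual_apply \<psi> x" if "x \<in> N" for x
        proof -
          define k where "k = cdual_apply \<psi> x / cdual_apply \<psi> z"
          have "x - k *\<^sub>C z \<in> N'"
            using that z insert.prems(1)
            by (simp add: N'_def k_def cdual_apply_diff cdual_apply_scaleC csubspace_diff
                csubspace_scale)
          then have "cdual_apply \<omega> (x - k *\<^sub>C z) = 0" using \<omega> by (simp add: annihilator_def)
          then show ?thesis by (simp add: cdual_apply_diff cdual_apply_scaleC k_def c_def)
        qed
        then show ?thesis by (auto simp: annihilator_def cdual_apply_minus cdual_apply_scale)
      next
        case False
        then show ?thesis using \<omega> by (intro exI[of _ 0]) (auto simp: annihilator_def N'_def)
      qed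
      then obtain c where "\<omega> - c *\<^sub>C \<psi> \<in> cspan (annihilator N \<union> insert \<psi> \<Psi>)"
        by (auto intro: cspan_base)
      moreover have "c *\<^sub>C \<psi> \<in> cspan (annihilator N \<union> insert \<psi> \<Psi>)"
        by (intro cspan_scale cspan_base) simp
      ultimately show "\<omega> \<in> cspan (annihilator N \<union> insert \<psi> \<Psi>)"
        by (metis cspan_add diff_add_cancel)
    qed
  qed
  finally show ?case .
qed

lemma biorthogonal_vectors:
  fixes \<Phi> :: "'a::complex_normed_vector cdual set"
  assumes N: "csubspace N" and \<Phi>: "finite \<Phi>" "cindependent \<Phi>" "cspan \<Phi> \<inter> annihilator N \<subseteq> {0}"
  obtains x where "\<And>\<phi>. \<phi> \<in> \<Phi> \<Longrightarrow> x \<phi> \<in> N" "\<And>\<phi>. \<phi> \<in> \<Phi> \<Longrightarrow> cdual_apply \<phi> (x \<phi>) = 1"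
    "\<And>\<phi> \<psi>. \<phi> \<in> \<Phi> \<Longrightarrow> \<psi> \<in> \<Phi> \<Longrightarrow> \<phi> \<noteq> \<psi> \<Longrightarrow> cdual_apply \<phi> (x \<psi>) = 0"
proof -
  have "\<exists>x\<in>N. cdual_apply \<phi> x = 1 \<and> (\<forall>\<psi>\<in>\<Phi> - {\<phi>}. cdual_apply \<psi> x = 0)" if \<phi>: "\<phi> \<in> \<Phi>" for \<phi>
  proof -
    obtain x where x: "x \<in> N" "\<And>\<psi>. \<psi> \<in> \<Phi> - {\<phi>} \<Longrightarrow> cdual_apply \<psi> x = 0" "cdual_apply \<phi> x \<noteq> 0"
      using in_cspan_annihilator_Un[OF _ N, of "\<Phi> - {\<phi>}" \<phi>] \<Phi>(1)
        notin_cspan_Un_Diff[OF csubspace_annihilator \<Phi>(2,3) \<phi>] by blast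
    then show ?thesis
      using N by (intro bexI[of _ "(1 / cdual_apply \<phi> x) *\<^sub>C x"])
        (simp_all add: cdual_apply_scaleC csubspace_scale)
  qed
  then obtain x where x: "\<And>\<phi>. \<phi> \<in> \<Phi> \<Longrightarrow> x \<phi> \<in> N" "\<And>\<phi>. \<phi> \<in> \<Phi> \<Longrightarrow> cdual_apply \<phi> (x \<phi>) = 1"
      "\<And>\<phi> \<psi>. \<phi> \<in> \<Phi> \<Longrightarrow> \<psi> \<in> \<Phi> - {\<phi>} \<Longrightarrow> cdual_apply \<psi> (x \<phi>) = 0" by metis
  show ?thesis by (rule that[of x]) (use x in simp_all)
qed

text \<open>In both dimension formulas the two sides count the members of biorthogonal systems:
  independent functionals admit biorthogonal vectors, and independent vectors admit biorthogonal
  functionals.\<close>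

lemma edim_annihilator:
  assumes R: "csubspace R" "closed R"
  shows "edim (annihilator R) = ecodim_in UNIV R"
proof (rule enat_eqI)
  fix n
  show "enat n \<le> edim (annihilator R) \<longleftrightarrow> enat n \<le> ecodim_in UNIV R"
  proof
    assume "enat n \<le> edim (annihilator R)"
    then obtain \<Phi> where \<Phi>: "finite \<Phi>" "card \<Phi> = n" "cindependent \<Phi>" "\<Phi> \<subseteq> annihilator R"
      using independent_of_edim[OF csubspace_annihilator] by metis
    have "annihilator UNIV \<subseteq> {0}" by (auto simp: annihilator_def cdual_apply_zero intro: cdual_eqI)
    then have "cspan \<Phi> \<inter> annihilator UNIV \<subseteq> {0}" by blast
    then obtain x where x: "\<And>\<phi>. \<phi> \<in> \<Phi> \<Longrightarrow> cdual_apply \<phi> (x \<phi>) = 1"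
      "\<And>\<phi> \<psi>. \<phi> \<in> \<Phi> \<Longrightarrow> \<psi> \<in> \<Phi> \<Longrightarrow> \<phi> \<noteq> \<psi> \<Longrightarrow> cdual_apply \<phi> (x \<psi>) = 0"
      using biorthogonal_vectors[OF csubspace_UNIV \<Phi>(1,3)] by metis
    have "\<And>\<phi> y. \<phi> \<in> \<Phi> \<Longrightarrow> y \<in> R \<Longrightarrow> cdual_apply \<phi> y = 0" using \<Phi>(4) by (auto simp: annihilator_def)
    note ind = independent_if_biorthogonal[of \<Phi> cdual_apply x R,
        OF \<Phi>(1) cdual_apply_add cdual_apply_scaleC x this]
    show "enat n \<le> ecodim_in UNIV R"
      using ecodim_in_ge[OF R(1) _ ind(1) subset_UNIV ind(3)] \<Phi>(1,2) ind(2) by simp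
  next
    assume "enat n \<le> ecodim_in UNIV R"
    then obtain B where B: "finite B" "card B = n" "cindependent B" "cspan B \<inter> R \<subseteq> {0}"
      using independent_mod_of_ecodim_in[OF R(1)] by metis
    obtain \<phi> where \<phi>: "\<And>b. b \<in> B \<Longrightarrow> cdual_apply (\<phi> b) b = 1"
      "\<And>b b'. b \<in> B \<Longrightarrow> b' \<in> B \<Longrightarrow> b' \<noteq> b \<Longrightarrow> cdual_apply (\<phi> b) b' = 0"
      "\<And>b x. b \<in> B \<Longrightarrow> x \<in> R \<Longrightarrow> cdual_apply (\<phi> b) x = 0"
      using biorthogonal_functionals[OF R B(1,3,4)] by blast
    have ind: "cindependent (\<phi> ` B)" "card (\<phi> ` B) = card B"
      using independent_if_biorthogonal[of B "\<lambda>b \<psi>. cdual_apply \<psi> b" \<phi> "{}",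
          OF B(1) cdual_apply_plus cdual_apply_scale] \<phi>(1,2) by auto
    have "\<phi> ` B \<subseteq> annihilator R" using \<phi>(3) by (auto simp: annihilator_def)
    then show "enat n \<le> edim (annihilator R)"
      using edim_ge[OF csubspace_annihilator _ ind(1)] B(1,2) ind(2) by simp
  qed
qed

lemma ecodim_annihilator:
  assumes N: "csubspace N"
  shows "ecodim_in UNIV (annihilator N) = edim N"
proof (rule enat_eqI)
  fix n
  show "enat n \<le> ecodim_in UNIV (annihilator N) \<longleftrightarrow> enat n \<le> edim N"
  proof
    assume "enat n \<le> ecodim_in UNIV (annihilator N)"
    then obtain \<Phi> where \<Phi>: "finite \<Phi>" "card \<Phi> = n" "cindependent \<Phi>" "cspan \<Phi> \<inter> annihilator N \<subseteq> {0}"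
      using independent_mod_of_ecodim_in[OF csubspace_annihilator] by metis
    obtain x where x: "\<And>\<phi>. \<phi> \<in> \<Phi> \<Longrightarrow> x \<phi> \<in> N" "\<And>\<phi>. \<phi> \<in> \<Phi> \<Longrightarrow> cdual_apply \<phi> (x \<phi>) = 1"
      "\<And>\<phi> \<psi>. \<phi> \<in> \<Phi> \<Longrightarrow> \<psi> \<in> \<Phi> \<Longrightarrow> \<phi> \<noteq> \<psi> \<Longrightarrow> cdual_apply \<phi> (x \<psi>) = 0"
      using biorthogonal_vectors[OF N \<Phi>(1,3,4)] by blast
    have ind: "cindependent (x ` \<Phi>)" "card (x ` \<Phi>) = card \<Phi>"
      using independent_if_biorthogonal[of \<Phi> cdual_apply x "{}",
          OF \<Phi>(1) cdual_apply_add cdual_apply_scaleC] x(2,3) by auto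
    show "enat n \<le> edim N"
      using edim_ge[OF N _ ind(1)] \<Phi>(1,2) ind(2) x(1) by (simp add: image_subset_iff)
  next
    assume "enat n \<le> edim N"
    then obtain B where B: "finite B" "card B = n" "cindependent B" "B \<subseteq> N"
      using independent_of_edim[OF N] by metis
    obtain \<phi> where \<phi>: "\<And>b. b \<in> B \<Longrightarrow> cdual_apply (\<phi> b) b = 1"
      "\<And>b b'. b \<in> B \<Longrightarrow> b' \<in> B \<Longrightarrow> b' \<noteq> b \<Longrightarrow> cdual_apply (\<phi> b) b' = 0"
      by (rule biorthogonal_functionals[of "{0}" B])
        (use B(1,3) in \<open>auto simp: csubspace_single_0\<close>)
    have "\<And>b \<psi>. b \<in> B \<Longrightarrow> \<psi> \<in> annihilator N \<Longrightarrow> cdual_apply \<psi> b = 0"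
      using B(4) by (auto simp: annihilator_def)
    then have ind: "cindependent (\<phi> ` B)" "card (\<phi> ` B) = card B" "cspan (\<phi> ` B) \<inter> annihilator N \<subseteq> {0}"
      using independent_if_biorthogonal[of B "\<lambda>b \<psi>. cdual_apply \<psi> b" \<phi> "annihilator N",
          OF B(1) cdual_apply_plus cdual_apply_scale] \<phi> by auto
    show "enat n \<le> ecodim_in UNIV (annihilator N)"
      using ecodim_in_ge[OF csubspace_annihilator _ ind(1) subset_UNIV ind(3)] B(1,2) ind(2) by simp
  qed
qed

lemma closed_range_dual_op_iff:
  fixes A :: "'a::complex_banach \<Rightarrow> 'a"
  assumes A: "bounded_clinear A"
  shows "closed (range (dual_op A)) \<longleftrightarrow> closed (range A)"
  using closed_range_if_closed_range_dual_op[OF A] range_dual_op[OF A] closed_annihilator by metis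

lemma nullity_dual_op:
  fixes A :: "'a::complex_banach \<Rightarrow> 'a"
  assumes A: "bounded_clinear A" and cl: "closed (range A)"
  shows "nullity (dual_op A) = deficiency_on UNIV A"
  unfolding nullity_on_def deficiency_on_def
  using edim_annihilator[OF csubspace_image[OF A csubspace_UNIV] cl] kernel_dual_op[OF A] by simp

lemma deficiency_dual_op:
  fixes A :: "'a::complex_banach \<Rightarrow> 'a"
  assumes A: "bounded_clinear A" and cl: "closed (range A)"
  shows "deficiency_on UNIV (dual_op A) = nullity A"
  unfolding nullity_on_def deficiency_on_def
  using ecodim_annihilator[OF csubspace_kernel[OF A]] range_dual_op[OF A cl] by simp

lemma lower_semi_weyl_on_iff:
  "lower_semi_weyl_on M A \<longleftrightarrow>
     closed (A ` M) \<and> deficiency_on M A < \<infinity> \<and> deficiency_on M A \<le> nullity_on M A"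
proof -
  have "fredholm_index_on M A \<ge> 0 \<longleftrightarrow> deficiency_on M A \<le> nullity_on M A" if "deficiency_on M A < \<infinity>"
    using that unfolding fredholm_index_on_def
    by (cases "nullity_on M A"; cases "deficiency_on M A") auto
  then show ?thesis unfolding lower_semi_weyl_on_def lower_semi_fredholm_on_def by blast
qed

lemma upper_weyl_spectrum_dual_op:
  fixes T :: "'a::complex_banach \<Rightarrow> 'a"
  assumes T: "bounded_clinear T"
  shows "upper_weyl_spectrum (dual_op T) = lower_weyl_spectrum T"
proof -
  have "upper_semi_weyl (dual_op A) \<longleftrightarrow> lower_semi_weyl A" if A: "bounded_clinear A" for A :: "'a \<Rightarrow> 'a"
    using closed_range_dual_op_iff[OF A] nullity_dual_op[OF A] deficiency_dual_op[OF A]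
    unfolding upper_semi_weyl_on_iff lower_semi_weyl_on_iff by (cases "closed (range A)") simp_all
  from this[OF bounded_clinear_shift_op[OF T]] show ?thesis
    by (simp add: upper_weyl_spectrum_def lower_weyl_spectrum_def dual_op_shift_op[OF T])
qed

section \<open>The single-valued extension property\<close>

text \<open>By the identity theorem, applied to \<open>f\<close> composed with the functionals, an analytic family of
  eigenvectors that vanishes near one point vanishes throughout a connected neighbourhood.\<close>

lemma SVEP_at_if_injective_nearby:
  fixes S :: "'a::complex_normed_vector \<Rightarrow> 'a"
  assumes \<epsilon>: "\<epsilon> > 0"
    and inj: "\<And>\<mu> x. \<mu> \<noteq> \<kappa> \<Longrightarrow> dist \<mu> \<kappa> < \<epsilon> \<Longrightarrow> shift_op S \<mu> x = 0 \<Longrightarrow> x = 0"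
  shows "SVEP_at S \<kappa>"
  unfolding SVEP_at_def
proof (intro allI impI ballI, elim conjE)
  fix U f w
  assume U: "open U" "connected U" "\<kappa> \<in> U" and f: "vector_analytic_on f U"
    and eq: "\<forall>\<mu>\<in>U. shift_op S \<mu> (f \<mu>) = 0" and w: "w \<in> U"
  define V where "V = U \<inter> ball \<kappa> \<epsilon> - {\<kappa>}"
  have lim: "\<kappa> islimpt V"
  proof -
    have "\<kappa> islimpt U \<inter> ball \<kappa> \<epsilon>" using U \<epsilon> by (intro interior_limit_point) (simp add: interior_open open_Int)
    then show ?thesis unfolding V_def by (simp add: islimpt_punctured[symmetric])
  qed
  show "f w = 0"
  proof (rule eq_zero_if_functionals_vanish)
    fix \<phi>
    have "(\<lambda>z. cdual_apply \<phi> (f z)) holomorphic_on U"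
      unfolding holomorphic_on_def
    proof
      fix z assume z: "z \<in> U"
      then obtain D where "(f has_derivative (\<lambda>h. h *\<^sub>C D)) (at z)" using f by (auto simp: vector_analytic_on_def)
      from bounded_linear.has_derivative[OF bounded_linear_cdual_apply this, of \<phi>]
      have "((\<lambda>z. cdual_apply \<phi> (f z)) has_field_derivative cdual_apply \<phi> D) (at z)"
        by (simp add: has_field_derivative_def cdual_apply_scaleC mult.commute[of _ "cdual_apply \<phi> D"])
      then show "(\<lambda>z. cdual_apply \<phi> (f z)) field_differentiable at z within U"
        by (meson field_differentiable_at_within field_differentiable_def)
    qed
    then show "cdual_apply \<phi> (f w) = 0"
    proof (rule analytic_continuation[OF _ U(1,2) _ U(3) lim _ w])
      show "V \<subseteq> U" by (auto simp: V_def)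
      show "cdual_apply \<phi> (f z) = 0" if "z \<in> V" for z
        using inj[of z "f z"] eq that by (auto simp: V_def dist_commute cdual_apply_zero_right)
    qed
  qed
qed

text \<open>If \<open>N(A\<^sup>n) \<subseteq> R(A)\<close> for all \<open>n\<close>, any kernel vector starts an infinite backward orbit, and
  its power series is an analytic family of eigenvectors.\<close>

lemma injective_if_SVEP_at:
  fixes T :: "'a::complex_banach \<Rightarrow> 'a"
  assumes T: "bounded_clinear T" and cl: "closed (range (shift_op T \<kappa>))"
    and ker: "\<And>n x. (shift_op T \<kappa> ^^ n) x = 0 \<Longrightarrow> x \<in> range (shift_op T \<kappa>)"
    and SVEP: "SVEP_at T \<kappa>" and x0: "shift_op T \<kappa> x0 = 0"
  shows "x0 = 0"
proof -
  define A where "A = shift_op T \<kappa>"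
  have A: "bounded_clinear A" unfolding A_def by (rule bounded_clinear_shift_op[OF T])
  define S where "S = {x. \<exists>n. (A ^^ n) x = 0}"
  have "S \<subseteq> range A" using ker by (auto simp: S_def A_def)
  moreover have "x \<in> S" if Ax: "A x \<in> S" for x
  proof -
    obtain n where "(A ^^ n) (A x) = 0" using Ax by (auto simp: S_def)
    then have "(A ^^ Suc n) x = 0" by (simp add: funpow_swap1)
    then show ?thesis unfolding S_def by blast
  qed
  ultimately obtain K where K: "K > 0" and orb: "\<And>x0. x0 \<in> S \<Longrightarrow> \<exists>x. x 0 = x0 \<and> (\<forall>k. x k \<in> S) \<and>
    (\<forall>k. A (x (Suc k)) = x k) \<and> (\<forall>k. norm (x k) \<le> norm x0 * K ^ k)"
    using backward_orbit_exists[OF A csubspace_UNIV closed_UNIV, of S] cl unfolding A_def by blast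
  have "(A ^^ 1) x0 = 0" using x0 by (simp add: A_def)
  then have "x0 \<in> S" unfolding S_def by blast
  then obtain x where x: "x 0 = x0" "\<And>k. A (x (Suc k)) = x k" "\<And>k. norm (x k) \<le> norm x0 * K ^ k"
    using orb by blast
  define h where "h \<mu> = (\<Sum>k. \<mu> ^ k *\<^sub>C x k)" for \<mu>
  define f where "f z = h (z - \<kappa>)" for z
  have h: "vector_analytic_on h (ball 0 (1/K))" unfolding h_def by (rule vector_analytic_power_series[OF x(3) K])
  have "vector_analytic_on f (ball \<kappa> (1/K))"
    unfolding vector_analytic_on_def
  proof
    fix z assume "z \<in> ball \<kappa> (1/K)"
    then have "z - \<kappa> \<in> ball 0 (1/K)" by (simp add: dist_norm norm_minus_commute)
    then obtain D where D: "(h has_derivative (\<lambda>v. v *\<^sub>C D)) (at (z - \<kappa>))"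
      using h unfolding vector_analytic_on_def by blast
    have "((\<lambda>z. z - \<kappa>) has_derivative (\<lambda>v. v)) (at z)" by (auto intro!: derivative_eq_intros)
    from has_derivative_compose[OF this D]
    have "(f has_derivative (\<lambda>v. v *\<^sub>C D)) (at z)" by (simp add: f_def[abs_def])
    then show "\<exists>D. (f has_derivative (\<lambda>h. h *\<^sub>C D)) (at z)" by blast
  qed
  moreover have "shift_op T \<mu> (f \<mu>) = 0" if "\<mu> \<in> ball \<kappa> (1/K)" for \<mu>
  proof -
    have "cmod (\<mu> - \<kappa>) < 1/K" using that by (simp add: dist_norm norm_minus_commute)
    from backward_orbit_sum[OF A x(2,3) K this] show ?thesis
      using x0 x(1) unfolding f_def h_def shift_op_recenter[of T \<mu> \<kappa>] A_def by simp
  qed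
  moreover have "\<kappa> \<in> ball \<kappa> (1/K)" using K by simp
  ultimately have "f \<kappa> = 0"
    using SVEP unfolding SVEP_at_def by (metis open_ball connected_ball)
  then show ?thesis by (simp add: f_def h_def vector_power_series_0 x(1))
qed

lemma deficiency_eq_0_iff:
  assumes A: "bounded_clinear A"
  shows "deficiency_on UNIV A = 0 \<longleftrightarrow> range A = UNIV"
proof
  assume 0: "deficiency_on UNIV A = 0"
  then have "ecodim_in UNIV (range A) < \<infinity>" by (simp add: deficiency_on_def)
  then obtain B where B: "finite B" "UNIV \<subseteq> cspan (range A \<union> B)" "ecodim_in UNIV (range A) = enat (card B)"
    by (rule ecodim_in_attained)
  then have "B = {}" using 0 by (simp add: deficiency_on_def zero_enat_def)
  then show "range A = UNIV"
    using B(2) cspan_csubspace[OF csubspace_image[OF A csubspace_UNIV]] by auto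
next
  assume "range A = UNIV"
  then have "UNIV \<subseteq> cspan (range A \<union> {})" by (simp add: complex_vector.span_UNIV)
  from ecodim_in_le[OF finite.emptyI empty_subsetI this] show "deficiency_on UNIV A = 0"
    by (simp add: deficiency_on_def zero_enat_def[symmetric])
qed

lemma nullity_eq_0_iff:
  assumes A: "bounded_clinear A"
  shows "nullity A = 0 \<longleftrightarrow> (\<forall>x. A x = 0 \<longrightarrow> x = 0)"
  using edim_eq_0_iff[OF csubspace_kernel[OF A]] bounded_clinear_zero[OF A]
  by (auto simp: nullity_on_def)

lemma notin_op_spectrum_if_bijective:
  fixes T :: "'a::complex_banach \<Rightarrow> 'a"
  assumes T: "bounded_clinear T" and "nullity (shift_op T \<mu>) = 0" "deficiency_on UNIV (shift_op T \<mu>) = 0"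
  shows "\<mu> \<notin> op_spectrum T"
proof -
  have A: "bounded_clinear (shift_op T \<mu>)" by (rule bounded_clinear_shift_op[OF T])
  have surj: "range (shift_op T \<mu>) = UNIV" using assms(3) deficiency_eq_0_iff[OF A] by blast
  then have cl: "closed (range (shift_op T \<mu>))" by simp
  have inj: "x = 0" if "shift_op T \<mu> x = 0" for x using assms(2) nullity_eq_0_iff[OF A] that by blast
  obtain c where "c > 0" "\<And>x. x \<in> UNIV \<Longrightarrow> c * norm x \<le> norm (shift_op T \<mu> x)"
    using bounded_below_if_inj_closed_image[OF bounded_clinear_imp_bounded_linear[OF A] subspace_UNIV
        closed_UNIV cl inj] by blast
  then show ?thesis using surj notin_op_spectrum_iff[OF T] by blast
qed

text \<open>Near a point off the upper semi-Weyl spectrum, \<open>A = T - \<mu>\<close> is again upper semi-Weyl and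
  has its kernel in its hyper-range.\<close>

lemma kernel_in_hyper_range_near_weyl_point:
  fixes T :: "'a::complex_banach \<Rightarrow> 'a"
  assumes T: "bounded_clinear T" and \<kappa>: "\<kappa> \<notin> upper_weyl_spectrum T"
  obtains \<epsilon> where "\<epsilon> > 0" "\<And>\<mu>. dist \<mu> \<kappa> < \<epsilon> \<Longrightarrow> \<mu> \<notin> upper_weyl_spectrum T"
    "\<And>\<mu> x n. \<mu> \<noteq> \<kappa> \<Longrightarrow> dist \<mu> \<kappa> < \<epsilon> \<Longrightarrow> shift_op T \<mu> x = 0 \<Longrightarrow> x \<in> range (shift_op T \<mu> ^^ n)"
proof -
  obtain \<epsilon>1 where \<epsilon>1: "\<epsilon>1 > 0" "\<And>\<mu>. dist \<mu> \<kappa> < \<epsilon>1 \<Longrightarrow> \<mu> \<notin> upper_weyl_spectrum T"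
    using upper_weyl_spectrum_closed_complement[OF T \<kappa>] by blast
  have W: "closed (range (shift_op T \<kappa>))" "edim {x. shift_op T \<kappa> x = 0} < \<infinity>"
    using \<kappa> by (auto simp: upper_weyl_spectrum_def upper_semi_weyl_on_iff nullity_on_def)
  obtain \<epsilon>2 where \<epsilon>2: "\<epsilon>2 > 0" "\<And>\<mu> x n. \<mu> \<noteq> 0 \<Longrightarrow> cmod \<mu> < \<epsilon>2 \<Longrightarrow>
      shift_op (shift_op T \<kappa>) \<mu> x = 0 \<Longrightarrow> x \<in> range (shift_op (shift_op T \<kappa>) \<mu> ^^ n)"
    using kernel_in_hyper_range_of_shift[OF bounded_clinear_shift_op[OF T] W] by blast
  show ?thesis
  proof (rule that[of "min \<epsilon>1 \<epsilon>2"])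
    show "x \<in> range (shift_op T \<mu> ^^ n)"
      if "\<mu> \<noteq> \<kappa>" "dist \<mu> \<kappa> < min \<epsilon>1 \<epsilon>2" "shift_op T \<mu> x = 0" for \<mu> x n
      using \<epsilon>2(2)[of "\<mu> - \<kappa>" x n] that unfolding shift_op_recenter[of T \<mu> \<kappa>] by (simp add: dist_norm)
  qed (use \<epsilon>1 \<epsilon>2(1) in auto)
qed

text \<open>For the converse let \<open>A = T - \<mu>\<close> with \<open>\<mu>\<close> near a Weyl point. From \<open>N(A) \<subseteq> R(A\<^sup>n)\<close> one gets
  \<open>N((A\<^sup>*)\<^sup>n) = R(A\<^sup>n)\<^sup>\<bottom> \<subseteq> N(A)\<^sup>\<bottom> = R(A\<^sup>*)\<close>, so that the SVEP makes \<open>A\<^sup>*\<close> injective. Then \<open>A\<close> has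
  deficiency \<open>0\<close>, and a nonpositive index leaves nullity \<open>0\<close>.\<close>

theorem weyl_points_isolated_iff_SVEP_dual:
  fixes T :: "'a::complex_banach \<Rightarrow> 'a"
  assumes T: "bounded_clinear T"
  shows "weyl_points_isolated T \<longleftrightarrow> SVEP_on (dual_op T) (- upper_weyl_spectrum T)"
proof
  assume iso: "weyl_points_isolated T"
  show "SVEP_on (dual_op T) (- upper_weyl_spectrum T)"
    unfolding SVEP_on_def
  proof
    fix \<kappa> assume "\<kappa> \<in> - upper_weyl_spectrum T"
    then obtain \<epsilon> where \<epsilon>: "\<epsilon> > 0" "\<And>\<mu>. \<mu> \<noteq> \<kappa> \<Longrightarrow> dist \<mu> \<kappa> < \<epsilon> \<Longrightarrow> \<mu> \<notin> op_spectrum T"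
      using iso unfolding weyl_points_isolated_def by blast
    show "SVEP_at (dual_op T) \<kappa>"
    proof (rule SVEP_at_if_injective_nearby[OF \<epsilon>(1)])
      fix \<mu> \<phi> assume "\<mu> \<noteq> \<kappa>" "dist \<mu> \<kappa> < \<epsilon>" and 0: "shift_op (dual_op T) \<mu> \<phi> = 0"
      then have "range (shift_op T \<mu>) = UNIV" using \<epsilon>(2) notin_op_spectrum_iff[OF T] by blast
      moreover have "\<phi> \<in> annihilator (range (shift_op T \<mu>))"
        using 0 kernel_dual_op[OF bounded_clinear_shift_op[OF T]] dual_op_shift_op[OF T] by auto
      ultimately show "\<phi> = 0" by (auto simp: annihilator_def cdual_apply_zero intro: cdual_eqI)
    qed
  qed
next
  assume SVEP: "SVEP_on (dual_op T) (- upper_weyl_spectrum T)"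
  have D: "bounded_clinear (dual_op T)" by (rule bounded_clinear_dual_op[OF T])
  show "weyl_points_isolated T"
    unfolding weyl_points_isolated_def
  proof (intro allI impI)
    fix \<kappa> assume "\<kappa> \<notin> upper_weyl_spectrum T"
    then obtain \<epsilon> where \<epsilon>: "\<epsilon> > 0" "\<And>\<mu>. dist \<mu> \<kappa> < \<epsilon> \<Longrightarrow> \<mu> \<notin> upper_weyl_spectrum T"
      "\<And>\<mu> x n. \<mu> \<noteq> \<kappa> \<Longrightarrow> dist \<mu> \<kappa> < \<epsilon> \<Longrightarrow> shift_op T \<mu> x = 0 \<Longrightarrow> x \<in> range (shift_op T \<mu> ^^ n)"
      using kernel_in_hyper_range_near_weyl_point[OF T] by blast
    have "\<mu> \<notin> op_spectrum T" if \<mu>: "\<mu> \<noteq> \<kappa>" "dist \<mu> \<kappa> < \<epsilon>" for \<mu>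
    proof -
      define A where "A = shift_op T \<mu>"
      have A: "bounded_clinear A" unfolding A_def by (rule bounded_clinear_shift_op[OF T])
      have DA: "shift_op (dual_op T) \<mu> = dual_op A" by (simp add: A_def dual_op_shift_op[OF T])
      have cl: "closed (range A)" and le: "nullity A \<le> deficiency_on UNIV A"
        using \<epsilon>(2)[OF \<mu>(2)] by (auto simp: upper_weyl_spectrum_def upper_semi_weyl_on_iff A_def)
      have "\<phi> = 0" if \<phi>: "dual_op A \<phi> = 0" for \<phi>
      proof (rule injective_if_SVEP_at[OF D, of \<mu>, unfolded DA])
        show "closed (range (dual_op A))" using closed_range_dual_op_iff[OF A] cl by blast
        show "SVEP_at (dual_op T) \<mu>" using SVEP \<epsilon>(2)[OF \<mu>(2)] by (auto simp: SVEP_on_def)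
        fix n \<psi> assume \<psi>: "(dual_op A ^^ n) \<psi> = 0"
        have "cdual_apply \<psi> x = 0" if x: "A x = 0" for x
        proof -
          obtain y where "x = (A ^^ n) y" using \<epsilon>(3)[OF \<mu>, of x n] x by (auto simp: A_def)
          then show ?thesis using cdual_apply_dual_op_funpow[OF A, of n \<psi> y] \<psi> by (simp add: cdual_apply_zero)
        qed
        then show "\<psi> \<in> range (dual_op A)" by (simp add: range_dual_op[OF A cl] annihilator_def)
      qed (rule \<phi>)
      then have "nullity (dual_op A) = 0"
        using nullity_eq_0_iff[OF bounded_clinear_dual_op[OF A]] by blast
      then have "deficiency_on UNIV A = 0" using nullity_dual_op[OF A cl] by simp
      then show ?thesis
        using notin_op_spectrum_if_bijective[OF T, of \<mu>] le unfolding A_def by simp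
    qed
    then show "\<exists>\<epsilon>>0. \<forall>\<mu>. \<mu> \<noteq> \<kappa> \<and> dist \<mu> \<kappa> < \<epsilon> \<longrightarrow> \<mu> \<notin> op_spectrum T" using \<epsilon>(1) by blast
  qed
qed

text \<open>Here \<open>N(A\<^sup>*) \<subseteq> R((A\<^sup>*)\<^sup>n)\<close> gives \<open>N(A\<^sup>n) \<subseteq> R(A)\<close>: a functional in \<open>N(A\<^sup>*) = R(A)\<^sup>\<bottom>\<close>
  vanishes on \<open>N(A\<^sup>n)\<close>, and \<open>R(A)\<close> is closed. So the SVEP of \<open>T\<close> makes \<open>A\<close> injective, and the
  nonnegative index makes it surjective.\<close>

theorem weyl_points_isolated_dual_iff_SVEP:
  fixes T :: "'a::complex_banach \<Rightarrow> 'a"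
  assumes T: "bounded_clinear T"
  shows "weyl_points_isolated (dual_op T) \<longleftrightarrow> SVEP_on T (- lower_weyl_spectrum T)"
proof
  have D: "bounded_clinear (dual_op T)" by (rule bounded_clinear_dual_op[OF T])
  note spec = upper_weyl_spectrum_dual_op[OF T]
  {
    assume iso: "weyl_points_isolated (dual_op T)"
    show "SVEP_on T (- lower_weyl_spectrum T)"
      unfolding SVEP_on_def
    proof
      fix \<kappa> assume "\<kappa> \<in> - lower_weyl_spectrum T"
      then obtain \<epsilon> where \<epsilon>: "\<epsilon> > 0" "\<And>\<mu>. \<mu> \<noteq> \<kappa> \<Longrightarrow> dist \<mu> \<kappa> < \<epsilon> \<Longrightarrow> \<mu> \<notin> op_spectrum (dual_op T)"
        using iso spec unfolding weyl_points_isolated_def by blast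
      show "SVEP_at T \<kappa>"
      proof (rule SVEP_at_if_injective_nearby[OF \<epsilon>(1)])
        fix \<mu> x assume "\<mu> \<noteq> \<kappa>" "dist \<mu> \<kappa> < \<epsilon>" and 0: "shift_op T \<mu> x = 0"
        then have surj: "range (shift_op (dual_op T) \<mu>) = UNIV"
          using \<epsilon>(2) notin_op_spectrum_iff[OF D] by blast
        show "x = 0"
        proof (rule eq_zero_if_functionals_vanish)
          fix \<phi>
          obtain \<psi> where "\<phi> = dual_op (shift_op T \<mu>) \<psi>"
            using surj unfolding dual_op_shift_op[OF T] by (metis surjD)
          then show "cdual_apply \<phi> x = 0"
            using 0 by (simp add: cdual_apply_dual_op[OF bounded_clinear_shift_op[OF T]] cdual_apply_zero_right)
        qed
      qed
    qed
  next
    assume SVEP: "SVEP_on T (- lower_weyl_spectrum T)"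
    show "weyl_points_isolated (dual_op T)"
      unfolding weyl_points_isolated_def
    proof (intro allI impI)
      fix \<kappa> assume "\<kappa> \<notin> upper_weyl_spectrum (dual_op T)"
      then obtain \<epsilon> where \<epsilon>: "\<epsilon> > 0" "\<And>\<mu>. dist \<mu> \<kappa> < \<epsilon> \<Longrightarrow> \<mu> \<notin> upper_weyl_spectrum (dual_op T)"
        "\<And>\<mu> \<phi> n. \<mu> \<noteq> \<kappa> \<Longrightarrow> dist \<mu> \<kappa> < \<epsilon> \<Longrightarrow> shift_op (dual_op T) \<mu> \<phi> = 0 \<Longrightarrow>
          \<phi> \<in> range (shift_op (dual_op T) \<mu> ^^ n)"
        using kernel_in_hyper_range_near_weyl_point[OF D] by blast
      have "\<mu> \<notin> op_spectrum (dual_op T)" if \<mu>: "\<mu> \<noteq> \<kappa>" "dist \<mu> \<kappa> < \<epsilon>" for \<mu>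
      proof -
        define A where "A = shift_op T \<mu>"
        have A: "bounded_clinear A" unfolding A_def by (rule bounded_clinear_shift_op[OF T])
        have DA: "shift_op (dual_op T) \<mu> = dual_op A" by (simp add: A_def dual_op_shift_op[OF T])
        have \<mu>l: "\<mu> \<notin> lower_weyl_spectrum T" using \<epsilon>(2)[OF \<mu>(2)] spec by simp
        have cl: "closed (range A)" and le: "deficiency_on UNIV A \<le> nullity A"
          using \<mu>l by (auto simp: lower_weyl_spectrum_def lower_semi_weyl_on_iff A_def)
        have "x = 0" if x: "A x = 0" for x
        proof (rule injective_if_SVEP_at[OF T, of \<mu>, folded A_def])
          show "closed (range A)" by (rule cl)
          show "SVEP_at T \<mu>" using SVEP \<mu>l by (auto simp: SVEP_on_def)
          fix n y assume y: "(A ^^ n) y = 0"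
          show "y \<in> range A"
          proof (rule ccontr)
            assume "y \<notin> range A"
            then obtain \<phi> where \<phi>: "cdual_apply \<phi> y = 1" "\<And>z. z \<in> range A \<Longrightarrow> cdual_apply \<phi> z = 0"
              using separate_from_closed_csubspace[OF csubspace_image[OF A csubspace_UNIV] cl] by blast
            have "\<phi> \<in> annihilator (range A)" using \<phi>(2) by (simp add: annihilator_def)
            then have "dual_op A \<phi> = 0" using kernel_dual_op[OF A] by blast
            then have "\<phi> \<in> range (dual_op A ^^ n)" using \<epsilon>(3)[OF \<mu>, of \<phi> n] unfolding DA by blast
            then obtain \<psi> where "\<phi> = (dual_op A ^^ n) \<psi>" by blast
            then have "cdual_apply \<phi> y = 0"
              using y by (simp add: cdual_apply_dual_op_funpow[OF A] cdual_apply_zero_right)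
            then show False using \<phi>(1) by simp
          qed
        qed (rule x)
        then have null: "nullity A = 0" using nullity_eq_0_iff[OF A] by blast
        then have "deficiency_on UNIV A = 0" using le by simp
        then have "nullity (dual_op A) = 0" "deficiency_on UNIV (dual_op A) = 0"
          using null nullity_dual_op[OF A cl] deficiency_dual_op[OF A cl] by simp_all
        then show ?thesis using notin_op_spectrum_if_bijective[OF D, of \<mu>] unfolding DA by blast
      qed
      then show "\<exists>\<epsilon>>0. \<forall>\<mu>. \<mu> \<noteq> \<kappa> \<and> dist \<mu> \<kappa> < \<epsilon> \<longrightarrow> \<mu> \<notin> op_spectrum (dual_op T)"
        using \<epsilon>(1) by blast
    qed
  }
qed

theorem corollary2p5:
  fixes T :: "'a::complex_banach \<Rightarrow> 'a"
  assumes infinite_dimensional: "edim (UNIV :: 'a set) = \<infinity>"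
    and T: "bounded_clinear T"
  shows
    "(property_z T \<longleftrightarrow>
        SVEP_on (dual_op T) (- upper_weyl_spectrum T) \<and> pi_00_a T = left_poles_finite_rank T) \<and>
     (finitely_a_polaroid T \<longrightarrow>
        (property_z T \<longleftrightarrow> SVEP_on (dual_op T) (- upper_weyl_spectrum T))) \<and>
     (property_gz T \<longleftrightarrow>
        SVEP_on (dual_op T) (- upper_weyl_spectrum T) \<and> pi_0_a T = left_poles T) \<and>
     (a_polaroid T \<longrightarrow>
        (property_gz T \<longleftrightarrow> SVEP_on (dual_op T) (- upper_weyl_spectrum T))) \<and>
     (property_z (dual_op T) \<longleftrightarrow>
        SVEP_on T (- lower_weyl_spectrum T) \<and>
        pi_00_a (dual_op T) = left_poles_finite_rank (dual_op T)) \<and>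
     (property_gz (dual_op T) \<longleftrightarrow>
        SVEP_on T (- lower_weyl_spectrum T) \<and> pi_0_a (dual_op T) = left_poles (dual_op T))"
proof -
  have D: "bounded_clinear (dual_op T)" by (rule bounded_clinear_dual_op[OF T])
  note iso = weyl_points_isolated_iff_SVEP_dual[OF T] weyl_points_isolated_dual_iff_SVEP[OF T]
  show ?thesis
    using property_z_iff[OF T] property_gz_iff[OF T] property_z_iff[OF D] property_gz_iff[OF D]
      pi_00_a_eq_left_poles_if_finitely_a_polaroid[OF T] pi_0_a_eq_left_poles_if_a_polaroid[OF T]
    unfolding iso by blast
qed

end
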